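(* Let $P=(a,b)\in\mathcal{C}(K)$. Then the $2^{2g}$-element set $$M_{1/2,P}:=\{\mathfrak{a}\in J(K)\mid 2\mathfrak{a}=P\in\mathcal{C}(K)\subset J(K)\}$$ can be described as follows. Let $\mathfrak{R}_{1/2,P}$ be the set of all $(2g+1)$-tuples $\mathfrak{r}=(\mathfrak{r}_1,\dots,\mathfrak{r}_{2g+1})$ of elements of $K$ such that $$\mathfrak{r}_i^2=a-\alpha_i\ \text{ for all } i=1,\dots,2g+1;\qquad \prod_{i=1}^{2g+1}\mathfrak{r}_i=-b.$$ Let $\mathbf{s}_i(\mathfrak{r})$ be the $i$th basic (elementary) symmetric function in $\mathfrak{r}_1,\dots,\mathfrak{r}_{2g+1}$. Put $$U_{\mathfrak{r}}(x)=(-1)^g\left[(a-x)^g+\sum_{j=1}^g\mathbf{s}_{2j}(\mathfrak{r})(a-x)^{g-j}\right],$$ $$V_{\mathfrak{r}}(x)=\left[\sum_{j=1}^g\mathbf{s}_{2j-1}(\mathfrak{r})(a-x)^{g-j+1}\right]-b-\mathbf{s}_1(\mathfrak{r})\left[(a-x)^g+\sum_{j=1}^g\mathbf{s}_{2j}(\mathfrak{r})(a-x)^{g-j}\right].$$ Then there is a natural bijection between $\mathfrak{R}_{1/2,P}$ and $M_{1/2,P}$ such that $\mathfrak{r}\in\mathfrak{R}_{1/2,P}$ corresponds to the element $\mathfrak{a}_{\mathfrak{r}}\in M_{1/2,P}$ with Mumford's representation $(U_{\mathfrak{r}},V_{\mathfrak{r}})$. More explicitly, if $\{c_1,\dots,c_g\}$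 is the list of the $g$ roots (with multiplicities) of $U_{\mathfrak{r}}(x)$, then $\mathfrak{r}$ corresponds to $$\mathfrak{a}_{\mathfrak{r}}=\mathrm{cl}(D-g(\infty))\in J(K),\qquad 2\mathfrak{a}_{\mathfrak{r}}=P,$$ where $$D=D(\mathfrak{a}_{\mathfrak{r}})=\sum_{j=1}^g(Q_j),\qquad Q_j=(c_j,V_{\mathfrak{r}}(c_j))\in\mathcal{C}(K)\ \text{ for all } j=1,\dots,g.$$ In addition, none of the $\alpha_i$ is a root of $U_{\mathfrak{r}}(x)$ (i.e., the polynomials $U_{\mathfrak{r}}(x)$ and $f(x)$ are relatively prime) and $$\mathfrak{r}_i=\mathbf{s}_1(\mathfrak{r})+(-1)^g\frac{V_{\mathfrak{r}}(\alpha_i)}{U_{\mathfrak{r}}(\alpha_i)}\quad\text{ for all } i=1,\dots,2g+1.$$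
   Context: $K$ is an algebraically closed field of characteristic different from $2$, $g\ge 1$ is an integer, $\alpha_1,\dots,\alpha_{2g+1}$ are distinct elements of $K$, and $f(x)=\prod_{i=1}^{2g+1}(x-\alpha_i)$. $\mathcal{C}$ is the smooth projective model of the smooth affine plane $K$-curve $y^2=f(x)$; it is a genus $g$ hyperelliptic curve with exactly one infinite point, denoted $\infty$, so $\mathcal{C}(K)=\{(a,b)\in K^2\mid b^2=f(a)\}\sqcup\{\infty\}$. Put $\mathfrak{W}_i=(\alpha_i,0)\in\mathcal{C}(K)$. The hyperelliptic involution is $\iota:(x,y)\mapsto(x,-y)$, $\infty\mapsto\infty$. $J$ is the jacobian of $\mathcal{C}$, and for a degree zero divisor $D$ on $\mathcal{C}$, $\mathrm{cl}(D)\in J(K)$ is its linear equivalence class. $\mathcal{C}$ is identified with its image in $J$ under $P\mapsto\mathrm{cl}((P)-(\infty))$. If $D$ is an effective divisor of degree $m$ whose support does not contain $\infty$, then $D-m(\infty)$ is called semi-reduced if every $\mathfrak{W}_i$ in $\mathrm{supp}(D)$ appears in $D$ with multiplicity $1$, and whenever $Q\in\mathrm{supp}(D)$ is not one of the $\mathfrak{W}_i$, then $\iota(Q)\notin\mathrm{supp}(D)$. It is called reduced if in addition $m\le g$. Every $\mathfrak{a}\in J(K)$ equals $\mathrm{cl}(D-m(\infty))$ for exactly one $m\geq 0$ and one effective degree $m$ divisor $D=D(\mathfrak{a})$ with $D-m(\infty)$ reduced. Mumford's representation of $\mathfrak{a}$ is the unique pair $(U,V)$ of polynomials in $K[x]$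 such that, writing $D=\sum_{j=1}^m(Q_j)$ with $Q_j=(c_j,d_j)$, one has $U(x)=\prod_{j=1}^m(x-c_j)$, $\deg V<\deg U$, $U$ divides $V^2-f$, and $D-m(\infty)$ is the gcd (minimum) of the divisors of the rational functions $U(x)$ and $y-V(x)$ on $\mathcal{C}$, i.e. $D=\sum_{Q\ne\infty}\min(\mathrm{ord}_Q U(x),\mathrm{ord}_Q(y-V(x)))\,(Q)$; in particular $Q_j=(c_j,V(c_j))$. (For $\mathfrak{a}=0$ the pair is $(1,0)$.) *)

theory Defs
  imports
    "HOL-Algebra.Algebraic_Closure_Type"
    "HOL-Algebra.Free_Abelian_Groups"
begin

text \<open>
  Throughout, \<open>f\<close> is the right-hand side of the equation \<open>y\<^sup>2 = f(x)\<close>; it is meant to be monic and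
  separable of odd degree, over an algebraically closed field of characteristic other than 2.
\<close>

datatype 'a point = Infty | Aff 'a 'a

fun xcoord :: "'a point \<Rightarrow> 'a" where
  "xcoord (Aff a b) = a"
| "xcoord Infty = undefined"

fun hyp_inv :: "'a::ab_group_add point \<Rightarrow> 'a point" where
  "hyp_inv (Aff a b) = Aff a (- b)"
| "hyp_inv Infty = Infty"

definition curve :: "'a::comm_ring_1 poly \<Rightarrow> 'a point set" where
  "curve f = insert Infty {Aff a b | a b. b\<^sup>2 = poly f a}"

definition weierstrass_points :: "'a::comm_ring_1 poly \<Rightarrow> 'a point set" where
  "weierstrass_points f = {Aff c 0 | c. poly f c = 0}"

definition genus :: "'a::zero poly \<Rightarrow> nat" where
  "genus f = (Polynomial.degree f - 1) div 2"


section \<open>The function field\<close>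

text \<open>
  The function field \<open>K(x)[y]/(y\<^sup>2 - f)\<close> is realised as the subfield \<open>K(x) + K(x) y\<close> of an algebraic
  closure of \<open>K(x)\<close>, where \<open>y\<close> is a fixed square root of \<open>f\<close>. The choice of the square root is
  immaterial, since \<open>y \<mapsto> - y\<close> induces an automorphism over \<open>K(x)\<close>.
\<close>

type_synonym 'a ratfun = "'a poly fract alg_closure"

definition fn_of_poly :: "'a::field poly \<Rightarrow> 'a ratfun" where
  "fn_of_poly p = to_ac (Fraction_Field.Fract p 1)"

definition fn_x :: "'a::field ratfun" where
  "fn_x = fn_of_poly [:0, 1:]"

definition fn_y :: "'a::field poly \<Rightarrow> 'a ratfun" where
  "fn_y f = (SOME y. y\<^sup>2 = fn_of_poly f)"

definition function_field :: "'a::field poly \<Rightarrow> 'a ratfun set" where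
  "function_field f = {to_ac u + to_ac v * fn_y f | u v. True}"


section \<open>Local rings and orders of vanishing\<close>

text \<open>
  The smooth projective model is covered by two smooth affine plane charts, with coordinate functions
  \<open>(x, y)\<close> and \<open>(1/x, y/x\<^bsup>g+1\<^esup>)\<close>. For \<open>f = \<Prod> (x - \<alpha>\<^sub>i)\<close> of degree \<open>2g+1\<close>, the functions \<open>u = 1/x\<close>
  and \<open>w = y/x\<^bsup>g+1\<^esup>\<close> satisfy \<open>w\<^sup>2 = u \<Prod> (1 - \<alpha>\<^sub>i u)\<close>, and the infinite point is \<open>(u, w) = (0, 0)\<close>.
\<close>

fun chart :: "'a::field poly \<Rightarrow> 'a point \<Rightarrow> 'a ratfun \<times> 'a ratfun" where
  "chart f (Aff a b) = (fn_x, fn_y f)"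
| "chart f Infty = (1 / fn_x, fn_y f / fn_x ^ (genus f + 1))"

fun chart_coords :: "'a::field point \<Rightarrow> 'a \<times> 'a" where
  "chart_coords (Aff a b) = (a, b)"
| "chart_coords Infty = (0, 0)"

text \<open>
  A bivariate polynomial \<open>G(X, Y)\<close> is an element of \<open>K[X][Y]\<close>: the outer variable is \<open>Y\<close>.
\<close>

definition chart_fn :: "'a::field poly \<Rightarrow> 'a point \<Rightarrow> 'a poly poly \<Rightarrow> 'a ratfun" where
  "chart_fn f Q G = (case chart f Q of (u, w) \<Rightarrow>
     poly (map_poly (\<lambda>p. poly (map_poly (\<lambda>c. fn_of_poly [:c:]) p) u) G) w)"

definition chart_value :: "'a::field point \<Rightarrow> 'a poly poly \<Rightarrow> 'a" where
  "chart_value Q G = (case chart_coords Q of (a, b) \<Rightarrow> poly (map_poly (\<lambda>p. poly p a) G) b)"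

definition local_ring :: "'a::field poly \<Rightarrow> 'a point \<Rightarrow> 'a ratfun set" where
  "local_ring f Q = {chart_fn f Q G / chart_fn f Q H | G H. chart_value Q H \<noteq> 0}"

definition max_ideal :: "'a::field poly \<Rightarrow> 'a point \<Rightarrow> 'a ratfun set" where
  "max_ideal f Q =
     {chart_fn f Q G / chart_fn f Q H | G H. chart_value Q G = 0 \<and> chart_value Q H \<noteq> 0}"

definition uniformizer :: "'a::field poly \<Rightarrow> 'a point \<Rightarrow> 'a ratfun \<Rightarrow> bool" where
  "uniformizer f Q t \<longleftrightarrow> max_ideal f Q = {t * r | r. r \<in> local_ring f Q}"

text \<open>Only meaningful for nonzero functions \<open>h\<close>.\<close>

definition ord_at :: "'a::field poly \<Rightarrow> 'a point \<Rightarrow> 'a ratfun \<Rightarrow> int" where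
  "ord_at f Q h = (THE n. \<exists>t u. uniformizer f Q t \<and> u \<in> local_ring f Q - max_ideal f Q \<and>
                               h = t powi n * u)"


section \<open>Divisors and the group of points of the Jacobian\<close>

text \<open>
  As \<open>K\<close> is algebraically closed, \<open>J(K)\<close> is the group of degree zero divisors modulo principal
  divisors. The group is written multiplicatively, as usual in \<open>HOL-Algebra\<close>, whereas divisors are
  finitely supported functions and are added with \<open>+\<close>.
\<close>

definition div_degree :: "('a point \<Rightarrow>\<^sub>0 int) \<Rightarrow> int" where
  "div_degree D = (\<Sum>Q\<in>Poly_Mapping.keys D. Poly_Mapping.lookup D Q)"

definition div_group :: "'a::comm_ring_1 poly \<Rightarrow> ('a point \<Rightarrow>\<^sub>0 int) monoid" where
  "div_group f = free_Abelian_group (curve f)"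

definition div0_group :: "'a::comm_ring_1 poly \<Rightarrow> ('a point \<Rightarrow>\<^sub>0 int) monoid" where
  "div0_group f = (div_group f)\<lparr>carrier := {D \<in> carrier (div_group f). div_degree D = 0}\<rparr>"

definition principal_divisors :: "'a::field poly \<Rightarrow> ('a point \<Rightarrow>\<^sub>0 int) set" where
  "principal_divisors f = {D \<in> carrier (div_group f).
     \<exists>h\<in>function_field f - {0}. \<forall>Q\<in>curve f. Poly_Mapping.lookup D Q = ord_at f Q h}"

definition jacobian :: "'a::field poly \<Rightarrow> ('a point \<Rightarrow>\<^sub>0 int) set monoid" where
  "jacobian f = div0_group f Mod principal_divisors f"

definition cl :: "'a::field poly \<Rightarrow> ('a point \<Rightarrow>\<^sub>0 int) \<Rightarrow> ('a point \<Rightarrow>\<^sub>0 int) set" where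
  "cl f D = principal_divisors f #>\<^bsub>div0_group f\<^esub> D"

definition point_class :: "'a::field poly \<Rightarrow> 'a point \<Rightarrow> ('a point \<Rightarrow>\<^sub>0 int) set" where
  "point_class f P = cl f (frag_of P - frag_of Infty)"


section \<open>Reduced divisors and Mumford's representation\<close>

text \<open>
  Here \<open>D\<close> is the effective part of \<open>D - m(\<infinity>)\<close>, with \<open>m\<close> the degree of \<open>D\<close>.
\<close>

definition minus_infty :: "('a point \<Rightarrow>\<^sub>0 int) \<Rightarrow> ('a point \<Rightarrow>\<^sub>0 int)" where
  "minus_infty D = D - frag_cmul (div_degree D) (frag_of Infty)"

definition semi_reduced :: "'a::comm_ring_1 poly \<Rightarrow> ('a point \<Rightarrow>\<^sub>0 int) \<Rightarrow> bool" where
  "semi_reduced f D \<longleftrightarrow>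
     Poly_Mapping.keys D \<subseteq> curve f - {Infty} \<and>
     (\<forall>Q. Poly_Mapping.lookup D Q \<ge> 0) \<and>
     (\<forall>Q\<in>Poly_Mapping.keys D. Q \<in> weierstrass_points f \<longrightarrow> Poly_Mapping.lookup D Q = 1) \<and>
     (\<forall>Q\<in>Poly_Mapping.keys D. Q \<notin> weierstrass_points f \<longrightarrow> hyp_inv Q \<notin> Poly_Mapping.keys D)"

definition reduced :: "'a::comm_ring_1 poly \<Rightarrow> ('a point \<Rightarrow>\<^sub>0 int) \<Rightarrow> bool" where
  "reduced f D \<longleftrightarrow> semi_reduced f D \<and> div_degree D \<le> int (genus f)"

text \<open>The relation \<open>D = D(\<aa>)\<close>.\<close>

definition reduced_rep ::
    "'a::field poly \<Rightarrow> ('a point \<Rightarrow>\<^sub>0 int) set \<Rightarrow> ('a point \<Rightarrow>\<^sub>0 int) \<Rightarrow> bool" where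
  "reduced_rep f A D \<longleftrightarrow> reduced f D \<and> A = cl f (minus_infty D)"

text \<open>
  The condition \<open>deg V < deg U\<close> is understood with \<open>deg 0 = - \<infinity>\<close>, so that \<open>(1, 0)\<close> represents the
  neutral element.
\<close>

definition mumford_rep ::
    "'a::field poly \<Rightarrow> ('a point \<Rightarrow>\<^sub>0 int) set \<Rightarrow> 'a poly \<Rightarrow> 'a poly \<Rightarrow> bool" where
  "mumford_rep f A U V \<longleftrightarrow> (\<exists>D. reduced_rep f A D \<and>
     U = (\<Prod>Q\<in>Poly_Mapping.keys D. [:- xcoord Q, 1:] ^ nat (Poly_Mapping.lookup D Q)) \<and>
     (V = 0 \<or> Polynomial.degree V < Polynomial.degree U) \<and>
     U dvd V\<^sup>2 - f \<and>
     (\<forall>Q\<in>curve f - {Infty}. Poly_Mapping.lookup D Q =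
        min (ord_at f Q (fn_of_poly U)) (ord_at f Q (fn_y f - fn_of_poly V))))"


section \<open>Halves of a point\<close>

definition halves :: "'a::field poly \<Rightarrow> 'a point \<Rightarrow> ('a point \<Rightarrow>\<^sub>0 int) set set" where
  "halves f P = {A \<in> carrier (jacobian f). A [^]\<^bsub>jacobian f\<^esub> (2::nat) = point_class f P}"

definition root_tuples ::
    "nat \<Rightarrow> (nat \<Rightarrow> 'a::field) \<Rightarrow> 'a \<Rightarrow> 'a \<Rightarrow> (nat \<Rightarrow> 'a) set" where
  "root_tuples g \<alpha> a b = {r \<in> {1..2*g+1} \<rightarrow>\<^sub>E UNIV.
     (\<forall>i\<in>{1..2*g+1}. (r i)\<^sup>2 = a - \<alpha> i) \<and> (\<Prod>i=1..2*g+1. r i) = - b}"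

definition esym :: "nat \<Rightarrow> (nat \<Rightarrow> 'a::field) \<Rightarrow> nat \<Rightarrow> 'a" where
  "esym g r k = (\<Sum>S | S \<subseteq> {1..2*g+1} \<and> card S = k. \<Prod>i\<in>S. r i)"

text \<open>The polynomial \<open>a - x\<close> is \<open>[:a, -1:]\<close>.\<close>

definition half_U :: "nat \<Rightarrow> 'a::field \<Rightarrow> (nat \<Rightarrow> 'a) \<Rightarrow> 'a poly" where
  "half_U g a r = (-1) ^ g *
     ([:a, -1:] ^ g + (\<Sum>j=1..g. Polynomial.smult (esym g r (2*j)) ([:a, -1:] ^ (g - j))))"

definition half_V :: "nat \<Rightarrow> 'a::field \<Rightarrow> 'a \<Rightarrow> (nat \<Rightarrow> 'a) \<Rightarrow> 'a poly" where
  "half_V g a b r =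
     (\<Sum>j=1..g. Polynomial.smult (esym g r (2*j - 1)) ([:a, -1:] ^ (g - j + 1))) - [:b:] -
     Polynomial.smult (esym g r 1)
       ([:a, -1:] ^ g + (\<Sum>j=1..g. Polynomial.smult (esym g r (2*j)) ([:a, -1:] ^ (g - j))))"

definition half_divisor :: "nat \<Rightarrow> 'a::field \<Rightarrow> 'a \<Rightarrow> (nat \<Rightarrow> 'a) \<Rightarrow> ('a point \<Rightarrow>\<^sub>0 int)" where
  "half_divisor g a b r =
     (\<Sum>c\<in>#proots (half_U g a r). frag_of (Aff c (poly (half_V g a b r) c)))"

definition half_class ::
    "'a::field poly \<Rightarrow> nat \<Rightarrow> 'a \<Rightarrow> 'a \<Rightarrow> (nat \<Rightarrow> 'a) \<Rightarrow> ('a point \<Rightarrow>\<^sub>0 int) set" where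
  "half_class f g a b r =
     cl f (half_divisor g a b r - frag_cmul (int g) (frag_of Infty))"

end

theory Submission
  imports Defs
begin

text \<open>
  Write \<open>X = a - x\<close> and \<open>\<Prod> (T + r\<^sub>i) = T E(T\<^sup>2) + O(T\<^sup>2)\<close>, where the coefficients of \<open>E\<close> and \<open>O\<close> are
  the symmetric functions of \<open>r\<close> with even and with odd index. At \<open>T\<^sup>2 = X\<close> the product of this with
  its conjugate under \<open>T \<mapsto> - T\<close> is \<open>\<Prod> (r\<^sub>i\<^sup>2 - X) = \<Prod> (x - \<alpha>\<^sub>i)\<close>, which gives
  \<open>f = A\<^sup>2 + (x - a) U\<^sup>2\<close> with \<open>A = O(a - x)\<close> and \<open>U = (-1)\<^sup>g E(a - x)\<close>
  (\<open>half_square_root_pair\<close>). So the norm of \<open>y - A\<close> is \<open>- (x - a) U\<^sup>2\<close>, and as \<open>U\<close> and \<open>f\<close> have no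
  common root, the divisor of \<open>y - A\<close> is \<open>2D + (\<iota>P) - (2g + 1)(\<infinity>)\<close>, where \<open>D\<close> consists of the points
  \<open>(c, A(c))\<close> over the roots \<open>c\<close> of \<open>U\<close> (\<open>ord_y_minus_square_root\<close>). Since \<open>P + \<iota>P - 2(\<infinity>)\<close> is the
  divisor of \<open>x - a\<close>, the class of \<open>D - g(\<infinity>)\<close> is a half of \<open>P\<close> (\<open>double_eq_point\<close>). The polynomial
  \<open>V\<close> is the remainder of \<open>A\<close> modulo \<open>U\<close>, so \<open>(U, V)\<close> is the Mumford representation.

  Conversely, let \<open>E - m(\<infinity>)\<close> with \<open>E\<close> effective and \<open>m \<le> g\<close> represent a half of \<open>P\<close>
  (\<open>effective_representative\<close>). Then \<open>2E + (\<iota>P) - (2m + 1)(\<infinity>)\<close> is the divisor of a function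
  that is regular on the affine curve, hence of the form \<open>A\<^sub>0 + B y\<close>. The odd pole order shows that
  \<open>m = g\<close> and that \<open>B\<close> is constant, and the norm is again \<open>(x - a) U\<^sup>2\<close> up to sign
  (\<open>halves_are_half_classes\<close>). The square roots are recovered as \<open>(-1)\<^sup>g A(\<alpha>\<^sub>i) / U(\<alpha>\<^sub>i)\<close>, by comparing
  a polynomial of degree \<open>2g + 1\<close> with its distinct roots (\<open>square_root_pair_ex_tuple\<close>).

  The geometry behind this is developed by hand, and everything rests on norms. A chart
  \<open>w\<^sup>2 = F(u)\<close> has discrete valuation rings at its smooth points, since a regular function divides its
  norm, a polynomial in \<open>u\<close>. The orders of \<open>A + B y\<close> above \<open>c\<close> add up to the multiplicity of \<open>c\<close> in
  the norm (\<open>sum_fiber_ord\<close>), and the pole order at infinity is the degree of the norm, so principal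
  divisors have degree zero. A class contains at most one reduced divisor because \<open>y\<close> has a pole of
  order \<open>2g + 1\<close> at infinity (\<open>reduced_unique\<close>). The existence of effective representatives of degree at
  most \<open>g\<close> is Riemann's inequality, proved by counting attainable pole orders
  (\<open>riemann_inequality\<close>).
\<close>

section \<open>Evaluation homomorphisms\<close>

locale unital_hom =
  fixes h :: "'r::comm_ring_1 \<Rightarrow> 's::comm_ring_1"
  assumes hom_one: "h 1 = 1"
    and hom_add: "h (x + y) = h x + h y"
    and hom_mult: "h (x * y) = h x * h y"
begin

lemma hom_zero: "h 0 = 0"
  using hom_add[of 0 0] by simp

lemma hom_uminus: "h (- x) = - h x"
  using hom_add[of x "- x"] by (simp add: hom_zero eq_neg_iff_add_eq_0 add.commute)

lemma hom_diff: "h (x - y) = h x - h y"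
  using hom_add[of x "- y"] by (simp add: hom_uminus)

lemma hom_power: "h (x ^ n) = h x ^ n"
  by (induction n) (simp_all add: hom_one hom_mult)

lemma poly_map_pCons: "poly (map_poly h (pCons c p)) w = h c + w * poly (map_poly h p) w"
  by (simp add: map_poly_pCons hom_zero)

text \<open>
  Evaluating at \<open>w\<close> after mapping the coefficients is again a homomorphism. Used twice in a row,
  this covers the evaluation of bivariate polynomials, both on functions and at points.
\<close>

lemma unital_hom_poly_map: "unital_hom (\<lambda>p. poly (map_poly h p) w)"
proof
  show "poly (map_poly h 1) w = 1"
    by (simp add: hom_one)
  show add: "poly (map_poly h (p + q)) w = poly (map_poly h p) w + poly (map_poly h q) w" for p q
    by (induction p q rule: poly_induct2) (simp_all add: poly_map_pCons hom_add algebra_simps)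
  have smult: "poly (map_poly h (Polynomial.smult c p)) w = h c * poly (map_poly h p) w" for c p
    by (induction p) (simp_all add: poly_map_pCons hom_mult algebra_simps)
  show "poly (map_poly h (p * q)) w = poly (map_poly h p) w * poly (map_poly h q) w" for p q
    by (induction p) (simp_all add: add smult poly_map_pCons hom_zero algebra_simps)
qed

end


section \<open>Discrete valuation rings in a field\<close>

text \<open>
  A local domain with principal maximal ideal, inside a field that may be larger than its fraction
  field. An element of the field need not be a power of the uniformizer times a unit, so the
  valuation is a relation; it is defined on all elements that occur on the curve.
\<close>

locale dvr =
  fixes R M :: "'b::field set" and t0 :: 'b
  assumes one_R: "1 \<in> R"
    and add_R: "x \<in> R \<Longrightarrow> y \<in> R \<Longrightarrow> x + y \<in> R"
    and mult_R: "x \<in> R \<Longrightarrow> y \<in> R \<Longrightarrow> x * y \<in> R"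
    and uminus_R: "x \<in> R \<Longrightarrow> - x \<in> R"
    and inverse_R: "x \<in> R \<Longrightarrow> x \<notin> M \<Longrightarrow> inverse x \<in> R"
    and M_eq: "M = {t0 * r | r. r \<in> R}"
    and M_le: "M \<subseteq> R"
    and one_M: "1 \<notin> M"
    and t0_nz: "t0 \<noteq> 0"
begin

lemma mult_M: "x \<in> M \<Longrightarrow> y \<in> R \<Longrightarrow> x * y \<in> M"
  unfolding M_eq by (auto simp: mult.assoc intro: mult_R)

lemma add_M: "x \<in> M \<Longrightarrow> y \<in> M \<Longrightarrow> x + y \<in> M"
  unfolding M_eq by (auto simp: distrib_left[symmetric] intro: add_R)

lemma uminus_M: "x \<in> M \<Longrightarrow> - x \<in> M"
  using mult_M[of x "- 1"] uminus_R[OF one_R] by simp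

lemma zero_M: "0 \<in> M"
  using add_R[OF one_R uminus_R[OF one_R]] unfolding M_eq by force

lemma t0_M: "t0 \<in> M"
  unfolding M_eq using one_R by force

definition units :: "'b set" where "units = R - M"

lemma unit_nz: "u \<in> units \<Longrightarrow> u \<noteq> 0"
  using zero_M by (auto simp: units_def)

lemma unit_inverse: "u \<in> units \<Longrightarrow> inverse u \<in> units"
  using mult_M[of "inverse u" u] inverse_R one_M unit_nz[of u] by (auto simp: units_def)

lemma unit_iff: "u \<in> units \<longleftrightarrow> u \<in> R \<and> inverse u \<in> R \<and> u \<noteq> 0"
  using unit_inverse unit_nz mult_M one_M by (metis Diff_iff right_inverse units_def)

lemma unit_mult: "u \<in> units \<Longrightarrow> v \<in> units \<Longrightarrow> u * v \<in> units"
  by (auto simp: unit_iff intro: mult_R)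

lemma unit_one: "1 \<in> units"
  using one_R one_M by (simp add: units_def)

lemma unit_uminus: "u \<in> units \<Longrightarrow> - u \<in> units"
  by (auto simp: unit_iff intro: uminus_R)

lemma unit_power: "u \<in> units \<Longrightarrow> u ^ n \<in> units"
  by (induction n) (auto intro: unit_mult unit_one)

lemma unit_powi: "u \<in> units \<Longrightarrow> u powi n \<in> units"
  by (auto simp: power_int_def intro!: unit_power unit_inverse)

lemma unit_add_M: "u \<in> units \<Longrightarrow> x \<in> M \<Longrightarrow> u + x \<in> units"
  using add_R M_le add_M[of "u + x" "- x"] uminus_M by (auto simp: units_def)

lemma powi_M: "n > 0 \<Longrightarrow> t0 powi n \<in> M"
proof -
  assume "n > 0"
  then obtain k where k: "n = int (Suc k)"
    by (metis gr0_implies_Suc zero_less_imp_eq_int)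
  have "t0 ^ k \<in> R"
    by (induction k) (use one_R mult_R t0_M M_le in auto)
  then show ?thesis
    unfolding k M_eq power_int_of_nat by auto
qed

definition has_val :: "'b \<Rightarrow> int \<Rightarrow> bool" where
  "has_val h n \<longleftrightarrow> (\<exists>u\<in>units. h = t0 powi n * u)"

lemma has_val_nz: "has_val h n \<Longrightarrow> h \<noteq> 0"
  using unit_nz t0_nz by (auto simp: has_val_def)

lemma has_val_unit: "u \<in> units \<Longrightarrow> has_val u 0"
  by (auto simp: has_val_def)

lemma has_val_one: "has_val 1 0"
  by (rule has_val_unit[OF unit_one])

lemma has_val_t0: "has_val t0 1"
  unfolding has_val_def using unit_one by force

lemma has_val_mult: "has_val h m \<Longrightarrow> has_val k n \<Longrightarrow> has_val (h * k) (m + n)"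
  unfolding has_val_def
  by (auto simp: power_int_add t0_nz algebra_simps intro!: bexI[OF _ unit_mult])

lemma has_val_inverse: "has_val h m \<Longrightarrow> has_val (inverse h) (- m)"
  unfolding has_val_def
  by (auto simp: power_int_minus t0_nz intro!: bexI[OF _ unit_inverse])

lemma has_val_divide: "has_val h m \<Longrightarrow> has_val k n \<Longrightarrow> has_val (h / k) (m - n)"
  using has_val_mult[OF _ has_val_inverse] by (simp add: divide_inverse)

lemma has_val_power: "has_val h m \<Longrightarrow> has_val (h ^ n) (int n * m)"
  by (induction n) (auto intro: has_val_one dest: has_val_mult simp: algebra_simps)

lemma has_val_uminus: "has_val h m \<Longrightarrow> has_val (- h) m"
  unfolding has_val_def by (auto intro!: bexI[OF _ unit_uminus])

lemma has_val_M: "has_val h n \<Longrightarrow> n > 0 \<Longrightarrow> h \<in> M"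
  unfolding has_val_def using mult_M powi_M by (auto simp: units_def)

lemma has_val_zero_unit: "has_val h 0 \<Longrightarrow> h \<in> units"
  by (auto simp: has_val_def)

lemma has_val_R_iff:
  assumes "has_val h n"
  shows "h \<in> R \<longleftrightarrow> n \<ge> 0"
proof (cases "n < 0")
  case True
  then have "inverse h \<in> M"
    using has_val_M[OF has_val_inverse[OF assms]] by simp
  then have "h \<notin> R"
    using mult_M[of "inverse h" h] one_M has_val_nz[OF assms] by auto
  then show ?thesis using True by simp
next
  case False
  then show ?thesis
    using has_val_M[OF assms] has_val_zero_unit[of h] assms M_le by (cases "n = 0") (auto simp: units_def)
qed

lemma has_val_M_iff:
  assumes "has_val h n"
  shows "h \<in> M \<longleftrightarrow> n \<ge> 1"
proof -
  have "h \<in> M \<longleftrightarrow> h \<in> R \<and> h \<notin> units"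
    using M_le by (auto simp: units_def)
  moreover have "h \<in> units \<longleftrightarrow> n = 0"
    using has_val_R_iff[OF assms] has_val_R_iff[OF has_val_inverse[OF assms]] has_val_nz[OF assms]
    by (auto simp: unit_iff)
  ultimately show ?thesis
    using has_val_R_iff[OF assms] by auto
qed

lemma has_val_add:
  assumes "has_val h m" "has_val k n" "m < n"
  shows "has_val (h + k) m"
proof -
  have "k / h \<in> M"
    using has_val_M[OF has_val_divide[OF assms(2,1)]] assms(3) by simp
  then have "has_val (1 + k / h) 0"
    by (intro has_val_unit unit_add_M unit_one)
  from has_val_mult[OF assms(1) this] show ?thesis
    using has_val_nz[OF assms(1)] by (simp add: distrib_left)
qed

lemma has_val_unique: "has_val h m \<Longrightarrow> has_val h n \<Longrightarrow> m = n"
  using has_val_R_iff[OF has_val_divide] one_R has_val_nz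
  by (metis diff_ge_0_iff_ge divide_self order_antisym)

text \<open>
  Divide by \<open>h + k\<close>: were its valuation too small, \<open>1\<close> would be a sum of two elements of \<open>M\<close>.
\<close>

lemma has_val_add_ge:
  assumes "has_val h m" "has_val k n" "has_val (h + k) l"
  shows "l \<ge> min m n"
proof (rule ccontr)
  assume "\<not> min m n \<le> l"
  then have "h / (h + k) \<in> M" "k / (h + k) \<in> M"
    using has_val_M[OF has_val_divide[OF assms(1,3)]] has_val_M[OF has_val_divide[OF assms(2,3)]]
    by auto
  then have "h / (h + k) + k / (h + k) \<in> M"
    by (rule add_M)
  then show False
    using has_val_nz[OF assms(3)] one_M by (simp flip: add_divide_distrib)
qed

text \<open>
  Splitting off \<open>t0\<close> from \<open>h\<close> must end with a unit, as each step lowers the valuation of the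
  multiple \<open>h * h'\<close>. This gives the existence of orders of vanishing without any intersection of
  ideals.
\<close>

lemma has_val_factor:
  assumes "h \<in> R" "h' \<in> R" "has_val (h * h') (int n)"
  shows "\<exists>m. has_val h m"
  using assms
proof (induction n arbitrary: h)
  case 0
  then have "h \<notin> M"
    using mult_M[of h h'] has_val_M_iff by fastforce
  then have "h \<in> units"
    using 0 by (simp add: units_def)
  then show ?case
    by (blast intro: has_val_unit)
next
  case (Suc n)
  show ?case
  proof (cases "h \<in> M")
    case True
    then obtain r where r: "h = t0 * r" "r \<in> R" by (auto simp: M_eq)
    have "has_val (h * h' / t0) (int (Suc n) - 1)"
      by (rule has_val_divide[OF Suc.prems(3) has_val_t0])
    then have "has_val (r * h') (int n)"
      using r t0_nz by simp
    from Suc.IH[OF r(2) Suc.prems(2) this] obtain m where "has_val r m" ..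
    from has_val_mult[OF has_val_t0 this] show ?thesis using r by auto
  next
    case False
    then have "h \<in> units"
      using Suc.prems by (simp add: units_def)
    then show ?thesis
      by (blast intro: has_val_unit)
  qed
qed

text \<open>
  Two generators of the maximal ideal differ by a unit, so the order of vanishing does not depend
  on the choice of the uniformizer.
\<close>

lemma val_eq:
  assumes "has_val h n"
  shows "(THE n. \<exists>t u. M = {t * r | r. r \<in> R} \<and> u \<in> R - M \<and> h = t powi n * u) = n"
proof (rule the_equality)
  show "\<exists>t u. M = {t * r | r. r \<in> R} \<and> u \<in> R - M \<and> h = t powi n * u"
    using assms M_eq unfolding has_val_def units_def by blast
next
  fix m assume "\<exists>t u. M = {t * r | r. r \<in> R} \<and> u \<in> R - M \<and> h = t powi m * u"
  then obtain t u where t: "M = {t * r | r. r \<in> R}" and u: "u \<in> units" "h = t powi m * u"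
    unfolding units_def by blast
  obtain r where r: "t0 = t * r" "r \<in> R" using t0_M t by auto
  have "t \<in> M" using t one_R by force
  then obtain s where s: "t = t0 * s" "s \<in> R" using M_eq by auto
  have "t0 * (r * s) = t0 * 1"
    using r(1) s(1) by (metis mult.assoc mult.commute mult_1_right)
  then have "r * s = 1"
    using t0_nz mult_cancel_left by blast
  then have "s \<in> units"
    unfolding unit_iff using r s by (metis inverse_unique mult.commute mult_zero_right zero_neq_one)
  then have "has_val h m"
    unfolding has_val_def u(2) s(1) power_int_mult_distrib
    by (intro bexI[of _ "s powi m * u"] unit_mult unit_powi u) (simp_all add: mult.assoc)
  with assms show "m = n" by (rule has_val_unique[rotated])
qed

end

section \<open>Local rings of a smooth double cover of the line\<close>

text \<open>
  Both charts of the curve have the form \<open>w\<^sup>2 = F(u)\<close> with \<open>1, w\<close> linearly independent over \<open>K(u)\<close>: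
  the affine one with \<open>(u, w) = (x, y)\<close>, and the one at infinity with
  \<open>(u, w) = (1/x, y/x\<^bsup>g+1\<^esup>)\<close>. Their points are therefore studied together.
\<close>

locale double_cover = unital_hom k for k :: "'a::field \<Rightarrow> 'b::field" +
  fixes u w :: 'b and F :: "'a poly"
  assumes w_sq: "w\<^sup>2 = poly (map_poly k F) u"
    and free: "poly (map_poly k A) u + poly (map_poly k B) u * w = 0 \<Longrightarrow> A = 0 \<and> B = 0"
begin

definition ev :: "'a poly \<Rightarrow> 'b" where
  "ev p = poly (map_poly k p) u"

definition ev2 :: "'a poly poly \<Rightarrow> 'b" where
  "ev2 G = poly (map_poly (\<lambda>p. poly (map_poly k p) u) G) w"

definition elt :: "'a poly \<Rightarrow> 'a poly \<Rightarrow> 'b" where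
  "elt A B = ev A + ev B * w"

sublocale ev: unital_hom ev
  unfolding ev_def by (rule unital_hom_poly_map)

sublocale ev2: unital_hom ev2
  using ev.unital_hom_poly_map[of w] unfolding ev2_def ev_def .

lemma ev2_pCons: "ev2 (pCons c G) = ev c + w * ev2 G"
  using ev.poly_map_pCons[of c G w] unfolding ev2_def ev_def .

lemma elt_zero_iff: "elt A B = 0 \<longleftrightarrow> A = 0 \<and> B = 0"
  using free[of A B] by (auto simp: elt_def ev.hom_zero) (simp_all add: ev_def)

lemma ev_zero_iff: "ev p = 0 \<longleftrightarrow> p = 0"
  using elt_zero_iff[of p 0] by (simp add: elt_def ev.hom_zero)

lemma elt_eq_ev2: "elt A B = ev2 [:A, B:]"
  by (simp add: elt_def ev2_pCons ev2.hom_zero)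

text \<open>The norm from the function field to \<open>K(u)\<close>.\<close>

lemma elt_mult_conj: "elt A B * elt A (- B) = ev (A\<^sup>2 - B\<^sup>2 * F)"
proof -
  have "elt A B * elt A (- B) = (ev A)\<^sup>2 - (ev B)\<^sup>2 * w\<^sup>2"
    by (simp add: elt_def ev.hom_uminus algebra_simps power2_eq_square)
  also have "w\<^sup>2 = ev F"
    by (simp add: w_sq ev_def)
  finally show ?thesis
    by (simp add: ev.hom_diff ev.hom_power ev.hom_mult)
qed

end

locale smooth_point = double_cover k u w F
  for k :: "'a::field \<Rightarrow> 'b::field" and u w F +
  fixes a b :: 'a
  assumes on_curve: "b\<^sup>2 = poly F a"
    and smooth: "b = 0 \<Longrightarrow> poly (pderiv F) a \<noteq> 0"
    and two_nz: "(2::'a) \<noteq> 0"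
begin

definition at_pt :: "'a poly poly \<Rightarrow> 'a" where
  "at_pt G = poly (map_poly (\<lambda>p. poly p a) G) b"

sublocale at_pt: unital_hom at_pt
proof -
  interpret unital_hom "\<lambda>p. poly p a" by unfold_locales simp_all
  show "unital_hom at_pt"
    unfolding at_pt_def by (rule unital_hom_poly_map)
qed

lemma at_pt_pCons: "at_pt (pCons c G) = poly c a + b * at_pt G"
proof -
  interpret unital_hom "\<lambda>p. poly p a" by unfold_locales simp_all
  show ?thesis
    unfolding at_pt_def by (rule poly_map_pCons)
qed

definition R :: "'b set" where
  "R = {ev2 G / ev2 H | G H. at_pt H \<noteq> 0}"

definition M :: "'b set" where
  "M = {ev2 G / ev2 H | G H. at_pt G = 0 \<and> at_pt H \<noteq> 0}"

text \<open>At a branch point \<open>u - a\<close> vanishes to order two and \<open>w\<close> is the uniformizer.\<close>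

definition t0 :: 'b where
  "t0 = (if b = 0 then w else ev [:- a, 1:])"

lemma t0_branch: "b = 0 \<Longrightarrow> t0 = w"
  and t0_nonbranch: "b \<noteq> 0 \<Longrightarrow> t0 = ev [:- a, 1:]"
  unfolding t0_def by simp_all

text \<open>The ramification index of the covering \<open>u\<close>.\<close>

definition ram :: nat where
  "ram = (if b = 0 then 2 else 1)"

lemma ev2_reduce: "\<exists>A B. ev2 G = elt A B \<and> at_pt G = poly A a + poly B a * b"
proof (induction G)
  case 0
  show ?case
    by (intro exI[of _ 0]) (simp add: elt_def ev2.hom_zero ev.hom_zero at_pt.hom_zero)
next
  case (pCons c G)
  then obtain A B where AB: "ev2 G = elt A B" "at_pt G = poly A a + poly B a * b" by blast
  have "ev2 (pCons c G) = elt (c + B * F) A"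
    using w_sq by (simp add: ev2_pCons AB elt_def ev.hom_add ev.hom_mult ev_def[of F] power2_eq_square
      algebra_simps)
  moreover have "at_pt (pCons c G) = poly (c + B * F) a + poly A a * b"
    using on_curve by (simp add: at_pt_pCons AB power2_eq_square algebra_simps)
  ultimately show ?case by blast
qed

text \<open>
  Functions on the chart have well-defined values: after reduction modulo the equation of the
  curve, a polynomial in the two coordinates that vanishes as a function is zero.
\<close>

lemma ev2_zero_imp_at_pt: "ev2 G = 0 \<Longrightarrow> at_pt G = 0"
  using ev2_reduce[of G] elt_zero_iff by auto

lemma ev2_nz: "at_pt G \<noteq> 0 \<Longrightarrow> ev2 G \<noteq> 0"
  using ev2_zero_imp_at_pt by blast

lemma elt_at_pt: "at_pt [:A, B:] = poly A a + poly B a * b"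
  by (simp add: at_pt_pCons at_pt.hom_zero)

lemma ev2_quotient_M_iff:
  assumes "at_pt H \<noteq> 0"
  shows "ev2 G / ev2 H \<in> M \<longleftrightarrow> at_pt G = 0"
proof
  assume "ev2 G / ev2 H \<in> M"
  then obtain G' H' where *: "ev2 G / ev2 H = ev2 G' / ev2 H'" "at_pt G' = 0" "at_pt H' \<noteq> 0"
    unfolding M_def by blast
  then have "ev2 (G * H' - G' * H) = 0"
    using ev2_nz[OF assms] ev2_nz[of H'] by (simp add: ev2.hom_diff ev2.hom_mult field_simps)
  then have "at_pt (G * H' - G' * H) = 0" by (rule ev2_zero_imp_at_pt)
  then show "at_pt G = 0"
    using * by (simp add: at_pt.hom_diff at_pt.hom_mult)
qed (use assms in \<open>auto simp: M_def\<close>)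

lemma ev2_R: "ev2 G \<in> R"
  unfolding R_def by (force simp: ev2.hom_one at_pt.hom_one intro: exI[of _ 1])

lemma ev2_M_iff: "ev2 G \<in> M \<longleftrightarrow> at_pt G = 0"
  using ev2_quotient_M_iff[of 1 G] by (simp add: ev2.hom_one at_pt.hom_one)

lemma elt_R: "elt A B \<in> R"
  unfolding elt_eq_ev2 by (rule ev2_R)

lemma elt_M_iff: "elt A B \<in> M \<longleftrightarrow> poly A a + poly B a * b = 0"
  unfolding elt_eq_ev2 ev2_M_iff elt_at_pt ..

lemma ev_R: "ev p \<in> R"
  using elt_R[of p 0] by (simp add: elt_def ev.hom_zero)

lemma ev_M_iff: "ev p \<in> M \<longleftrightarrow> poly p a = 0"
  using elt_M_iff[of p 0] by (simp add: elt_def ev.hom_zero)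

lemma w_R: "w \<in> R"
  using elt_R[of 0 1] by (simp add: elt_def ev.hom_zero ev.hom_one)

lemma w_M_iff: "w \<in> M \<longleftrightarrow> b = 0"
  using elt_M_iff[of 0 1] by (simp add: elt_def ev.hom_zero ev.hom_one)

lemma w_nz: "w \<noteq> 0"
  using elt_zero_iff[of 0 1] by (simp add: elt_def ev.hom_zero ev.hom_one)

lemma add_R: "x \<in> R \<Longrightarrow> y \<in> R \<Longrightarrow> x + y \<in> R"
  unfolding R_def
proof clarify
  fix G H G' H' assume H: "at_pt H \<noteq> 0" "at_pt H' \<noteq> 0"
  then have "ev2 G / ev2 H + ev2 G' / ev2 H' = ev2 (G * H' + G' * H) / ev2 (H * H')"
    using ev2_nz[of H] ev2_nz[of H'] by (simp add: ev2.hom_add ev2.hom_mult field_simps)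
  with H show "\<exists>Ga Ha. ev2 G / ev2 H + ev2 G' / ev2 H' = ev2 Ga / ev2 Ha \<and> at_pt Ha \<noteq> 0"
    by (metis at_pt.hom_mult no_zero_divisors)
qed

lemma mult_R: "x \<in> R \<Longrightarrow> y \<in> R \<Longrightarrow> x * y \<in> R"
  unfolding R_def
  by (auto simp: times_divide_times_eq at_pt.hom_mult simp flip: ev2.hom_mult)
    (metis at_pt.hom_mult no_zero_divisors)

lemma mult_M: "x \<in> M \<Longrightarrow> y \<in> R \<Longrightarrow> x * y \<in> M"
  unfolding R_def M_def
  by (auto simp: times_divide_times_eq at_pt.hom_mult simp flip: ev2.hom_mult)
    (metis at_pt.hom_mult no_zero_divisors mult_zero_left)

lemma inverse_R: "x \<in> R \<Longrightarrow> x \<notin> M \<Longrightarrow> inverse x \<in> R"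
proof -
  assume "x \<in> R" "x \<notin> M"
  then obtain G H where "x = ev2 G / ev2 H" "at_pt G \<noteq> 0"
    unfolding R_def using ev2_quotient_M_iff by blast
  then show ?thesis
    unfolding R_def by (auto simp: inverse_divide)
qed

lemma M_le_R: "M \<subseteq> R"
  unfolding M_def R_def by blast

lemma t0_M: "t0 \<in> M"
proof (cases "b = 0")
  case True
  then show ?thesis
    unfolding t0_branch[OF True] w_M_iff .
qed (simp add: t0_nonbranch ev_M_iff)

lemma root_factor:
  assumes "poly p a = 0"
  obtains q where "p = [:- a, 1:] * q"
  using assms by (auto simp: poly_eq_0_iff_dvd elim!: dvdE)

text \<open>
  Smoothness at a branch point means that \<open>F\<close> has a simple root there, so that \<open>F / (u - a)\<close> is
  a unit.
\<close>

lemma linear_at_branch_point: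
  assumes "b = 0"
  obtains F1 where "F = [:- a, 1:] * F1" "ev F1 \<in> R - M" "ev [:- a, 1:] = w\<^sup>2 * inverse (ev F1)"
proof -
  obtain F1 where F1: "F = [:- a, 1:] * F1"
    using assms on_curve by (auto intro: root_factor)
  have "poly F1 a \<noteq> 0"
    using smooth[OF assms] unfolding F1 pderiv_mult by (simp add: pderiv_pCons)
  then have *: "ev F1 \<in> R - M" "ev F1 \<noteq> 0"
    by (auto simp: ev_R ev_M_iff ev_zero_iff)
  have "w\<^sup>2 = ev [:- a, 1:] * ev F1"
    unfolding w_sq ev.hom_mult[symmetric] F1 by (rule ev_def[symmetric])
  then have "ev [:- a, 1:] = w\<^sup>2 * inverse (ev F1)"
    using * by (simp add: field_simps)
  with F1 * that show thesis by blast
qed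

text \<open>
  At a branch point a function \<open>A + B w\<close> in the maximal ideal has \<open>A(a) = 0\<close>, and \<open>u - a\<close> is a
  multiple of \<open>w\<close>. At any other point \<open>A + B w\<close> is \<open>(A + b B) + B (w - b)\<close>, and \<open>u - a\<close> divides
  \<open>w - b\<close> because \<open>(w - b)(w + b) = F - b\<^sup>2\<close> and \<open>w + b\<close> is a unit.
\<close>

lemma M_subset_t0: "x \<in> M \<Longrightarrow> \<exists>r\<in>R. x = t0 * r"
proof -
  assume "x \<in> M"
  then obtain G H where GH: "x = ev2 G / ev2 H" "at_pt G = 0" "at_pt H \<noteq> 0"
    unfolding M_def by blast
  obtain A B where AB: "ev2 G = elt A B" "poly A a + poly B a * b = 0"
    using ev2_reduce[of G] GH by auto
  have "\<exists>r\<in>R. elt A B = t0 * r"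
  proof (cases "b = 0")
    case True
    obtain F1 where F1: "ev F1 \<in> R - M" "ev [:- a, 1:] = w\<^sup>2 * inverse (ev F1)"
      using linear_at_branch_point[OF True] by metis
    obtain A1 where A1: "A = [:- a, 1:] * A1"
      using True AB root_factor by auto
    have "elt A B = t0 * (w * inverse (ev F1) * ev A1 + ev B)"
      unfolding t0_branch[OF True] elt_def A1 ev.hom_mult F1(2)
      by (simp add: power2_eq_square algebra_simps)
    moreover have "w * inverse (ev F1) * ev A1 + ev B \<in> R"
      using F1 by (intro add_R mult_R ev_R w_R inverse_R) auto
    ultimately show ?thesis by blast
  next
    case False
    obtain p where p: "A + Polynomial.smult b B = [:- a, 1:] * p"
      using AB by (auto intro: root_factor[of "A + Polynomial.smult b B"] simp: mult.commute)
    obtain q where q: "F - [:b\<^sup>2:] = [:- a, 1:] * q"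
      using on_curve by (auto intro: root_factor[of "F - [:b\<^sup>2:]"])
    have wb: "w + k b = elt [:b:] 1"
      by (simp add: elt_def ev.hom_one) (simp add: ev_def map_poly_pCons hom_zero)
    have "w + k b \<notin> M"
      using False two_nz unfolding wb elt_M_iff by (simp flip: mult_2)
    moreover have "w + k b \<in> R" unfolding wb by (rule elt_R)
    ultimately have inv: "inverse (w + k b) \<in> R" "w + k b \<noteq> 0"
      using inverse_R elt_zero_iff[of "[:b:]" 1] wb by auto
    have evs: "ev (Polynomial.smult b B) = k b * ev B" for B
      using ev.hom_mult[of "[:b:]" B] by (simp add: ev_def map_poly_pCons hom_zero)
    have evb: "ev [:b\<^sup>2:] = (k b)\<^sup>2"
      by (simp add: ev_def map_poly_pCons hom_zero hom_power)
    have "(w - k b) * (w + k b) = w\<^sup>2 - (k b)\<^sup>2"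
      by (simp add: power2_eq_square algebra_simps)
    also have "\<dots> = ev (F - [:b\<^sup>2:])"
      by (simp add: w_sq ev.hom_diff evb) (simp add: ev_def)
    also have "\<dots> = t0 * ev q"
      unfolding q ev.hom_mult t0_nonbranch[OF False] ..
    finally have *: "w - k b = t0 * (ev q * inverse (w + k b))"
      using inv(2) by (simp add: field_simps)
    have "elt A B = ev (A + Polynomial.smult b B) + ev B * (w - k b)"
      by (simp add: elt_def ev.hom_add evs algebra_simps)
    also have "\<dots> = t0 * (ev p + ev B * (ev q * inverse (w + k b)))"
      unfolding p * ev.hom_mult t0_nonbranch[OF False] by (simp only: algebra_simps)
    finally show ?thesis
      using inv by (intro bexI[of _ "ev p + ev B * (ev q * inverse (w + k b))"] add_R mult_R ev_R)
  qed
  then obtain r where r: "r \<in> R" "elt A B = t0 * r" by blast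
  have "inverse (ev2 H) \<in> R"
    using GH by (intro inverse_R ev2_R) (simp add: ev2_M_iff)
  then show ?thesis
    using r by (intro bexI[of _ "r * inverse (ev2 H)"] mult_R) (simp_all add: GH AB divide_inverse)
qed

sublocale dvr R M t0
proof
  show "1 \<in> R"
    using ev2_R[of 1] by (simp add: ev2.hom_one)
  show "- x \<in> R" if "x \<in> R" for x
    using mult_R[OF ev2_R[of "- 1"] that] by (simp add: ev2.hom_one ev2.hom_uminus)
  show "M = {t0 * r | r. r \<in> R}"
    using M_subset_t0 mult_M[OF t0_M] by blast
  show "1 \<notin> M"
    using ev2_M_iff[of 1] by (simp add: ev2.hom_one at_pt.hom_one)
  show "t0 \<noteq> 0"
    by (auto simp: t0_def w_nz ev_zero_iff)
qed (auto intro: add_R mult_R inverse_R M_le_R[THEN subsetD])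

text \<open>The residue field at the point is the field of constants.\<close>

lemma residue_ex:
  assumes "x \<in> R"
  shows "\<exists>c. x - k c \<in> M"
proof -
  obtain G H where GH: "x = ev2 G / ev2 H" "at_pt H \<noteq> 0"
    using assms unfolding R_def by blast
  define c where "c = at_pt G / at_pt H"
  have "ev2 [:[:c:]:] = k c"
    by (simp add: ev2_pCons ev2.hom_zero) (simp add: ev_def map_poly_pCons hom_zero)
  then have "x - k c = ev2 (G - [:[:c:]:] * H) / ev2 H"
    using ev2_nz[OF GH(2)] unfolding ev2.hom_diff ev2.hom_mult by (simp add: GH field_simps)
  moreover have "at_pt (G - [:[:c:]:] * H) = 0"
    using GH(2) unfolding at_pt.hom_diff at_pt.hom_mult
    by (simp add: at_pt_pCons at_pt.hom_zero c_def)
  ultimately show ?thesis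
    using GH(2) unfolding M_def by blast
qed

lemma has_val_linear: "has_val (ev [:- a, 1:]) (int ram)"
proof (cases "b = 0")
  case True
  obtain F1 where F1: "ev F1 \<in> R - M" "ev [:- a, 1:] = w\<^sup>2 * inverse (ev F1)"
    using linear_at_branch_point[OF True] by metis
  have w_val: "has_val w 1"
    by (rule back_subst[of "\<lambda>x. has_val x 1", OF has_val_t0 t0_branch[OF True]])
  have "has_val (w\<^sup>2 * inverse (ev F1)) (int 2 * 1 + - 0)"
    using F1(1) w_val unfolding units_def[symmetric]
    by (intro has_val_mult has_val_power has_val_inverse has_val_unit)
  moreover have "int ram = int 2 * 1 + - 0"
    unfolding ram_def using True by simp
  ultimately show ?thesis
    by (metis F1(2))
qed (use has_val_t0 in \<open>simp add: t0_nonbranch ram_def\<close>)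

lemma has_val_ev:
  assumes "p \<noteq> 0"
  shows "has_val (ev p) (int (ram * Polynomial.order a p))"
proof -
  obtain q where q: "p = [:- a, 1:] ^ Polynomial.order a p * q" "\<not> [:- a, 1:] dvd q"
    using order_decomp[OF assms] by blast
  then have "ev q \<in> units"
    by (auto simp: units_def ev_R ev_M_iff poly_eq_0_iff_dvd)
  then have "has_val (ev [:- a, 1:] ^ Polynomial.order a p * ev q)
      (int (Polynomial.order a p) * int ram + 0)"
    by (intro has_val_mult has_val_power has_val_unit has_val_linear)
  moreover have "ev p = ev [:- a, 1:] ^ Polynomial.order a p * ev q"
    using q(1) by (metis ev.hom_mult ev.hom_power)
  ultimately show ?thesis by (simp add: mult.commute)
qed

lemma norm_nz: "A \<noteq> 0 \<or> B \<noteq> 0 \<Longrightarrow> A\<^sup>2 - B\<^sup>2 * F \<noteq> 0"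
  using elt_mult_conj[of A B] elt_zero_iff[of A B] elt_zero_iff[of A "- B"]
  by (metis ev_zero_iff mult_eq_0_iff neg_equal_0_iff_equal)

text \<open>Every nonzero regular function divides its norm, which is a polynomial in \<open>u\<close>.\<close>

lemma has_val_elt_ex:
  assumes "A \<noteq> 0 \<or> B \<noteq> 0"
  shows "\<exists>n. has_val (elt A B) n"
  using has_val_factor[OF elt_R elt_R, of A B A "- B"] has_val_ev[OF norm_nz[OF assms]]
  unfolding elt_mult_conj by blast

text \<open>Where the conjugate does not vanish, a function and its norm differ by a unit.\<close>

lemma has_val_elt_norm:
  assumes "poly A a - poly B a * b \<noteq> 0"
  shows "has_val (elt A B) (int (ram * Polynomial.order a (A\<^sup>2 - B\<^sup>2 * F)))"
proof -
  have *: "A \<noteq> 0 \<or> B \<noteq> 0" using assms by auto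
  have "elt A (- B) \<in> units"
    using assms by (simp add: units_def elt_R elt_M_iff)
  then have "has_val (ev (A\<^sup>2 - B\<^sup>2 * F) * inverse (elt A (- B)))
    (int (ram * Polynomial.order a (A\<^sup>2 - B\<^sup>2 * F)) + - 0)"
    by (intro has_val_mult has_val_inverse has_val_unit has_val_ev norm_nz *)
  moreover have "ev (A\<^sup>2 - B\<^sup>2 * F) * inverse (elt A (- B)) = elt A B"
    using elt_mult_conj[of A B] * by (simp add: elt_zero_iff field_simps)
  ultimately show ?thesis
    by simp
qed

end

section \<open>The function field\<close>

lemma unital_hom_fn_of_poly: "unital_hom (fn_of_poly :: 'a::field poly \<Rightarrow> 'a ratfun)"
  by unfold_locales (simp_all add: fn_of_poly_def One_fract_def flip: to_ac_add to_ac_mult)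

interpretation fn: unital_hom "fn_of_poly :: 'a::field poly \<Rightarrow> 'a ratfun"
  by (rule unital_hom_fn_of_poly)

abbreviation const_fn :: "'a::field \<Rightarrow> 'a ratfun" where
  "const_fn c \<equiv> fn_of_poly [:c:]"

lemma unital_hom_const_fn: "unital_hom (const_fn :: 'a::field \<Rightarrow> 'a ratfun)"
proof
  show "const_fn (1 :: 'a) = 1"
    using fn.hom_one by (simp add: one_pCons)
  show "const_fn (a + b) = const_fn a + const_fn b" for a b :: 'a
    by (simp flip: fn.hom_add)
  show "const_fn (a * b) = const_fn a * const_fn b" for a b :: 'a
    using fn.hom_mult[of "[:a:]" "[:b:]"] by (simp add: mult.commute)
qed

lemma fn_of_poly_eq_0_iff [simp]: "fn_of_poly p = 0 \<longleftrightarrow> p = 0"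
  by (simp add: fn_of_poly_def Zero_fract_def eq_fract)

lemma fn_x_nz: "fn_x \<noteq> 0"
  by (simp add: fn_x_def)

lemma poly_const_fn: "poly (map_poly const_fn p) fn_x = fn_of_poly (p :: 'a::field poly)"
proof -
  interpret c: unital_hom "const_fn :: 'a \<Rightarrow> _" by (rule unital_hom_const_fn)
  show ?thesis
  proof (induction p)
    case (pCons c p)
    have "fn_of_poly (pCons c p) = const_fn c + fn_x * fn_of_poly p"
      by (simp add: fn_x_def flip: fn.hom_add fn.hom_mult)
    then show ?case
      by (simp add: c.poly_map_pCons pCons.IH)
  qed (simp add: fn.hom_zero)
qed

lemma fn_y_sq: "(fn_y f)\<^sup>2 = fn_of_poly f"
  unfolding fn_y_def by (rule someI_ex) (rule nth_root_exists, simp)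

definition curve_fn :: "'a::field poly \<Rightarrow> 'a poly \<Rightarrow> 'a poly \<Rightarrow> 'a ratfun" where
  "curve_fn f A B = fn_of_poly A + fn_of_poly B * fn_y f"

text \<open>The norm of \<open>A + B y\<close> from the function field to \<open>K(x)\<close>.\<close>

definition curve_norm :: "'a::field poly \<Rightarrow> 'a poly \<Rightarrow> 'a poly \<Rightarrow> 'a poly" where
  "curve_norm f A B = A\<^sup>2 - B\<^sup>2 * f"

lemma map_poly_const_fn_reflect:
  "map_poly const_fn (reflect_poly p) = reflect_poly (map_poly (const_fn :: 'a::field \<Rightarrow> _) p)"
proof -
  have "Polynomial.degree (map_poly const_fn p) = Polynomial.degree p"
    by (rule degree_map_poly) simp
  then show ?thesis
    by (intro poly_eqI) (auto simp: coeff_map_poly coeff_reflect_poly fn.hom_zero)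
qed

text \<open>This is the change of coordinates from \<open>x\<close> to \<open>1/x\<close> on polynomials.\<close>

lemma poly_const_fn_inverse_x:
  fixes p :: "'a::field poly"
  shows "poly (map_poly const_fn p) (1 / fn_x) = fn_of_poly (reflect_poly p) / fn_x ^ Polynomial.degree p"
    and "poly (map_poly const_fn (reflect_poly p)) (1 / fn_x) = fn_of_poly p / fn_x ^ Polynomial.degree p"
proof -
  have d: "Polynomial.degree (map_poly const_fn p) = Polynomial.degree p"
    by (rule degree_map_poly) simp
  show "poly (map_poly const_fn p) (1 / fn_x) = fn_of_poly (reflect_poly p) / fn_x ^ Polynomial.degree p"
    using poly_reflect_poly_nz[OF fn_x_nz, of "map_poly const_fn p"] fn_x_nz[where ?'a = 'a]
    unfolding d map_poly_const_fn_reflect[symmetric] poly_const_fn[of "reflect_poly p"]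
    by (simp add: inverse_eq_divide)
  show "poly (map_poly const_fn (reflect_poly p)) (1 / fn_x) = fn_of_poly p / fn_x ^ Polynomial.degree p"
    using poly_reflect_poly_nz[of "1 / fn_x" "map_poly const_fn p"] fn_x_nz[where ?'a = 'a]
    unfolding d map_poly_const_fn_reflect by (simp add: poly_const_fn power_one_over)
qed

locale hyperelliptic =
  fixes g :: nat and \<alpha> :: "nat \<Rightarrow> 'a::alg_closed_field" and f :: "'a poly"
  assumes char: "CHAR('a) \<noteq> 2"
    and genus_pos: "g \<ge> 1"
    and inj: "inj_on \<alpha> {1..2*g+1}"
    and f_eq: "f = (\<Prod>i=1..2*g+1. [:- \<alpha> i, 1:])"
begin

lemma two_nz: "(2 :: 'a) \<noteq> 0"
proof
  assume "(2 :: 'a) = 0"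
  then have "of_nat 2 = (0 :: 'a)" by simp
  then have "CHAR('a) dvd 2" by (simp only: of_nat_eq_0_iff_char_dvd)
  then have "CHAR('a) = 1"
    using char prime_nat_iff two_is_prime_nat by blast
  then show False by simp
qed

lemma degree_f: "Polynomial.degree f = 2 * g + 1"
  unfolding f_eq by (subst degree_prod_eq_sum_degree) auto

lemma monic_f: "lead_coeff f = 1"
  unfolding f_eq lead_coeff_prod by (rule prod.neutral) simp

lemma f_nz: "f \<noteq> 0"
  using degree_f by auto

lemma genus_f: "genus f = g"
  by (simp add: genus_def degree_f)

lemma poly_f: "poly f x = (\<Prod>i=1..2*g+1. x - \<alpha> i)"
  unfolding f_eq poly_prod by (rule prod.cong) simp_all

lemma poly_f_eq_0_iff: "poly f x = 0 \<longleftrightarrow> x \<in> \<alpha> ` {1..2*g+1}"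
proof -
  have "finite {1..2*g+1}" by simp
  from prod_zero_iff[OF this, of "\<lambda>i. x - \<alpha> i"] show ?thesis
    unfolding poly_f image_def by auto
qed

lemma f_simple_root:
  assumes "poly f x = 0"
  shows "poly (pderiv f) x \<noteq> 0"
proof -
  obtain i where i: "i \<in> {1..2*g+1}" "x = \<alpha> i"
    using assms poly_f_eq_0_iff by auto
  have "f = [:- \<alpha> i, 1:] * (\<Prod>j\<in>{1..2*g+1} - {i}. [:- \<alpha> j, 1:])"
    unfolding f_eq using i by (subst prod.remove[of _ i]) auto
  then have "poly (pderiv f) x = (\<Prod>j\<in>{1..2*g+1} - {i}. \<alpha> i - \<alpha> j)"
    using pderiv_mult[of "[:- \<alpha> i, 1:]"] by (simp only: i) (simp add: pderiv_pCons poly_prod)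
  also have "\<dots> \<noteq> 0"
    using inj i by (subst prod_zero_iff) (auto simp: inj_on_def)
  finally show ?thesis .
qed

lemma f_not_square_dvd: "\<not> [:- x, 1:]\<^sup>2 dvd f"
proof
  assume "[:- x, 1:]\<^sup>2 dvd f"
  then obtain q where q: "f = [:- x, 1:]\<^sup>2 * q" by (auto elim: dvdE)
  have "poly f x = 0" "poly (pderiv f) x = 0"
    unfolding q pderiv_mult power2_eq_square by simp_all
  then show False using f_simple_root by blast
qed

lemma Aff_in_curve: "Aff c d \<in> curve f \<longleftrightarrow> d\<^sup>2 = poly f c"
  by (auto simp: curve_def)

text \<open>\<open>A\<^sup>2\<close> has even and \<open>B\<^sup>2 f\<close> has odd degree, so the leading terms do not cancel.\<close>

lemma degree_curve_norm:
  "B = 0 \<Longrightarrow> Polynomial.degree (curve_norm f A B) = 2 * Polynomial.degree A"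
  "B \<noteq> 0 \<Longrightarrow> Polynomial.degree (curve_norm f A B) =
     max (2 * Polynomial.degree A) (2 * Polynomial.degree B + 2 * g + 1)"
proof -
  have dA: "Polynomial.degree (A\<^sup>2) = 2 * Polynomial.degree A"
    by (cases "A = 0") (simp_all add: degree_power_eq)
  show "B = 0 \<Longrightarrow> Polynomial.degree (curve_norm f A B) = 2 * Polynomial.degree A"
    by (simp add: curve_norm_def dA)
  assume B: "B \<noteq> 0"
  then have dB: "Polynomial.degree (B\<^sup>2 * f) = 2 * Polynomial.degree B + 2 * g + 1"
    using f_nz by (simp add: degree_mult_eq degree_power_eq degree_f)
  have "Polynomial.degree (A\<^sup>2) \<noteq> Polynomial.degree (B\<^sup>2 * f)"
    unfolding dA dB by presburger
  then have "Polynomial.degree (A\<^sup>2 + - (B\<^sup>2 * f)) = max (Polynomial.degree (A\<^sup>2)) (Polynomial.degree (B\<^sup>2 * f))"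
    using degree_add_eq_left[of "- (B\<^sup>2 * f)" "A\<^sup>2"] degree_add_eq_right[of "A\<^sup>2" "- (B\<^sup>2 * f)"]
    by (auto simp: max_def)
  then show "Polynomial.degree (curve_norm f A B) =
     max (2 * Polynomial.degree A) (2 * Polynomial.degree B + 2 * g + 1)"
    unfolding dA dB by (simp add: curve_norm_def)
qed

lemma curve_norm_zero_iff: "curve_norm f A B = 0 \<longleftrightarrow> A = 0 \<and> B = 0"
proof
  assume 0: "curve_norm f A B = 0"
  then have "B = 0"
    using degree_curve_norm(2)[of B A] by (cases "B = 0") auto
  with 0 show "A = 0 \<and> B = 0"
    by (simp add: curve_norm_def)
qed (simp add: curve_norm_def)

lemma curve_fn_mult_conj: "curve_fn f A B * curve_fn f A (- B) = fn_of_poly (curve_norm f A B)"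
proof -
  have "curve_fn f A B * curve_fn f A (- B) = (fn_of_poly A)\<^sup>2 - (fn_of_poly B)\<^sup>2 * (fn_y f)\<^sup>2"
    by (simp add: curve_fn_def fn.hom_uminus algebra_simps power2_eq_square)
  then show ?thesis
    by (simp add: fn_y_sq curve_norm_def fn.hom_diff fn.hom_power fn.hom_mult)
qed

text \<open>As \<open>f\<close> has odd degree, it is not a square in \<open>K(x)\<close>; equivalently, nonzero functions have nonzero norms.\<close>

lemma curve_fn_zero_iff: "curve_fn f A B = 0 \<longleftrightarrow> A = 0 \<and> B = 0"
proof
  assume "curve_fn f A B = 0"
  then have "curve_norm f A B = 0"
    using curve_fn_mult_conj[of A B] by simp
  then show "A = 0 \<and> B = 0" by (simp only: curve_norm_zero_iff)
qed (simp add: curve_fn_def fn.hom_zero)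

lemma double_cover_aff: "double_cover const_fn fn_x (fn_y f) f"
proof -
  interpret unital_hom const_fn by (rule unital_hom_const_fn)
  show ?thesis
    by unfold_locales (use curve_fn_zero_iff in \<open>simp_all add: poly_const_fn fn_y_sq curve_fn_def\<close>)
qed

lemma aff_ev: "double_cover.ev const_fn fn_x = (fn_of_poly :: 'a poly \<Rightarrow> _)"
  by (simp add: fun_eq_iff double_cover.ev_def[OF double_cover_aff] poly_const_fn)

lemma aff_elt: "double_cover.elt const_fn fn_x (fn_y f) = curve_fn f"
  by (simp add: fun_eq_iff double_cover.elt_def[OF double_cover_aff] curve_fn_def aff_ev)

sublocale aff: double_cover const_fn fn_x "fn_y f" f
  rewrites "aff.ev = fn_of_poly" and "aff.elt = curve_fn f"
  by (rule double_cover_aff aff_ev aff_elt)+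

abbreviation f_inf :: "'a poly" where
  "f_inf \<equiv> pCons 0 (reflect_poly f)"

abbreviation w_inf :: "'a ratfun" where
  "w_inf \<equiv> fn_y f / fn_x ^ (g + 1)"

text \<open>Multiplying by a power of \<open>x\<close> reduces this to the independence of \<open>1\<close> and \<open>y\<close> over \<open>K(x)\<close>.\<close>

lemma inf_chart_free:
  assumes "poly (map_poly const_fn A) (1 / fn_x) + poly (map_poly const_fn B) (1 / fn_x) * w_inf = 0"
  shows "A = 0 \<and> B = 0"
proof -
  define m n where "m = Polynomial.degree A" and "n = Polynomial.degree B"
  have "0 = fn_x ^ (m + n + g + 1) * (fn_of_poly (reflect_poly A) / fn_x ^ m
      + fn_of_poly (reflect_poly B) / fn_x ^ n * w_inf)"
    using assms by (simp add: poly_const_fn_inverse_x m_def n_def)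
  also have "\<dots> = fn_of_poly ([:0, 1:] ^ (n + g + 1) * reflect_poly A)
      + fn_of_poly ([:0, 1:] ^ m * reflect_poly B) * fn_y f"
    using fn_x_nz[where ?'a = 'a] unfolding fn.hom_mult fn.hom_power fn_x_def[symmetric]
    by (simp add: field_simps power_add)
  finally have "[:0, 1:] ^ (n + g + 1) * reflect_poly A = 0 \<and> [:0, 1:] ^ m * reflect_poly B = 0"
    using curve_fn_zero_iff unfolding curve_fn_def by metis
  then show ?thesis by simp
qed

sublocale inf: double_cover const_fn "1 / fn_x" w_inf f_inf
proof -
  interpret unital_hom const_fn by (rule unital_hom_const_fn)
  show "double_cover const_fn (1 / fn_x) w_inf f_inf"
  proof
    show "w_inf\<^sup>2 = poly (map_poly const_fn f_inf) (1 / fn_x)"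
    proof -
      have exponent: "(g + 1) * 2 = Suc (2 * g + 1)" by simp
      have "w_inf\<^sup>2 = fn_of_poly f / (fn_x * fn_x ^ (2 * g + 1))"
        unfolding power_divide fn_y_sq power_mult[symmetric] exponent power_Suc by (rule refl)
      also have "\<dots> = 1 / fn_x * (fn_of_poly f / fn_x ^ (2 * g + 1))"
        by (simp only: times_divide_times_eq mult_1)
      also have "\<dots> = poly (map_poly const_fn f_inf) (1 / fn_x)"
        unfolding poly_map_pCons poly_const_fn_inverse_x(2) degree_f pCons_0_0 fn.hom_zero add_0 ..
      finally show ?thesis .
    qed
  qed (rule inf_chart_free)
qed

lemma smooth_point_Aff:
  assumes "Aff c d \<in> curve f"
  shows "smooth_point const_fn fn_x (fn_y f) f c d"
proof
  show "d\<^sup>2 = poly f c"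
    using assms by (simp add: Aff_in_curve)
  then show "d = 0 \<Longrightarrow> poly (pderiv f) c \<noteq> 0"
    using f_simple_root by simp
qed (rule two_nz)

lemma smooth_point_Infty: "smooth_point const_fn (1 / fn_x) w_inf f_inf 0 0"
  by unfold_locales (use two_nz monic_f in \<open>simp_all add: pderiv_pCons\<close>)

definition point_unif :: "'a point \<Rightarrow> 'a ratfun" where
  "point_unif Q = (case Q of Aff c d \<Rightarrow> if d = 0 then fn_y f else fn_of_poly [:- c, 1:] | Infty \<Rightarrow> w_inf)"

text \<open>
  The order as a relation. A definite description is of no use before existence and uniqueness are
  known, and those are shown for each kind of function together with the value.
\<close>

definition has_ord :: "'a point \<Rightarrow> 'a ratfun \<Rightarrow> int \<Rightarrow> bool" where
  "has_ord Q = dvr.has_val (local_ring f Q) (max_ideal f Q) (point_unif Q)"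

lemma Aff_rings:
  assumes "Aff c d \<in> curve f"
  shows "local_ring f (Aff c d) = smooth_point.R const_fn fn_x (fn_y f) c d"
    and "max_ideal f (Aff c d) = smooth_point.M const_fn fn_x (fn_y f) c d"
    and "point_unif (Aff c d) = smooth_point.t0 const_fn fn_x (fn_y f) c d"
proof -
  interpret smooth_point const_fn fn_x "fn_y f" f c d
    by (rule smooth_point_Aff[OF assms])
  show "local_ring f (Aff c d) = R" "max_ideal f (Aff c d) = M"
    unfolding local_ring_def max_ideal_def R_def M_def chart_fn_def chart_value_def
      chart.simps chart_coords.simps prod.case aff.ev2_def at_pt_def
    by (rule refl)+
  show "point_unif (Aff c d) = t0"
    by (simp add: point_unif_def t0_def aff_ev)
qed

lemma Infty_rings:
  shows "local_ring f Infty = smooth_point.R const_fn (1 / fn_x) w_inf 0 0"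
    and "max_ideal f Infty = smooth_point.M const_fn (1 / fn_x) w_inf 0 0"
    and "point_unif Infty = smooth_point.t0 const_fn (1 / fn_x) w_inf 0 0"
proof -
  interpret smooth_point const_fn "1 / fn_x" w_inf f_inf 0 0
    by (rule smooth_point_Infty)
  show "local_ring f Infty = R" "max_ideal f Infty = M"
    unfolding local_ring_def max_ideal_def R_def M_def chart_fn_def chart_value_def
      chart.simps chart_coords.simps prod.case inf.ev2_def at_pt_def genus_f
    by (rule refl)+
  show "point_unif Infty = t0"
    unfolding point_unif_def t0_def by (simp only: point.case simp_thms if_True)
qed

lemma point_dvr: "Q \<in> curve f \<Longrightarrow> dvr (local_ring f Q) (max_ideal f Q) (point_unif Q)"
proof (cases Q)
  case (Aff c d)
  assume "Q \<in> curve f"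
  then have Q: "Aff c d \<in> curve f" by (simp add: Aff)
  interpret smooth_point const_fn fn_x "fn_y f" f c d
    by (rule smooth_point_Aff[OF Q])
  show ?thesis
    unfolding Aff Aff_rings[OF Q] by (rule dvr_axioms)
next
  case Infty
  interpret smooth_point const_fn "1 / fn_x" w_inf f_inf 0 0
    by (rule smooth_point_Infty)
  show ?thesis
    unfolding Infty Infty_rings by (rule dvr_axioms)
qed

lemma ord_at_eq:
  assumes "Q \<in> curve f" "has_ord Q h n"
  shows "ord_at f Q h = n"
proof -
  interpret dvr "local_ring f Q" "max_ideal f Q" "point_unif Q"
    by (rule point_dvr[OF assms(1)])
  show ?thesis
    using val_eq[of h n] assms(2) unfolding ord_at_def uniformizer_def has_ord_def by simp
qed

end

section \<open>Orders of vanishing on the curve\<close>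

context hyperelliptic
begin

lemma has_ord_mult:
  "Q \<in> curve f \<Longrightarrow> has_ord Q h m \<Longrightarrow> has_ord Q k n \<Longrightarrow> has_ord Q (h * k) (m + n)"
  unfolding has_ord_def by (rule dvr.has_val_mult[OF point_dvr])

lemma has_ord_inverse: "Q \<in> curve f \<Longrightarrow> has_ord Q h m \<Longrightarrow> has_ord Q (inverse h) (- m)"
  unfolding has_ord_def by (rule dvr.has_val_inverse[OF point_dvr])

lemma has_ord_divide:
  "Q \<in> curve f \<Longrightarrow> has_ord Q h m \<Longrightarrow> has_ord Q k n \<Longrightarrow> has_ord Q (h / k) (m - n)"
  unfolding has_ord_def by (rule dvr.has_val_divide[OF point_dvr])

lemma has_ord_power: "Q \<in> curve f \<Longrightarrow> has_ord Q h m \<Longrightarrow> has_ord Q (h ^ n) (int n * m)"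
  unfolding has_ord_def by (rule dvr.has_val_power[OF point_dvr])

lemma has_ord_add:
  "Q \<in> curve f \<Longrightarrow> has_ord Q h m \<Longrightarrow> has_ord Q k n \<Longrightarrow> m < n \<Longrightarrow> has_ord Q (h + k) m"
  unfolding has_ord_def by (rule dvr.has_val_add[OF point_dvr])

subsection \<open>Affine points\<close>

definition ram_index :: "'a \<Rightarrow> nat" where
  "ram_index d = (if d = 0 then 2 else 1)"

lemma has_ord_Aff_poly:
  assumes "Aff c d \<in> curve f" "p \<noteq> 0"
  shows "has_ord (Aff c d) (fn_of_poly p) (int (ram_index d * Polynomial.order c p))"
proof -
  interpret smooth_point const_fn fn_x "fn_y f" f c d
    by (rule smooth_point_Aff[OF assms(1)])
  show ?thesis
    using has_val_ev[OF assms(2)] unfolding has_ord_def Aff_rings[OF assms(1)] aff_ev ram_def ram_index_def .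
qed

lemma has_ord_Aff_curve_fn_ex:
  assumes "Aff c d \<in> curve f" "A \<noteq> 0 \<or> B \<noteq> 0"
  shows "\<exists>n\<ge>0. has_ord (Aff c d) (curve_fn f A B) n"
proof -
  interpret smooth_point const_fn fn_x "fn_y f" f c d
    by (rule smooth_point_Aff[OF assms(1)])
  obtain n where n: "has_val (curve_fn f A B) n"
    using has_val_elt_ex[OF assms(2)] unfolding aff_elt by blast
  moreover have "n \<ge> 0"
    using has_val_R_iff[OF n] elt_R[of A B] unfolding aff_elt by simp
  ultimately show ?thesis
    unfolding has_ord_def Aff_rings[OF assms(1)] by blast
qed

lemma has_ord_Aff_curve_fn_pos_iff:
  assumes "Aff c d \<in> curve f" "has_ord (Aff c d) (curve_fn f A B) n"
  shows "n \<ge> 1 \<longleftrightarrow> poly A c + poly B c * d = 0"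
proof -
  interpret smooth_point const_fn fn_x "fn_y f" f c d
    by (rule smooth_point_Aff[OF assms(1)])
  have "has_val (curve_fn f A B) n"
    using assms(2) unfolding has_ord_def Aff_rings[OF assms(1)] .
  from has_val_M_iff[OF this] show ?thesis
    using elt_M_iff[of A B] unfolding aff_elt by simp
qed

lemma has_ord_Aff_curve_fn_norm:
  assumes "Aff c d \<in> curve f" "poly A c - poly B c * d \<noteq> 0"
  shows "has_ord (Aff c d) (curve_fn f A B) (int (ram_index d * Polynomial.order c (curve_norm f A B)))"
proof -
  interpret smooth_point const_fn fn_x "fn_y f" f c d
    by (rule smooth_point_Aff[OF assms(1)])
  show ?thesis
    using has_val_elt_norm[OF assms(2)]
    unfolding has_ord_def Aff_rings[OF assms(1)] aff_elt ram_def ram_index_def curve_norm_def .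
qed

lemma has_ord_branch_y:
  assumes "Aff c 0 \<in> curve f"
  shows "has_ord (Aff c 0) (fn_y f) 1"
  using dvr.has_val_t0[OF point_dvr[OF assms]] unfolding has_ord_def by (simp add: point_unif_def)

subsection \<open>The infinite point\<close>

lemma Infty_in_curve: "Infty \<in> curve f"
  by (simp add: curve_def)

lemma has_ord_Infty_x: "has_ord Infty fn_x (- 2)"
proof -
  interpret smooth_point const_fn "1 / fn_x" w_inf f_inf 0 0
    by (rule smooth_point_Infty)
  have "Polynomial.order (0 :: 'a) [:0, 1:] = 1"
    using order_power_n_n[of "0 :: 'a" 1] by simp
  moreover have "inf.ev [:0, 1:] = 1 / fn_x"
    by (simp add: inf.ev_def map_poly_pCons fn.hom_zero) (simp add: fn.hom_one flip: one_pCons)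
  ultimately have "has_val (1 / fn_x) 2"
    using has_val_ev[of "[:0, 1:]"] unfolding ram_def by simp
  then have "has_ord Infty (1 / fn_x) 2"
    unfolding has_ord_def Infty_rings .
  from has_ord_inverse[OF Infty_in_curve this] show ?thesis by simp
qed

lemma has_ord_Infty_y: "has_ord Infty (fn_y f) (- (2 * int g + 1))"
proof -
  have "has_ord Infty w_inf 1"
    using dvr.has_val_t0[OF point_dvr[OF Infty_in_curve]]
    unfolding has_ord_def point_unif_def point.case .
  from has_ord_mult[OF Infty_in_curve this has_ord_power[OF Infty_in_curve has_ord_Infty_x, of "g + 1"]]
  have "has_ord Infty (w_inf * fn_x ^ (g + 1)) (1 + int (g + 1) * - 2)" .
  moreover have "w_inf * fn_x ^ (g + 1) = fn_y f"
    using fn_x_nz[where ?'a = 'a] by simp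
  moreover have "1 + int (g + 1) * - 2 = - (2 * int g + 1)" by simp
  ultimately show ?thesis by metis
qed

lemma has_ord_Infty_poly:
  assumes "p \<noteq> 0"
  shows "has_ord Infty (fn_of_poly p) (- 2 * int (Polynomial.degree p))"
proof -
  interpret smooth_point const_fn "1 / fn_x" w_inf f_inf 0 0
    by (rule smooth_point_Infty)
  have "inf.ev (reflect_poly p) \<in> units"
    unfolding units_def using ev_R ev_M_iff assms by simp
  then have "has_ord Infty (inf.ev (reflect_poly p)) 0"
    unfolding has_ord_def Infty_rings by (rule has_val_unit)
  from has_ord_mult[OF Infty_in_curve this
      has_ord_power[OF Infty_in_curve has_ord_Infty_x, of "Polynomial.degree p"]]
  show ?thesis
    using fn_x_nz[where ?'a = 'a] unfolding inf.ev_def poly_const_fn_inverse_x(2)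
    by (simp add: mult.commute)
qed

text \<open>
  The two summands of \<open>A + B y\<close> have pole orders of different parity at infinity, so they cannot
  cancel.
\<close>

lemma has_ord_Infty_curve_fn:
  assumes "A \<noteq> 0 \<or> B \<noteq> 0"
  shows "has_ord Infty (curve_fn f A B) (- int (Polynomial.degree (curve_norm f A B)))"
proof (cases "B = 0")
  case True
  then show ?thesis
    using has_ord_Infty_poly[of A] assms
    by (simp add: curve_fn_def fn.hom_zero degree_curve_norm)
next
  case B: False
  from has_ord_mult[OF Infty_in_curve has_ord_Infty_poly[OF B] has_ord_Infty_y]
  have By: "has_ord Infty (fn_of_poly B * fn_y f) (- int (2 * Polynomial.degree B + 2 * g + 1))"
    by (simp add: algebra_simps)
  show ?thesis
  proof (cases "A = 0")
    case True
    then show ?thesis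
      using By B by (simp add: curve_fn_def fn.hom_zero degree_curve_norm)
  next
    case False
    note Ao = has_ord_Infty_poly[OF False]
    have "2 * Polynomial.degree A \<noteq> 2 * Polynomial.degree B + 2 * g + 1"
      by presburger
    then consider "2 * Polynomial.degree A < 2 * Polynomial.degree B + 2 * g + 1"
      | "2 * Polynomial.degree A > 2 * Polynomial.degree B + 2 * g + 1"
      using nat_neq_iff by blast
    then show ?thesis
    proof cases
      case 1
      then show ?thesis
        using has_ord_add[OF Infty_in_curve By Ao] B
        by (simp add: curve_fn_def degree_curve_norm add.commute)
    next
      case 2
      then show ?thesis
        using has_ord_add[OF Infty_in_curve Ao By] B
        by (simp add: curve_fn_def degree_curve_norm)
    qed
  qed
qed

subsection \<open>The order function on the function field\<close>

lemma common_denominator: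
  fixes p q r s y :: "'b::field"
  shows "q \<noteq> 0 \<Longrightarrow> s \<noteq> 0 \<Longrightarrow> p / q + r / s * y = (p * s + r * q * y) / (q * s)"
  by (simp add: field_simps)

abbreviation FF :: "'a ratfun set" where
  "FF \<equiv> function_field f - {0}"

lemma function_field_iff:
  "h \<in> function_field f \<longleftrightarrow> (\<exists>A B C. C \<noteq> 0 \<and> h = curve_fn f A B / fn_of_poly C)"
proof
  assume "h \<in> function_field f"
  then obtain u v where h: "h = to_ac u + to_ac v * fn_y f"
    unfolding function_field_def by blast
  obtain p q where u: "u = Fraction_Field.Fract p q" "q \<noteq> 0" by (cases u)
  obtain r s where v: "v = Fraction_Field.Fract r s" "s \<noteq> 0" by (cases v)
  have *: "to_ac (Fraction_Field.Fract a b) = fn_of_poly a / fn_of_poly b" if "b \<noteq> 0" for a b :: "'a poly"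
    using that by (simp add: fn_of_poly_def flip: to_ac_divide)
  have "h = curve_fn f (p * s) (r * q) / fn_of_poly (q * s)"
    unfolding h u(1) v(1) *[OF u(2)] *[OF v(2)] curve_fn_def fn.hom_mult
    by (rule common_denominator) (simp_all add: u v)
  with u v show "\<exists>A B C. C \<noteq> 0 \<and> h = curve_fn f A B / fn_of_poly C"
    by (intro exI conjI) auto
next
  assume "\<exists>A B C. C \<noteq> 0 \<and> h = curve_fn f A B / fn_of_poly C"
  then obtain A B C where C: "C \<noteq> 0" and h: "h = curve_fn f A B / fn_of_poly C" by blast
  have "h = to_ac (Fraction_Field.Fract A 1 / Fraction_Field.Fract C 1)
      + to_ac (Fraction_Field.Fract B 1 / Fraction_Field.Fract C 1) * fn_y f"
    unfolding to_ac_divide h curve_fn_def fn_of_poly_def by (simp add: add_divide_distrib)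
  then show "h \<in> function_field f"
    unfolding function_field_def by blast
qed

lemma curve_fn_FF: "A \<noteq> 0 \<or> B \<noteq> 0 \<Longrightarrow> curve_fn f A B \<in> FF"
  using fn.hom_one unfolding Diff_iff function_field_iff singleton_iff curve_fn_zero_iff
  by (metis div_by_1 one_neq_zero)

lemma FF_cases:
  assumes "h \<in> FF"
  obtains A B C where "A \<noteq> 0 \<or> B \<noteq> 0" "C \<noteq> 0" "h = curve_fn f A B / fn_of_poly C"
  using assms unfolding Diff_iff function_field_iff singleton_iff by (metis curve_fn_zero_iff div_0)

lemma curve_fn_poly: "curve_fn f A 0 = fn_of_poly A"
  by (simp add: curve_fn_def fn.hom_zero)

lemma poly_FF: "p \<noteq> 0 \<Longrightarrow> fn_of_poly p \<in> FF"
  using curve_fn_FF[of p 0] by (simp add: curve_fn_poly)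

lemma FF_mult: "h \<in> FF \<Longrightarrow> k \<in> FF \<Longrightarrow> h * k \<in> FF"
proof -
  assume "h \<in> FF" "k \<in> FF"
  then obtain A B C A' B' C' where *: "C \<noteq> 0" "C' \<noteq> 0"
    "h = curve_fn f A B / fn_of_poly C" "k = curve_fn f A' B' / fn_of_poly C'"
    by (metis FF_cases)
  have "curve_fn f A B * curve_fn f A' B' = fn_of_poly A * fn_of_poly A' + fn_of_poly B * fn_of_poly B' * (fn_y f)\<^sup>2
      + (fn_of_poly A * fn_of_poly B' + fn_of_poly B * fn_of_poly A') * fn_y f"
    by (simp add: curve_fn_def algebra_simps power2_eq_square)
  also have "\<dots> = curve_fn f (A * A' + B * B' * f) (A * B' + B * A')"
    by (simp add: curve_fn_def fn.hom_add fn.hom_mult fn_y_sq)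
  finally have "h * k = curve_fn f (A * A' + B * B' * f) (A * B' + B * A') / fn_of_poly (C * C')"
    by (simp add: * fn.hom_mult)
  moreover have "C * C' \<noteq> 0" using * by simp
  moreover have "h * k \<noteq> 0" using \<open>h \<in> FF\<close> \<open>k \<in> FF\<close> by auto
  ultimately show ?thesis
    unfolding Diff_iff function_field_iff by blast
qed

lemma FF_inverse: "h \<in> FF \<Longrightarrow> inverse h \<in> FF"
proof -
  assume "h \<in> FF"
  then obtain A B C where *: "A \<noteq> 0 \<or> B \<noteq> 0" "C \<noteq> 0" "h = curve_fn f A B / fn_of_poly C"
    by (metis FF_cases)
  have N: "curve_norm f A B \<noteq> 0" using * curve_norm_zero_iff by blast
  have "curve_fn f A B \<noteq> 0" "curve_fn f A (- B) \<noteq> 0"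
    using *(1) by (auto simp: curve_fn_zero_iff)
  then have "inverse h = fn_of_poly C * (curve_fn f A (- B) / fn_of_poly (curve_norm f A B))"
    by (simp add: * field_simps flip: curve_fn_mult_conj)
  moreover have "curve_fn f A (- B) / fn_of_poly (curve_norm f A B) \<in> FF"
    using N \<open>curve_fn f A (- B) \<noteq> 0\<close> unfolding Diff_iff function_field_iff by auto
  ultimately show ?thesis
    using FF_mult[OF poly_FF[OF *(2)]] by metis
qed

lemma FF_divide: "h \<in> FF \<Longrightarrow> k \<in> FF \<Longrightarrow> h / k \<in> FF"
  unfolding divide_inverse by (intro FF_mult FF_inverse)

lemma has_ord_curve_fn_ex:
  assumes "Q \<in> curve f" "A \<noteq> 0 \<or> B \<noteq> 0"
  shows "\<exists>n. has_ord Q (curve_fn f A B) n"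
  using assms has_ord_Aff_curve_fn_ex has_ord_Infty_curve_fn by (cases Q) blast+

lemma has_ord_ord_at:
  assumes Q: "Q \<in> curve f" and h: "h \<in> FF"
  shows "has_ord Q h (ord_at f Q h)"
proof -
  obtain A B C where *: "A \<noteq> 0 \<or> B \<noteq> 0" "C \<noteq> 0" "h = curve_fn f A B / fn_of_poly C"
    using h by (rule FF_cases)
  then have "\<exists>n. has_ord Q h n"
    using has_ord_curve_fn_ex[OF Q, of A B] has_ord_curve_fn_ex[OF Q, of C 0] has_ord_divide[OF Q]
    unfolding curve_fn_poly by blast
  then show ?thesis
    using ord_at_eq[OF Q] by blast
qed

lemma ord_mult:
  "Q \<in> curve f \<Longrightarrow> h \<in> FF \<Longrightarrow> k \<in> FF \<Longrightarrow> ord_at f Q (h * k) = ord_at f Q h + ord_at f Q k"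
  by (intro ord_at_eq has_ord_mult has_ord_ord_at)

lemma ord_inverse: "Q \<in> curve f \<Longrightarrow> h \<in> FF \<Longrightarrow> ord_at f Q (inverse h) = - ord_at f Q h"
  by (intro ord_at_eq has_ord_inverse has_ord_ord_at)

lemma ord_divide:
  "Q \<in> curve f \<Longrightarrow> h \<in> FF \<Longrightarrow> k \<in> FF \<Longrightarrow> ord_at f Q (h / k) = ord_at f Q h - ord_at f Q k"
  by (intro ord_at_eq has_ord_divide has_ord_ord_at)

lemma ord_add_ge:
  assumes "Q \<in> curve f" "h \<in> FF" "k \<in> FF" "h + k \<in> FF"
  shows "ord_at f Q (h + k) \<ge> min (ord_at f Q h) (ord_at f Q k)"
  using dvr.has_val_add_ge[OF point_dvr[OF assms(1)]] assms has_ord_ord_at unfolding has_ord_def by blast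

lemma ord_add_less:
  assumes "Q \<in> curve f" "h \<in> FF" "k \<in> FF" "ord_at f Q h < ord_at f Q k"
  shows "ord_at f Q (h + k) = ord_at f Q h"
  using assms by (intro ord_at_eq has_ord_add[OF _ _ has_ord_ord_at] has_ord_ord_at)

lemma ord_Aff_poly:
  "Aff c d \<in> curve f \<Longrightarrow> p \<noteq> 0 \<Longrightarrow>
    ord_at f (Aff c d) (fn_of_poly p) = int (ram_index d * Polynomial.order c p)"
  by (intro ord_at_eq has_ord_Aff_poly)

lemma ord_Aff_curve_fn_nonneg:
  "Aff c d \<in> curve f \<Longrightarrow> A \<noteq> 0 \<or> B \<noteq> 0 \<Longrightarrow> ord_at f (Aff c d) (curve_fn f A B) \<ge> 0"
  using has_ord_Aff_curve_fn_ex ord_at_eq by metis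

lemma ord_Aff_curve_fn_pos_iff:
  "Aff c d \<in> curve f \<Longrightarrow> A \<noteq> 0 \<or> B \<noteq> 0 \<Longrightarrow>
    ord_at f (Aff c d) (curve_fn f A B) \<ge> 1 \<longleftrightarrow> poly A c + poly B c * d = 0"
  by (intro has_ord_Aff_curve_fn_pos_iff has_ord_ord_at curve_fn_FF)

lemma ord_Aff_curve_fn_norm:
  "Aff c d \<in> curve f \<Longrightarrow> poly A c - poly B c * d \<noteq> 0 \<Longrightarrow>
    ord_at f (Aff c d) (curve_fn f A B) = int (ram_index d * Polynomial.order c (curve_norm f A B))"
  by (intro ord_at_eq has_ord_Aff_curve_fn_norm)

lemma ord_Infty_curve_fn:
  "A \<noteq> 0 \<or> B \<noteq> 0 \<Longrightarrow>
    ord_at f Infty (curve_fn f A B) = - int (Polynomial.degree (curve_norm f A B))"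
  by (intro ord_at_eq has_ord_Infty_curve_fn Infty_in_curve)

lemma ord_const:
  assumes "Q \<in> curve f" "c \<noteq> 0"
  shows "ord_at f Q (const_fn c) = 0"
proof (cases Q)
  case (Aff x y)
  moreover have "Polynomial.order x [:c:] = 0"
    using assms(2) by (simp add: order_0I)
  ultimately show ?thesis
    using assms ord_Aff_poly[of x y "[:c:]"] by simp
next
  case Infty
  then show ?thesis
    using assms ord_at_eq[OF Infty_in_curve has_ord_Infty_poly[of "[:c:]"]] by simp
qed

text \<open>
  If \<open>h\<close> vanishes at \<open>Q\<close> to exactly the order \<open>n\<close>, any function vanishing to order \<open>n\<close> can be
  made to vanish to a higher order by subtracting a multiple of \<open>h\<close>: vanishing to order
  \<open>n + 1\<close> is one linear condition on the functions vanishing to order \<open>n\<close>.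
\<close>

lemma ord_cancel_ex:
  assumes Q: "Q \<in> curve f" and h: "h \<in> FF" "h' \<in> FF" and le: "ord_at f Q h \<le> ord_at f Q h'"
  shows "\<exists>c. h' - const_fn c * h \<in> FF \<longrightarrow> ord_at f Q (h' - const_fn c * h) > ord_at f Q h"
proof -
  interpret dvr "local_ring f Q" "max_ideal f Q" "point_unif Q"
    by (rule point_dvr[OF Q])
  have "has_val (h' / h) (ord_at f Q h' - ord_at f Q h)"
    using has_ord_divide[OF Q has_ord_ord_at[OF Q h(2)] has_ord_ord_at[OF Q h(1)]] unfolding has_ord_def .
  then have "h' / h \<in> local_ring f Q"
    using has_val_R_iff le by simp
  then have "\<exists>c. h' / h - const_fn c \<in> max_ideal f Q"
  proof (cases Q)
    case (Aff c d)
    interpret P: smooth_point const_fn fn_x "fn_y f" f c d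
      using Q unfolding Aff by (rule smooth_point_Aff)
    show "\<exists>c. h' / h - const_fn c \<in> max_ideal f Q" if "h' / h \<in> local_ring f Q"
      using P.residue_ex that Q unfolding Aff by (simp only: Aff_rings)
  next
    case Infty
    interpret P: smooth_point const_fn "1 / fn_x" w_inf f_inf 0 0
      by (rule smooth_point_Infty)
    show "\<exists>c. h' / h - const_fn c \<in> max_ideal f Q" if "h' / h \<in> local_ring f Q"
      using P.residue_ex that unfolding Infty Infty_rings .
  qed
  then obtain c where c: "h' / h - const_fn c \<in> max_ideal f Q" ..
  have "ord_at f Q (h' - const_fn c * h) > ord_at f Q h" if k: "h' - const_fn c * h \<in> FF"
  proof -
    have "(h' - const_fn c * h) / h = h' / h - const_fn c"
      using h by (simp add: field_simps)
    then have "ord_at f Q ((h' - const_fn c * h) / h) \<ge> 1"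
      using has_val_M_iff has_ord_ord_at[OF Q FF_divide[OF k h(1)]] c unfolding has_ord_def by simp
    then show ?thesis
      using ord_divide[OF Q k h(1)] by simp
  qed
  then show ?thesis by blast
qed

end

section \<open>Degrees of divisors\<close>

lemma div_degree_superset:
  assumes "finite S" "Poly_Mapping.keys D \<subseteq> S"
  shows "div_degree D = (\<Sum>Q\<in>S. Poly_Mapping.lookup D Q)"
  unfolding div_degree_def using assms by (intro sum.mono_neutral_left) (auto simp: in_keys_iff)

lemma div_degree_add: "div_degree (D + E) = div_degree D + div_degree E"
proof -
  have "finite (Poly_Mapping.keys D \<union> Poly_Mapping.keys E)" by simp
  then show ?thesis
    using Poly_Mapping.keys_add[of D E]
    by (simp add: div_degree_superset[of "Poly_Mapping.keys D \<union> Poly_Mapping.keys E"] lookup_add sum.distrib)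
qed

lemma div_degree_cmul: "div_degree (frag_cmul n D) = n * div_degree D"
  using keys_cmul[of n D]
  by (simp add: div_degree_superset[of "Poly_Mapping.keys D"] sum_distrib_left)

lemma div_degree_uminus: "div_degree (- D) = - div_degree D"
  unfolding div_degree_def by (simp add: sum_negf)

lemma div_degree_diff: "div_degree (D - E) = div_degree D - div_degree E"
  using div_degree_add[of D "- E"] by (simp add: div_degree_uminus)

lemma div_degree_zero: "div_degree 0 = 0"
  by (simp add: div_degree_def)

lemma div_degree_frag_of: "div_degree (frag_of Q) = 1"
  by (simp add: div_degree_def)

lemma div_degree_minus_infty: "div_degree (minus_infty D) = 0"
  by (simp add: minus_infty_def div_degree_diff div_degree_cmul div_degree_frag_of)

lemma proots_prod_linear: "proots (\<Prod>x\<in>#M. [:- x, 1:]) = (M :: 'a::idom multiset)"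
proof (induction M)
  case (add x M)
  have "(\<Prod>x\<in>#M. [:- x, 1:]) \<noteq> 0"
    by (induction M) (simp_all del: mult_pCons_left)
  then show ?case
    using add by (simp add: proots_mult del: mult_pCons_left)
qed simp

lemma alg_closed_proots:
  fixes p :: "'a::alg_closed_field poly"
  assumes "p \<noteq> 0"
  shows "size (proots p) = Polynomial.degree p"
    and "p = Polynomial.smult (lead_coeff p) (\<Prod>x\<in>#proots p. [:- x, 1:])"
proof -
  obtain M where M: "size M = Polynomial.degree p"
    "p = Polynomial.smult (lead_coeff p) (\<Prod>x\<in>#M. [:- x, 1:])"
    using alg_closed_imp_factorization[OF assms] by blast
  have nz: "lead_coeff p \<noteq> 0" using assms by simp
  have "proots p = M"
    by (subst M(2)) (simp only: proots_smult[OF nz] proots_prod_linear)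
  with M show "size (proots p) = Polynomial.degree p"
    and "p = Polynomial.smult (lead_coeff p) (\<Prod>x\<in>#proots p. [:- x, 1:])" by simp_all
qed

lemma monic_poly_eqI_order:
  fixes p q :: "'a::alg_closed_field poly"
  assumes "lead_coeff p = 1" "lead_coeff q = 1" "\<And>c. Polynomial.order c p = Polynomial.order c q"
  shows "p = q"
proof -
  have "p \<noteq> 0" "q \<noteq> 0" using assms(1,2) by auto
  moreover from this have "proots p = proots q"
    by (intro multiset_eqI) (simp add: assms(3))
  ultimately show ?thesis
    using alg_closed_proots(2)[of p] alg_closed_proots(2)[of q] assms(1,2) by simp
qed

lemma sum_order_alg_closed:
  fixes p :: "'a::alg_closed_field poly"
  assumes "p \<noteq> 0"
  shows "(\<Sum>c | poly p c = 0. Polynomial.order c p) = Polynomial.degree p"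
  using alg_closed_proots(1)[OF assms] assms by (simp add: size_multiset_overloaded_eq)

lemma order_linear: "Polynomial.order c [:- a, 1:] = (if c = a then 1 else (0 :: nat))"
  for a :: "'a::idom"
  using order_power_n_n[of a 1] by (auto intro: order_0I)

lemma order_linear_power_mult:
  fixes q :: "'a::idom poly"
  assumes "q \<noteq> 0"
  shows "Polynomial.order c ([:- c, 1:] ^ n * q) = n + Polynomial.order c q"
  using assms by (simp add: order_mult order_power_n_n)

text \<open>
  Orders of \<open>A + B y\<close> above \<open>c\<close> are computed in two steps: the common power of \<open>x - c\<close> is split
  off here, and the primitive rest is treated below.
\<close>

lemma primitive_pair_ex:
  fixes A B :: "'a::field poly"
  assumes "A \<noteq> 0 \<or> B \<noteq> 0"
  shows "\<exists>n A' B'. A = [:- c, 1:] ^ n * A' \<and> B = [:- c, 1:] ^ n * B' \<and> (poly A' c \<noteq> 0 \<or> poly B' c \<noteq> 0)"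
  using assms
proof (induction "Polynomial.degree A + Polynomial.degree B" arbitrary: A B rule: less_induct)
  case less
  show ?case
  proof (cases "poly A c \<noteq> 0 \<or> poly B c \<noteq> 0")
    case True
    then show ?thesis
      by (intro exI[of _ 0] exI[of _ A] exI[of _ B]) simp
  next
    case False
    then have "[:- c, 1:] dvd A" "[:- c, 1:] dvd B"
      using poly_eq_0_iff_dvd by blast+
    then obtain A1 B1 where AB1: "A = [:- c, 1:] * A1" "B = [:- c, 1:] * B1"
      by (auto elim!: dvdE)
    have deg: "Polynomial.degree ([:- c, 1:] * p) = (if p = 0 then 0 else Suc (Polynomial.degree p))"
      for p :: "'a poly"
      by (simp add: degree_mult_eq del: mult_pCons_left)
    have "A1 \<noteq> 0 \<or> B1 \<noteq> 0" using less.prems AB1 by auto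
    moreover from this have "Polynomial.degree A1 + Polynomial.degree B1 < Polynomial.degree A + Polynomial.degree B"
      unfolding AB1 deg by auto
    ultimately obtain n A' B' where *: "A1 = [:- c, 1:] ^ n * A'" "B1 = [:- c, 1:] ^ n * B'"
      "poly A' c \<noteq> 0 \<or> poly B' c \<noteq> 0"
      using less.hyps[of A1 B1] by blast
    then show ?thesis
      unfolding AB1 by (intro exI[of _ "Suc n"] exI[of _ A'] exI[of _ B']) (simp only: power_Suc mult.assoc simp_thms)
  qed
qed

context hyperelliptic
begin

definition fiber :: "'a \<Rightarrow> 'a point set" where
  "fiber c = {Aff c d | d. d\<^sup>2 = poly f c}"

lemma fiber_eq:
  assumes "d\<^sup>2 = poly f c"
  shows "fiber c = {Aff c d, Aff c (- d)}"
  unfolding fiber_def assms[symmetric] by (auto simp: power2_eq_iff)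

lemma fiber_ex: "\<exists>d. d\<^sup>2 = poly f c"
  by (rule nth_root_exists) simp

lemma double_eq_0_iff: "x + x = (0 :: 'a) \<longleftrightarrow> x = 0"
  using two_nz by (simp flip: mult_2)

lemma neq_uminus: "d \<noteq> 0 \<Longrightarrow> - d \<noteq> (d :: 'a)"
  using double_eq_0_iff[of d] by (metis add.left_inverse)

lemma sum_fiber:
  assumes "d\<^sup>2 = poly f c"
  shows "(\<Sum>Q\<in>fiber c. F Q) = (if d = 0 then F (Aff c 0) else F (Aff c d) + F (Aff c (- d)))"
  unfolding fiber_eq[OF assms] using neq_uminus[of d] by auto

lemma curve_fn_linear_power:
  "curve_fn f ([:- c, 1:] ^ n * A) ([:- c, 1:] ^ n * B) = fn_of_poly ([:- c, 1:] ^ n) * curve_fn f A B"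
  "curve_norm f ([:- c, 1:] ^ n * A) ([:- c, 1:] ^ n * B) = [:- c, 1:] ^ (2 * n) * curve_norm f A B"
  unfolding curve_fn_def curve_norm_def fn.hom_mult
  by (simp_all only: power_mult_distrib power_even_eq distrib_left right_diff_distrib mult.assoc)

text \<open>
  A primitive function \<open>A + B y\<close> vanishes at no more than one of two distinct conjugate points.
  There its order is that of the norm, since its conjugate does not vanish.
\<close>

lemma ord_primitive_nonbranch:
  assumes d: "d\<^sup>2 = poly f c" "d \<noteq> 0" and prim: "poly A c \<noteq> 0 \<or> poly B c \<noteq> 0"
  shows "ord_at f (Aff c d) (curve_fn f A B) + ord_at f (Aff c (- d)) (curve_fn f A B)
    = int (Polynomial.order c (curve_norm f A B))"
proof -
  have nz: "A \<noteq> 0 \<or> B \<noteq> 0" using prim by auto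
  have *: "ord_at f (Aff c e) (curve_fn f A B) + ord_at f (Aff c (- e)) (curve_fn f A B)
    = int (Polynomial.order c (curve_norm f A B))"
    if e: "e\<^sup>2 = poly f c" "e \<noteq> 0" and val: "poly A c - poly B c * e \<noteq> 0" for e
  proof -
    have Q: "Aff c e \<in> curve f" "Aff c (- e) \<in> curve f" using e by (simp_all add: Aff_in_curve)
    have "ord_at f (Aff c (- e)) (curve_fn f A B) = 0"
      using ord_Aff_curve_fn_pos_iff[OF Q(2) nz] ord_Aff_curve_fn_nonneg[OF Q(2) nz] val by simp
    then show ?thesis
      using ord_Aff_curve_fn_norm[OF Q(1) val] e by (simp add: ram_index_def)
  qed
  show ?thesis
  proof (cases "poly A c - poly B c * d = 0")
    case True
    have "poly A c - poly B c * (- d) \<noteq> 0"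
    proof
      assume "poly A c - poly B c * (- d) = 0"
      with True have "poly A c + poly A c = 0" "poly B c * d + poly B c * d = 0"
        by (simp_all add: algebra_simps)
      then show False
        using prim d two_nz by (simp add: double_eq_0_iff)
    qed
    then show ?thesis
      using *[of "- d"] d by simp
  qed (use * d in blast)
qed

text \<open>At a branch point \<open>A\<close> vanishes to even order, at least two here, and \<open>B y\<close> to order one.\<close>

lemma ord_branch_simple_zero:
  assumes c: "poly f c = 0" and A: "poly A c = 0" and B: "poly B c \<noteq> 0"
  shows "ord_at f (Aff c 0) (curve_fn f A B) = 1"
proof -
  have Q: "Aff c 0 \<in> curve f" using c by (simp add: Aff_in_curve)
  have "B \<noteq> 0" using B by auto
  then have "has_ord (Aff c 0) (fn_of_poly B * fn_y f) (int (ram_index 0 * Polynomial.order c B) + 1)"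
    by (intro has_ord_mult has_ord_Aff_poly has_ord_branch_y Q)
  moreover have "Polynomial.order c B = 0" using B by (simp add: order_0I)
  ultimately have By: "has_ord (Aff c 0) (fn_of_poly B * fn_y f) 1"
    by simp
  have "has_ord (Aff c 0) (curve_fn f A B) 1"
  proof (cases "A = 0")
    case True
    then show ?thesis using By by (simp add: curve_fn_def fn.hom_zero)
  next
    case False
    have "Polynomial.order c A \<ge> 1"
      using order_root[of A c] False A by simp
    then have "1 < int (ram_index 0 * Polynomial.order c A)"
      by (simp add: ram_index_def)
    from has_ord_add[OF Q By has_ord_Aff_poly[OF Q False] this]
    show ?thesis by (simp add: curve_fn_def add.commute)
  qed
  then show ?thesis
    using ord_at_eq[OF Q] by simp
qed

lemma ord_primitive_branch:
  assumes c: "poly f c = 0" and prim: "poly A c \<noteq> 0 \<or> poly B c \<noteq> 0"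
  shows "ord_at f (Aff c 0) (curve_fn f A B) = int (Polynomial.order c (curve_norm f A B))"
proof -
  have Q: "Aff c 0 \<in> curve f" using c by (simp add: Aff_in_curve)
  show ?thesis
  proof (cases "poly A c = 0")
    case False
    then have "A \<noteq> 0 \<or> B \<noteq> 0" by auto
    then have "ord_at f (Aff c 0) (curve_fn f A B) = 0"
      using ord_Aff_curve_fn_pos_iff[OF Q, of A B] ord_Aff_curve_fn_nonneg[OF Q, of A B] False by simp
    moreover have "Polynomial.order c (curve_norm f A B) = 0"
      using False c by (intro order_0I) (simp add: curve_norm_def)
    ultimately show ?thesis by simp
  next
    case True
    then have B: "poly B c \<noteq> 0" "B \<noteq> 0" using prim by auto
    have "[:- c, 1:] dvd A" using True poly_eq_0_iff_dvd by blast
    then have A2: "[:- c, 1:]\<^sup>2 dvd A\<^sup>2" by (rule dvd_power_same)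
    have N: "curve_norm f A B \<noteq> 0" using B curve_norm_zero_iff by simp
    obtain f1 where f1: "f = [:- c, 1:] * f1" using c by (auto simp: poly_eq_0_iff_dvd elim: dvdE)
    have f1c: "poly f1 c \<noteq> 0"
    proof
      assume "poly f1 c = 0"
      then have "[:- c, 1:]\<^sup>2 dvd f"
        unfolding f1 power2_eq_square by (intro mult_dvd_mono) (simp_all add: poly_eq_0_iff_dvd)
      then show False using f_not_square_dvd by blast
    qed
    have "Polynomial.order c (B\<^sup>2 * f) = 1"
    proof -
      have "B\<^sup>2 * f = [:- c, 1:] ^ 1 * (B\<^sup>2 * f1)"
        unfolding f1 by (simp only: power_one_right ac_simps)
      moreover have "Polynomial.order c (B\<^sup>2 * f1) = 0"
        using B f1c by (intro order_0I) simp
      moreover have "B\<^sup>2 * f1 \<noteq> 0" using B f1c by auto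
      ultimately show ?thesis
        using order_linear_power_mult[of "B\<^sup>2 * f1" c 1] by (metis add_0_right)
    qed
    then have Bf: "[:- c, 1:] dvd B\<^sup>2 * f" "\<not> [:- c, 1:]\<^sup>2 dvd B\<^sup>2 * f"
      using order_divides[of c 1 "B\<^sup>2 * f"] order_divides[of c 2 "B\<^sup>2 * f"] B f_nz by simp_all
    have "[:- c, 1:] dvd curve_norm f A B"
      unfolding curve_norm_def using Bf(1) \<open>[:- c, 1:] dvd A\<close>
      by (intro dvd_diff) (simp_all add: power2_eq_square)
    moreover have "\<not> [:- c, 1:]\<^sup>2 dvd curve_norm f A B"
      unfolding curve_norm_def using A2 Bf(2) by (metis dvd_diff_right_iff)
    ultimately have ordN: "Polynomial.order c (curve_norm f A B) = 1"
      using order_divides[of c 1 "curve_norm f A B"] order_divides[of c 2 "curve_norm f A B"] N by simp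
    show ?thesis
      using ord_branch_simple_zero[OF c True B(1)] ordN by simp
  qed
qed

text \<open>
  The norm of a regular function records its zeros: above \<open>c\<close> they are counted by the
  multiplicity of \<open>c\<close> as a root of the norm.
\<close>

lemma sum_fiber_ord:
  assumes "A \<noteq> 0 \<or> B \<noteq> 0"
  shows "(\<Sum>Q\<in>fiber c. ord_at f Q (curve_fn f A B)) = int (Polynomial.order c (curve_norm f A B))"
proof -
  obtain d where d: "d\<^sup>2 = poly f c" using fiber_ex by blast
  obtain n A' B' where *: "A = [:- c, 1:] ^ n * A'" "B = [:- c, 1:] ^ n * B'"
    and prim: "poly A' c \<noteq> 0 \<or> poly B' c \<noteq> 0"
    using primitive_pair_ex[OF assms] by blast
  have nz: "A' \<noteq> 0 \<or> B' \<noteq> 0" using prim by auto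
  have Q: "Aff c d \<in> curve f" "Aff c (- d) \<in> curve f" using d by (simp_all add: Aff_in_curve)
  have Xn: "[:- c, 1:] ^ n \<noteq> 0" by simp
  have ordX: "Polynomial.order c ([:- c, 1:] ^ n) = n" by (rule order_power_n_n)
  have split: "ord_at f (Aff c e) (curve_fn f A B) = int (ram_index e * n) + ord_at f (Aff c e) (curve_fn f A' B')"
    if "Aff c e \<in> curve f" for e
    unfolding * curve_fn_linear_power
    using ord_mult[OF that poly_FF[OF Xn] curve_fn_FF[OF nz]] ord_Aff_poly[OF that Xn] by (simp only: ordX)
  have ordN: "Polynomial.order c (curve_norm f A B) = 2 * n + Polynomial.order c (curve_norm f A' B')"
    unfolding * curve_fn_linear_power
    by (rule order_linear_power_mult) (use nz curve_norm_zero_iff in blast)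
  show ?thesis
  proof (cases "d = 0")
    case True
    then have "poly f c = 0" using d by simp
    then show ?thesis
      using split[of d] Q ord_primitive_branch[OF _ prim] True
      unfolding sum_fiber[OF d] ordN by (simp add: ram_index_def)
  next
    case False
    then show ?thesis
      using split[of d] split[of "- d"] Q ord_primitive_nonbranch[OF d False prim]
      unfolding sum_fiber[OF d] ordN by (simp add: ram_index_def)
  qed
qed

lemma ord_nonzero_imp_norm_root:
  assumes "Aff c d \<in> curve f" "A \<noteq> 0 \<or> B \<noteq> 0" "ord_at f (Aff c d) (curve_fn f A B) \<noteq> 0"
  shows "poly (curve_norm f A B) c = 0"
proof -
  have "ord_at f (Aff c d) (curve_fn f A B) \<ge> 1"
    using ord_Aff_curve_fn_nonneg[OF assms(1,2)] assms(3) by linarith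
  then have "poly A c + poly B c * d = 0"
    using ord_Aff_curve_fn_pos_iff[OF assms(1,2)] by blast
  then have "poly A c = - (poly B c * d)" by (simp add: eq_neg_iff_add_eq_0)
  then show ?thesis
    using assms(1) by (simp add: curve_norm_def Aff_in_curve power_mult_distrib)
qed

lemma finite_fiber: "finite (fiber c)"
proof -
  obtain d where "d\<^sup>2 = poly f c" using fiber_ex by blast
  then show ?thesis by (simp add: fiber_eq)
qed

lemma disjoint_fibers: "c \<noteq> c' \<Longrightarrow> fiber c \<inter> fiber c' = {}"
  by (auto simp: fiber_def)

text \<open>A finite set that contains all zeros and poles of a regular function with norm \<open>N\<close>.\<close>

definition norm_support :: "'a poly \<Rightarrow> 'a point set" where
  "norm_support N = insert Infty (\<Union>c\<in>{c. poly N c = 0}. fiber c)"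

lemma finite_norm_support: "N \<noteq> 0 \<Longrightarrow> finite (norm_support N)"
  unfolding norm_support_def using finite_fiber poly_roots_finite[of N] by simp

lemma norm_support_le: "norm_support N \<subseteq> curve f"
  by (auto simp: norm_support_def fiber_def curve_def)

lemma ord_nonzero_imp_norm_support:
  assumes "Q \<in> curve f" "A \<noteq> 0 \<or> B \<noteq> 0" "ord_at f Q (curve_fn f A B) \<noteq> 0"
  shows "Q \<in> norm_support (curve_norm f A B)"
proof (cases Q)
  case (Aff c d)
  then have "poly (curve_norm f A B) c = 0" "Q \<in> fiber c"
    using ord_nonzero_imp_norm_root assms by (auto simp: fiber_def Aff_in_curve)
  then show ?thesis by (auto simp: norm_support_def)
qed (simp add: norm_support_def)

definition dvs :: "'a ratfun \<Rightarrow> 'a point \<Rightarrow>\<^sub>0 int" where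
  "dvs h = Abs_poly_mapping (\<lambda>Q. if Q \<in> curve f then ord_at f Q h else 0)"

lemma finite_ord_nonzero:
  assumes "h \<in> FF"
  shows "finite {Q. (if Q \<in> curve f then ord_at f Q h else 0) \<noteq> 0}"
proof -
  obtain A B C where *: "A \<noteq> 0 \<or> B \<noteq> 0" "C \<noteq> 0" "h = curve_fn f A B / fn_of_poly C"
    using assms by (rule FF_cases)
  have C: "C \<noteq> 0 \<or> 0 \<noteq> (0 :: 'a poly)" using * by simp
  have "ord_at f Q h = ord_at f Q (curve_fn f A B) - ord_at f Q (curve_fn f C 0)" if "Q \<in> curve f" for Q
    unfolding *(3) curve_fn_poly using that by (intro ord_divide curve_fn_FF poly_FF *)
  then have "ord_at f Q (curve_fn f A B) \<noteq> 0 \<or> ord_at f Q (curve_fn f C 0) \<noteq> 0"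
    if "Q \<in> curve f" "ord_at f Q h \<noteq> 0" for Q
    using that by fastforce
  then have "{Q. (if Q \<in> curve f then ord_at f Q h else 0) \<noteq> 0} \<subseteq>
      norm_support (curve_norm f A B) \<union> norm_support (curve_norm f C 0)"
    using ord_nonzero_imp_norm_support[OF _ *(1)] ord_nonzero_imp_norm_support[OF _ C]
    by (simp add: subset_iff) blast
  moreover have "finite \<dots>"
    using * curve_norm_zero_iff[of A B] curve_norm_zero_iff[of C 0] finite_norm_support by simp
  ultimately show ?thesis by (rule finite_subset)
qed

lemma lookup_dvs:
  "h \<in> FF \<Longrightarrow> Poly_Mapping.lookup (dvs h) Q = (if Q \<in> curve f then ord_at f Q h else 0)"
  unfolding dvs_def by (subst Abs_poly_mapping_inverse) (simp_all add: finite_ord_nonzero)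

lemma keys_dvs: "h \<in> FF \<Longrightarrow> Poly_Mapping.keys (dvs h) \<subseteq> curve f"
  by (auto simp: in_keys_iff lookup_dvs split: if_splits)

lemma dvs_mult: "h \<in> FF \<Longrightarrow> k \<in> FF \<Longrightarrow> dvs (h * k) = dvs h + dvs k"
  by (rule poly_mapping_eqI) (simp add: lookup_dvs[OF FF_mult] lookup_dvs lookup_add ord_mult)

lemma dvs_inverse: "h \<in> FF \<Longrightarrow> dvs (inverse h) = - dvs h"
  by (rule poly_mapping_eqI) (simp add: lookup_dvs[OF FF_inverse] lookup_dvs ord_inverse)

lemma dvs_divide: "h \<in> FF \<Longrightarrow> k \<in> FF \<Longrightarrow> dvs (h / k) = dvs h - dvs k"
  unfolding divide_inverse using dvs_mult[OF _ FF_inverse] dvs_inverse by simp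

text \<open>
  By the fiberwise count there are as many affine zeros as the degree of the norm, which is also
  the order of the pole at infinity.
\<close>

lemma div_degree_dvs_curve_fn:
  assumes "A \<noteq> 0 \<or> B \<noteq> 0"
  shows "div_degree (dvs (curve_fn f A B)) = 0"
proof -
  let ?N = "curve_norm f A B" and ?h = "curve_fn f A B"
  have N: "?N \<noteq> 0" using assms curve_norm_zero_iff by blast
  have h: "?h \<in> FF" using assms by (rule curve_fn_FF)
  have "div_degree (dvs ?h) = (\<Sum>Q\<in>norm_support ?N. Poly_Mapping.lookup (dvs ?h) Q)"
    using ord_nonzero_imp_norm_support[OF _ assms]
    by (intro div_degree_superset finite_norm_support N) (auto simp: in_keys_iff lookup_dvs[OF h] split: if_splits)
  also have "\<dots> = (\<Sum>Q\<in>norm_support ?N. ord_at f Q ?h)"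
    using norm_support_le by (intro sum.cong) (auto simp: lookup_dvs[OF h])
  also have "\<dots> = ord_at f Infty ?h + (\<Sum>Q\<in>(\<Union>c\<in>{c. poly ?N c = 0}. fiber c). ord_at f Q ?h)"
    unfolding norm_support_def using finite_norm_support[OF N]
    by (subst sum.insert) (auto simp: norm_support_def fiber_def)
  also have "(\<Sum>Q\<in>(\<Union>c\<in>{c. poly ?N c = 0}. fiber c). ord_at f Q ?h)
      = (\<Sum>c | poly ?N c = 0. \<Sum>Q\<in>fiber c. ord_at f Q ?h)"
    using disjoint_fibers finite_fiber poly_roots_finite[OF N] by (intro sum.UNION_disjoint) auto
  also have "\<dots> = int (\<Sum>c | poly ?N c = 0. Polynomial.order c ?N)"
    by (simp add: sum_fiber_ord[OF assms])
  also have "\<dots> = int (Polynomial.degree ?N)"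
    by (simp only: sum_order_alg_closed[OF N])
  finally show ?thesis
    using ord_Infty_curve_fn[OF assms] by simp
qed

lemma div_degree_dvs: "h \<in> FF \<Longrightarrow> div_degree (dvs h) = 0"
proof -
  assume "h \<in> FF"
  then obtain A B C where *: "A \<noteq> 0 \<or> B \<noteq> 0" "C \<noteq> 0" "h = curve_fn f A B / curve_fn f C 0"
    unfolding curve_fn_poly by (rule FF_cases)
  then show ?thesis
    using div_degree_dvs_curve_fn[of A B] div_degree_dvs_curve_fn[of C 0]
    unfolding *(3) by (subst dvs_divide) (use * in \<open>auto intro!: curve_fn_FF[THEN DiffD1] simp: curve_fn_zero_iff div_degree_diff\<close>)
qed

section \<open>The group of divisor classes\<close>

lemma principal_divisors_eq: "principal_divisors f = dvs ` FF"
proof (intro equalityI subsetI)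
  fix D assume "D \<in> principal_divisors f"
  then obtain h where D: "Poly_Mapping.keys D \<subseteq> curve f" "h \<in> FF"
    "\<forall>Q\<in>curve f. Poly_Mapping.lookup D Q = ord_at f Q h"
    unfolding principal_divisors_def div_group_def by auto
  have "D = dvs h"
    by (rule poly_mapping_eqI) (use D in \<open>auto simp: lookup_dvs in_keys_iff\<close>)
  with D show "D \<in> dvs ` FF" by blast
next
  fix D assume "D \<in> dvs ` FF"
  then show "D \<in> principal_divisors f"
    unfolding principal_divisors_def div_group_def using keys_dvs by (fastforce simp: lookup_dvs)
qed

abbreviation Div0 :: "('a point \<Rightarrow>\<^sub>0 int) monoid" where
  "Div0 \<equiv> div0_group f"

abbreviation Prin :: "('a point \<Rightarrow>\<^sub>0 int) set" where
  "Prin \<equiv> principal_divisors f"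

lemma Div0_carrier: "D \<in> carrier Div0 \<longleftrightarrow> Poly_Mapping.keys D \<subseteq> curve f \<and> div_degree D = 0"
  by (simp add: div0_group_def div_group_def)

lemma Div0_mult: "x \<otimes>\<^bsub>Div0\<^esub> y = x + y"
  by (simp add: div0_group_def div_group_def)

lemma Div0_one: "\<one>\<^bsub>Div0\<^esub> = 0"
  by (simp add: div0_group_def div_group_def)

lemma Div0_add: "x \<in> carrier Div0 \<Longrightarrow> y \<in> carrier Div0 \<Longrightarrow> x + y \<in> carrier Div0"
  unfolding Div0_carrier using Poly_Mapping.keys_add[of x y] by (auto simp: div_degree_add)

lemma Div0_uminus: "x \<in> carrier Div0 \<Longrightarrow> - x \<in> carrier Div0"
  unfolding Div0_carrier by (auto simp: div_degree_uminus)

lemma Div0_diff: "x \<in> carrier Div0 \<Longrightarrow> y \<in> carrier Div0 \<Longrightarrow> x - y \<in> carrier Div0"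
  using Div0_add[OF _ Div0_uminus, of x y] by simp

lemma Div0_comm_group: "comm_group Div0"
proof (rule comm_groupI)
  show "\<one>\<^bsub>Div0\<^esub> \<in> carrier Div0"
    by (simp add: Div0_one Div0_carrier div_degree_zero)
  show "\<exists>y\<in>carrier Div0. y \<otimes>\<^bsub>Div0\<^esub> x = \<one>\<^bsub>Div0\<^esub>" if "x \<in> carrier Div0" for x
    using Div0_uminus[OF that] by (intro bexI[of _ "- x"]) (simp_all add: Div0_mult Div0_one)
qed (simp_all add: Div0_mult Div0_one Div0_add ac_simps)

lemma Div0_inv:
  assumes "x \<in> carrier Div0"
  shows "inv\<^bsub>Div0\<^esub> x = - x"
proof -
  interpret comm_group Div0 by (rule Div0_comm_group)
  show ?thesis
    by (rule inv_equality) (use assms Div0_uminus in \<open>simp_all add: Div0_mult Div0_one\<close>)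
qed

lemma Prin_le: "Prin \<subseteq> carrier Div0"
  unfolding principal_divisors_eq image_subset_iff Div0_carrier using keys_dvs div_degree_dvs by blast

lemma Prin_zero: "0 \<in> Prin"
proof -
  have "dvs (fn_of_poly 1 / fn_of_poly 1) = 0"
    using poly_FF[of 1] by (subst dvs_divide) auto
  moreover have "fn_of_poly 1 / fn_of_poly 1 \<in> FF"
    by (intro FF_divide poly_FF) simp_all
  ultimately show ?thesis
    unfolding principal_divisors_eq by (metis imageI)
qed

lemma Prin_add: "x \<in> Prin \<Longrightarrow> y \<in> Prin \<Longrightarrow> x + y \<in> Prin"
  unfolding principal_divisors_eq image_iff using FF_mult dvs_mult by metis

lemma Prin_uminus: "x \<in> Prin \<Longrightarrow> - x \<in> Prin"
  unfolding principal_divisors_eq image_iff using FF_inverse dvs_inverse by metis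

lemma Prin_normal: "Prin \<lhd> Div0"
proof -
  interpret comm_group Div0 by (rule Div0_comm_group)
  have "subgroup Prin Div0"
  proof
    show "inv\<^bsub>Div0\<^esub> x \<in> Prin" if "x \<in> Prin" for x
      using Div0_inv that Prin_le Prin_uminus by auto
  qed (simp_all add: Prin_le Div0_mult Div0_one Prin_zero Prin_add)
  then show ?thesis by (simp add: normal_iff_subgroup)
qed

lemma cl_eq_coset: "cl f D = {p + D | p. p \<in> Prin}"
  by (auto simp: cl_def r_coset_def Div0_mult)

lemma cl_eq_iff: "cl f D = cl f E \<longleftrightarrow> D - E \<in> Prin"
proof
  assume "cl f D = cl f E"
  then have "D \<in> cl f E"
    using Prin_zero unfolding cl_eq_coset by force
  then show "D - E \<in> Prin" by (auto simp: cl_eq_coset)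
next
  assume *: "D - E \<in> Prin"
  have sub: "cl f D1 \<subseteq> cl f D2" if "D1 - D2 \<in> Prin" for D1 D2
  proof
    fix Z assume "Z \<in> cl f D1"
    then obtain p where "p \<in> Prin" "Z = (p + (D1 - D2)) + D2"
      unfolding cl_eq_coset by force
    then show "Z \<in> cl f D2"
      unfolding cl_eq_coset using Prin_add that by blast
  qed
  show "cl f D = cl f E"
    using sub[OF *] sub[of E D] Prin_uminus[OF *] by simp
qed

lemma jacobian_carrier: "A \<in> carrier (jacobian f) \<longleftrightarrow> (\<exists>D\<in>carrier Div0. A = cl f D)"
  by (auto simp: jacobian_def FactGroup_def RCOSETS_def cl_def)

lemma jacobian_double:
  assumes "D \<in> carrier Div0"
  shows "cl f D [^]\<^bsub>jacobian f\<^esub> (2::nat) = cl f (D + D)"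
proof -
  interpret N: normal Prin Div0 by (rule Prin_normal)
  interpret J: group "jacobian f"
    unfolding jacobian_def by (rule N.factorgroup_is_group)
  have "cl f D \<in> carrier (jacobian f)"
    using assms jacobian_carrier by blast
  then have "cl f D [^]\<^bsub>jacobian f\<^esub> (2::nat) = cl f D \<otimes>\<^bsub>jacobian f\<^esub> cl f D"
    unfolding numeral_2_eq_2 by (simp only: J.nat_pow_Suc J.nat_pow_0 J.l_one)
  also have "\<dots> = cl f (D + D)"
    using N.rcos_sum[OF assms assms] unfolding jacobian_def cl_def mult_FactGroup Div0_mult .
  finally show ?thesis .
qed

lemma halves_iff:
  "A \<in> halves f P \<longleftrightarrow> (\<exists>D\<in>carrier Div0. A = cl f D \<and> D + D - (frag_of P - frag_of Infty) \<in> Prin)"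
  unfolding halves_def mem_Collect_eq jacobian_carrier point_class_def cl_eq_iff[symmetric]
  using jacobian_double by metis

end

section \<open>Regular functions and effective divisors\<close>

lemma order_prod_linear:
  fixes e :: "'i \<Rightarrow> 'a::idom"
  assumes "finite K"
  shows "Polynomial.order c (\<Prod>i\<in>K. [:- e i, 1:] ^ n i) = (\<Sum>i\<in>K. if e i = c then n i else 0)"
  using assms
proof (induction K rule: finite_induct)
  case (insert i K)
  have nz: "(\<Prod>i\<in>K. [:- e i, 1:] ^ n i) \<noteq> 0"
    using insert.hyps(1) by (simp add: prod_zero_iff)
  have "Polynomial.order c ([:- e i, 1:] ^ n i) = (if e i = c then n i else 0)"
    by (auto simp: order_power_n_n intro!: order_0I)
  then show ?case
    using insert nz by (simp add: order_mult del: mult_pCons_left)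
qed simp

text \<open>
  The first Mumford polynomial of an effective affine divisor \<open>D\<close>. Its own divisor is
  \<open>D + \<iota>D - 2 deg D (\<infinity>)\<close>.
\<close>

definition x_poly :: "('a::field point \<Rightarrow>\<^sub>0 int) \<Rightarrow> 'a poly" where
  "x_poly D = (\<Prod>Q\<in>Poly_Mapping.keys D. [:- xcoord Q, 1:] ^ nat (Poly_Mapping.lookup D Q))"

lemma x_poly_nz: "x_poly D \<noteq> 0"
  by (simp add: x_poly_def prod_zero_iff)

lemma monic_x_poly: "lead_coeff (x_poly D) = 1"
  unfolding x_poly_def lead_coeff_prod by (rule prod.neutral) (simp add: lead_coeff_power)

lemma degree_x_poly:
  assumes "\<And>Q. Poly_Mapping.lookup D Q \<ge> 0"
  shows "int (Polynomial.degree (x_poly D)) = div_degree D"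
proof -
  have "Polynomial.degree (x_poly D) = (\<Sum>Q\<in>Poly_Mapping.keys D. nat (Poly_Mapping.lookup D Q))"
    unfolding x_poly_def by (subst degree_prod_eq_sum_degree) (auto simp: degree_linear_power)
  then show ?thesis
    using assms by (simp add: div_degree_def)
qed

context hyperelliptic
begin

definition effective :: "('a point \<Rightarrow>\<^sub>0 int) \<Rightarrow> bool" where
  "effective D \<longleftrightarrow> Poly_Mapping.keys D \<subseteq> curve f - {Infty} \<and> (\<forall>Q. Poly_Mapping.lookup D Q \<ge> 0)"

lemma order_x_poly:
  assumes D: "effective D" and d: "d\<^sup>2 = poly f c"
  shows "int (ram_index d * Polynomial.order c (x_poly D)) =
    Poly_Mapping.lookup D (Aff c d) + Poly_Mapping.lookup D (Aff c (- d))"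
proof -
  have fib: "Q \<in> fiber c \<longleftrightarrow> xcoord Q = c" if "Q \<in> Poly_Mapping.keys D" for Q
    using that D unfolding effective_def by (cases Q) (auto simp: fiber_def curve_def)
  have "Polynomial.order c (x_poly D) =
      (\<Sum>Q\<in>Poly_Mapping.keys D. if xcoord Q = c then nat (Poly_Mapping.lookup D Q) else 0)"
    unfolding x_poly_def by (rule order_prod_linear) simp
  also have "\<dots> = (\<Sum>Q\<in>Poly_Mapping.keys D \<inter> fiber c. nat (Poly_Mapping.lookup D Q))"
    using fib by (subst sum.inter_restrict) (auto intro!: sum.cong)
  also have "\<dots> = (\<Sum>Q\<in>fiber c. nat (Poly_Mapping.lookup D Q))"
    by (rule sum.mono_neutral_left) (auto simp: finite_fiber in_keys_iff)
  finally have "int (Polynomial.order c (x_poly D)) = (\<Sum>Q\<in>fiber c. Poly_Mapping.lookup D Q)"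
    using D by (simp add: effective_def)
  then show ?thesis
    unfolding sum_fiber[OF d] by (simp add: ram_index_def)
qed

lemma ord_x_poly:
  assumes "effective D" "Aff c d \<in> curve f"
  shows "ord_at f (Aff c d) (fn_of_poly (x_poly D)) =
    Poly_Mapping.lookup D (Aff c d) + Poly_Mapping.lookup D (Aff c (- d))"
  using assms(2) unfolding ord_Aff_poly[OF assms(2) x_poly_nz]
  by (intro order_x_poly[OF assms(1)]) (simp add: Aff_in_curve)

lemma ord_Infty_poly: "p \<noteq> 0 \<Longrightarrow> ord_at f Infty (fn_of_poly p) = - 2 * int (Polynomial.degree p)"
  by (intro ord_at_eq has_ord_Infty_poly Infty_in_curve)

lemma ord_Infty_x_poly:
  assumes "effective D"
  shows "ord_at f Infty (fn_of_poly (x_poly D)) = - 2 * div_degree D"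
  using assms degree_x_poly[of D] by (simp add: ord_Infty_poly x_poly_nz effective_def)

lemma curve_fn_smult:
  "curve_fn f (Polynomial.smult k A) (Polynomial.smult k B) = const_fn k * curve_fn f A B"
proof -
  have "fn_of_poly (Polynomial.smult k p) = const_fn k * fn_of_poly p" for p :: "'a poly"
    using fn.hom_mult[of "[:k:]" p] by simp
  then show ?thesis by (simp add: curve_fn_def algebra_simps)
qed

text \<open>
  The affine curve is normal: clear denominators and cancel the linear factors of the denominator
  one at a time.
\<close>

lemma regular_imp_curve_fn:
  assumes "C \<noteq> 0" "A \<noteq> 0 \<or> B \<noteq> 0" "h = curve_fn f A B / fn_of_poly C"
    and "\<And>Q. Q \<in> curve f - {Infty} \<Longrightarrow> ord_at f Q h \<ge> 0"
  shows "\<exists>A' B'. (A' \<noteq> 0 \<or> B' \<noteq> 0) \<and> h = curve_fn f A' B'"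
  using assms
proof (induction "Polynomial.degree C" arbitrary: A B C)
  case 0
  then obtain c where c: "C = [:c:]" "c \<noteq> 0"
    by (metis degree_eq_zeroE pCons_eq_0_iff)
  have "[:inverse c:] * [:c:] = 1"
    using c(2) by (simp add: one_pCons)
  then have "const_fn (inverse c) * const_fn c = 1"
    by (metis fn.hom_mult fn.hom_one)
  then have "inverse (const_fn c) = const_fn (inverse c)"
    by (metis inverse_unique mult.commute)
  then have "h = curve_fn f (Polynomial.smult (inverse c) A) (Polynomial.smult (inverse c) B)"
    unfolding curve_fn_smult 0 c(1) divide_inverse by (simp only: mult.commute)
  moreover have "Polynomial.smult (inverse c) A \<noteq> 0 \<or> Polynomial.smult (inverse c) B \<noteq> 0"
    using c(2) 0 by auto
  ultimately show ?case by blast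
next
  case (Suc n)
  have "Polynomial.degree C > 0" using Suc.hyps(2) by simp
  then obtain c where "poly C c = 0"
    using alg_closed_imp_poly_has_root by blast
  then obtain C1 where C1: "C = [:- c, 1:] * C1"
    using poly_eq_0_iff_dvd by (blast elim: dvdE)
  have ordC: "Polynomial.order c C \<ge> 1"
    using \<open>poly C c = 0\<close> Suc.prems(1) order_root[of C c] by simp
  have ge: "ord_at f (Aff c d) (curve_fn f A B) \<ge> int (ram_index d)" if Q: "Aff c d \<in> curve f" for d
  proof -
    have "ord_at f (Aff c d) h \<ge> 0" using Suc.prems(4) Q by simp
    then have "ord_at f (Aff c d) (curve_fn f A B) \<ge> int (ram_index d * Polynomial.order c C)"
      unfolding Suc.prems(3)
      by (simp only: ord_divide[OF Q curve_fn_FF[OF Suc.prems(2)] poly_FF[OF Suc.prems(1)]]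
        ord_Aff_poly[OF Q Suc.prems(1)] diff_ge_0_iff_ge)
    moreover have "ram_index d * 1 \<le> ram_index d * Polynomial.order c C"
      using ordC by (rule mult_le_mono2)
    ultimately show ?thesis by linarith
  qed
  have val: "poly A c + poly B c * d = 0" if Q: "Aff c d \<in> curve f" for d
    using ge[OF Q] ord_Aff_curve_fn_pos_iff[OF Q Suc.prems(2)] by (auto simp: ram_index_def split: if_splits)
  obtain d where d: "d\<^sup>2 = poly f c" using fiber_ex by blast
  have Q: "Aff c d \<in> curve f" "Aff c (- d) \<in> curve f" using d by (simp_all add: Aff_in_curve)
  have zero: "poly A c = 0 \<and> poly B c = 0"
  proof (cases "d = 0")
    case True
    then have A: "poly A c = 0" and fc: "poly f c = 0" using val[OF Q(1)] d by simp_all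
    moreover have "poly B c = 0"
    proof (rule ccontr)
      assume "poly B c \<noteq> 0"
      then show False
        using ord_branch_simple_zero[OF fc A] ge[OF Q(1)] True by (simp add: ram_index_def)
    qed
    ultimately show ?thesis by blast
  next
    case False
    have "poly A c + poly B c * d = 0" "poly A c - poly B c * d = 0"
      using val[OF Q(1)] val[OF Q(2)] by simp_all
    then have "poly A c + poly A c = 0" "poly B c * d + poly B c * d = 0"
      by (simp_all add: algebra_simps)
    then show ?thesis
      using False two_nz by (simp add: double_eq_0_iff)
  qed
  then have "[:- c, 1:] dvd A" "[:- c, 1:] dvd B"
    using poly_eq_0_iff_dvd by blast+
  then obtain A1 B1 where AB1: "A = [:- c, 1:] * A1" "B = [:- c, 1:] * B1"
    by (blast elim: dvdE)
  have nz: "C1 \<noteq> 0" "A1 \<noteq> 0 \<or> B1 \<noteq> 0" using Suc.prems C1 AB1 by auto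
  have "h = curve_fn f A1 B1 / fn_of_poly C1"
    unfolding Suc.prems(3) AB1 C1 fn.hom_mult
    using curve_fn_linear_power(1)[of c 1 A1 B1] by (simp del: mult_pCons_left)
  moreover have "n = Polynomial.degree C1"
    using Suc.hyps(2) nz unfolding C1 by (simp add: degree_mult_eq del: mult_pCons_left)
  ultimately show ?case
    using Suc.hyps(1)[OF _ nz] Suc.prems(4) by blast
qed

lemma regular_function:
  assumes "h \<in> FF" "\<And>Q. Q \<in> curve f - {Infty} \<Longrightarrow> ord_at f Q h \<ge> 0"
  obtains A B where "A \<noteq> 0 \<or> B \<noteq> 0" "h = curve_fn f A B"
  using FF_cases[OF assms(1)] regular_imp_curve_fn[OF _ _ _ assms(2)] by metis

section \<open>Uniqueness of the reduced divisor in a class\<close>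

lemma reduced_effective: "reduced f D \<Longrightarrow> effective D"
  by (auto simp: reduced_def semi_reduced_def effective_def)

lemma lookup_minus_infty:
  assumes "effective D"
  shows "Poly_Mapping.lookup (minus_infty D) Q = (if Q = Infty then - div_degree D else Poly_Mapping.lookup D Q)"
proof -
  have "Poly_Mapping.lookup D Infty = 0"
    using assms by (auto simp: effective_def in_keys_iff)
  then show ?thesis by (simp add: minus_infty_def lookup_minus)
qed

lemma minus_infty_Div0: "effective D \<Longrightarrow> minus_infty D \<in> carrier Div0"
proof -
  assume D: "effective D"
  have "Q \<in> curve f" if "Q \<in> Poly_Mapping.keys (minus_infty D)" for Q
  proof (cases "Q = Infty")
    case False
    then have "Q \<in> Poly_Mapping.keys D"
      using that unfolding in_keys_iff lookup_minus_infty[OF D] by simp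
    then show ?thesis using D by (auto simp: effective_def)
  qed (simp add: Infty_in_curve)
  then show ?thesis
    by (auto simp: Div0_carrier div_degree_minus_infty)
qed

text \<open>
  If \<open>D - D'\<close> is the divisor of \<open>h\<close>, then multiplying \<open>h\<close> by the polynomial with divisor
  \<open>D' + \<iota>D'\<close> gives a regular function with at most \<open>2g\<close> zeros. Its pole at infinity is too small
  to involve \<open>y\<close>, so its divisor \<open>D + \<iota>D'\<close> is invariant under the involution, and even at the
  branch points. For reduced divisors this forces \<open>D = D'\<close>.
\<close>

lemma reduced_unique:
  assumes D: "reduced f D" and D': "reduced f D'" and eq: "cl f (minus_infty D) = cl f (minus_infty D')"
  shows "D = D'"
proof -
  let ?l = Poly_Mapping.lookup
  note eff = reduced_effective[OF D] reduced_effective[OF D']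
  have "minus_infty D - minus_infty D' \<in> Prin" using eq by (simp add: cl_eq_iff)
  then obtain h where h: "h \<in> FF" "minus_infty D - minus_infty D' = dvs h"
    unfolding principal_divisors_eq by blast
  have ordh: "ord_at f Q h = ?l (minus_infty D) Q - ?l (minus_infty D') Q" if "Q \<in> curve f" for Q
    using arg_cong[OF h(2), of "\<lambda>D. ?l D Q"] that by (simp add: lookup_dvs[OF h(1)] lookup_minus)
  define k where "k = h * fn_of_poly (x_poly D')"
  have k: "k \<in> FF" unfolding k_def by (intro FF_mult h poly_FF x_poly_nz)
  have ordk: "ord_at f Q k = ord_at f Q h + ord_at f Q (fn_of_poly (x_poly D'))" if "Q \<in> curve f" for Q
    unfolding k_def by (intro ord_mult that h poly_FF x_poly_nz)
  have aff: "ord_at f (Aff c d) k = ?l D (Aff c d) + ?l D' (Aff c (- d))" if "Aff c d \<in> curve f" for c d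
    using ordk[OF that] ordh[OF that] ord_x_poly[OF eff(2) that] eff
    by (simp add: lookup_minus_infty)
  have inf: "ord_at f Infty k = - div_degree D - div_degree D'"
    using ordk[OF Infty_in_curve] ordh[OF Infty_in_curve] ord_Infty_x_poly[OF eff(2)] eff
    by (simp add: lookup_minus_infty)
  have nonneg: "ord_at f Q k \<ge> 0" if "Q \<in> curve f - {Infty}" for Q
    using that aff eff by (cases Q) (auto simp: effective_def)
  obtain A B where AB: "A \<noteq> 0 \<or> B \<noteq> 0" "k = curve_fn f A B"
    using regular_function[OF k nonneg] by metis
  have "B = 0"
  proof (rule ccontr)
    assume "B \<noteq> 0"
    then have "Polynomial.degree (curve_norm f A B) \<ge> 2 * g + 1"
      by (simp add: degree_curve_norm)
    then have "div_degree D + div_degree D' \<ge> 2 * int g + 1"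
      using inf ord_Infty_curve_fn[OF AB(1)] AB(2) by simp
    then show False
      using D D' by (simp add: reduced_def genus_f)
  qed
  then have ordA: "ord_at f (Aff c d) k = int (ram_index d * Polynomial.order c A)" if "Aff c d \<in> curve f" for c d
    using AB ord_Aff_poly[OF that, of A] by (simp add: curve_fn_poly)
  have "?l D Q = ?l D' Q" for Q
  proof (cases "Q \<in> curve f - {Infty}")
    case True
    then obtain c d where Q: "Q = Aff c d" "Aff c d \<in> curve f" by (cases Q) auto
    then have Q': "Aff c (- d) \<in> curve f" by (simp add: Aff_in_curve)
    have sum: "?l D (Aff c d) + ?l D' (Aff c (- d)) = int (ram_index d * Polynomial.order c A)"
      using aff[OF Q(2)] ordA[OF Q(2)] by simp
    have sum': "?l D (Aff c (- d)) + ?l D' (Aff c d) = int (ram_index d * Polynomial.order c A)"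
      using aff[OF Q'] ordA[OF Q'] by (simp add: ram_index_def)
    show ?thesis
    proof (cases "d = 0")
      case True
      have "poly f c = 0" using Q(2) True by (simp add: Aff_in_curve)
      then have "Aff c 0 \<in> weierstrass_points f" by (simp add: weierstrass_points_def)
      then have 01: "?l E (Aff c 0) = 0 \<or> ?l E (Aff c 0) = 1" if "reduced f E" for E
        using that by (auto simp: reduced_def semi_reduced_def in_keys_iff)
      have parity: "m = n" if "m = 0 \<or> m = 1" "n = 0 \<or> n = 1" "m + n = 2 * k" for m n k :: int
        using that by presburger
      from 01[OF D] 01[OF D'] have "?l D (Aff c 0) = 0 \<or> ?l D (Aff c 0) = 1" "?l D' (Aff c 0) = 0 \<or> ?l D' (Aff c 0) = 1"
        by blast+
      then show ?thesis
        using sum True Q(1)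
          parity[of "?l D (Aff c 0)" "?l D' (Aff c 0)" "int (Polynomial.order c A)"]
        by (simp add: ram_index_def)
    next
      case False
      then have nW: "Aff c d \<notin> weierstrass_points f" by (simp add: weierstrass_points_def)
      have "?l E (Aff c d) \<ge> 0 \<and> ?l E (Aff c (- d)) \<ge> 0 \<and> (?l E (Aff c d) = 0 \<or> ?l E (Aff c (- d)) = 0)"
        if "reduced f E" for E
        using that nW by (auto simp: reduced_def semi_reduced_def in_keys_iff)
      from this[OF D] this[OF D'] show ?thesis
        using sum sum' Q(1) by auto
    qed
  next
    case False
    then show ?thesis
      using eff by (metis effective_def not_in_keys_iff_lookup_eq_zero subsetD)
  qed
  then show ?thesis by (rule poly_mapping_eqI)
qed

section \<open>Existence of an effective representative of degree at most \<open>g\<close>\<close>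

lemma function_field_add: "h \<in> function_field f \<Longrightarrow> k \<in> function_field f \<Longrightarrow> h + k \<in> function_field f"
proof -
  assume "h \<in> function_field f" "k \<in> function_field f"
  then obtain u v u' v' where "h = to_ac u + to_ac v * fn_y f" "k = to_ac u' + to_ac v' * fn_y f"
    unfolding function_field_def by blast
  then have "h + k = to_ac (u + u') + to_ac (v + v') * fn_y f"
    by (simp add: algebra_simps)
  then show ?thesis unfolding function_field_def by blast
qed

lemma FF_uminus: "h \<in> FF \<Longrightarrow> - h \<in> FF"
  using FF_mult[OF poly_FF[of "- 1"], of h] by (simp add: fn.hom_uminus fn.hom_one)

lemma ord_uminus: "Q \<in> curve f \<Longrightarrow> h \<in> FF \<Longrightarrow> ord_at f Q (- h) = ord_at f Q h"
  using ord_at_eq dvr.has_val_uminus[OF point_dvr] has_ord_ord_at unfolding has_ord_def by metis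

text \<open>The pole order at infinity is exact, as distinct pole orders witness linear independence.\<close>

definition vanishing :: "'a point multiset \<Rightarrow> nat \<Rightarrow> 'a ratfun \<Rightarrow> bool" where
  "vanishing \<M> m h \<longleftrightarrow> h \<in> FF \<and> (\<forall>Q\<in>curve f - {Infty}. ord_at f Q h \<ge> int (count \<M> Q)) \<and>
     ord_at f Infty h = - int m"

text \<open>\<open>x\<^sup>j\<close> and \<open>x\<^sup>j y\<close> realise all pole orders except the \<open>g\<close> odd numbers below \<open>2g\<close>.\<close>

lemma vanishing_base:
  assumes "\<not> (odd m \<and> m < 2 * g)"
  shows "\<exists>h. vanishing {#} m h"
proof (cases "even m")
  case True
  then obtain j where j: "m = 2 * j" by (elim evenE)
  have "vanishing {#} m (curve_fn f ([:0, 1:] ^ j) 0)"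
    unfolding vanishing_def j using ord_Aff_curve_fn_nonneg[of _ _ "[:0, 1:] ^ j" 0]
    by (auto simp: curve_fn_FF[THEN DiffD1] curve_fn_zero_iff ord_Infty_curve_fn degree_curve_norm
        degree_linear_power[of 0, simplified] curve_def)
  then show ?thesis by blast
next
  case False
  then obtain i where "m = 2 * i + 1" "g \<le> i"
    using assms by (auto elim!: oddE)
  then obtain j where j: "m = 2 * j + 2 * g + 1"
    by (metis add.commute add_mult_distrib2 le_Suc_ex)
  have "vanishing {#} m (curve_fn f 0 ([:0, 1:] ^ j))"
    unfolding vanishing_def j using ord_Aff_curve_fn_nonneg[of _ _ 0 "[:0, 1:] ^ j"]
    by (auto simp: curve_fn_FF[THEN DiffD1] curve_fn_zero_iff ord_Infty_curve_fn degree_curve_norm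
        degree_linear_power[of 0, simplified] curve_def)
  then show ?thesis by blast
qed

text \<open>
  Functions with different pole orders at infinity are linearly independent. Instead of dimensions
  it is enough to count attained pole orders: requiring one more zero at \<open>Q\<close> loses at most the
  least pole order of a function that violates the requirement, since this function can be used to
  cancel the value at \<open>Q\<close> of the others without changing their pole orders.
\<close>

lemma vanishing_step:
  assumes Q: "Q \<in> curve f - {Infty}" and S: "finite S" "\<And>m. m \<in> S \<Longrightarrow> \<exists>h. vanishing \<M> m h"
  shows "\<exists>S'\<subseteq>S. card S \<le> Suc (card S') \<and> (\<forall>m\<in>S'. \<exists>h. vanishing (add_mset Q \<M>) m h)"
proof -
  have Qc: "Q \<in> curve f" using Q by simp
  obtain H where H: "\<And>m. m \<in> S \<Longrightarrow> vanishing \<M> m (H m)"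
    using S(2) by metis
  define T where "T = {m \<in> S. ord_at f Q (H m) = int (count \<M> Q)}"
  have raise: "vanishing (add_mset Q \<M>) m h" if "vanishing \<M> m h" "ord_at f Q h > int (count \<M> Q)" for m h
    using that by (auto simp: vanishing_def)
  have outside: "vanishing (add_mset Q \<M>) m (H m)" if "m \<in> S - T" for m
    using that H[of m] Q by (intro raise) (auto simp: T_def vanishing_def less_le)
  show ?thesis
  proof (cases "T = {}")
    case True
    then show ?thesis
      using outside by (intro exI[of _ S]) auto
  next
    case False
    have "finite T" using S(1) by (simp add: T_def)
    \<comment> \<open>The least pole order in \<open>T\<close> is the one given up: its function does not disturb larger poles.\<close>
    define m0 where "m0 = Min T"
    have m0: "m0 \<in> T" "\<And>m. m \<in> T \<Longrightarrow> m0 \<le> m"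
      using \<open>finite T\<close> False by (simp_all add: m0_def)
    then have m0S: "m0 \<in> S" by (simp add: T_def)
    define h0 where "h0 = H m0"
    have h0: "h0 \<in> FF" "\<And>Q. Q \<in> curve f - {Infty} \<Longrightarrow> ord_at f Q h0 \<ge> int (count \<M> Q)"
      "ord_at f Infty h0 = - int m0" "ord_at f Q h0 = int (count \<M> Q)"
      using H[OF m0S] m0(1) by (auto simp: vanishing_def h0_def T_def)
    have "\<exists>h. vanishing (add_mset Q \<M>) m h" if m: "m \<in> S - {m0}" for m
    proof (cases "m \<in> T")
      case True
      then have less: "m0 < m" using m0(2) m by fastforce
      have h: "H m \<in> FF" "\<And>Q. Q \<in> curve f - {Infty} \<Longrightarrow> ord_at f Q (H m) \<ge> int (count \<M> Q)"
        "ord_at f Infty (H m) = - int m" "ord_at f Q (H m) = int (count \<M> Q)"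
        using H[of m] m True by (auto simp: vanishing_def T_def)
      obtain c where c: "H m - const_fn c * h0 \<in> FF \<longrightarrow> ord_at f Q (H m - const_fn c * h0) > ord_at f Q h0"
        using ord_cancel_ex[OF Qc h0(1) h(1)] h(4) h0(4) by auto
      have "c \<noteq> 0"
        using c h(1,4) h0(4) by (auto simp: fn.hom_zero)
      define k where "k = - (const_fn c * h0)"
      have ch0: "const_fn c * h0 \<in> FF"
        using \<open>c \<noteq> 0\<close> by (intro FF_mult poly_FF h0) simp
      then have k: "k \<in> FF" unfolding k_def by (rule FF_uminus)
      have ordk: "ord_at f Q k = ord_at f Q h0" if "Q \<in> curve f" for Q
        unfolding k_def using ord_uminus[OF that ch0] ord_mult[OF that poly_FF[of "[:c:]"] h0(1)]
          ord_const[OF that \<open>c \<noteq> 0\<close>] \<open>c \<noteq> 0\<close> by simp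
      have "H m + k \<noteq> 0"
      proof
        assume "H m + k = 0"
        then have "H m = - k" by (simp add: eq_neg_iff_add_eq_0)
        then have "ord_at f Infty (H m) = ord_at f Infty h0"
          using ord_uminus[OF Infty_in_curve k] ordk[OF Infty_in_curve] by simp
        then show False using h(3) h0(3) less by simp
      qed
      then have hk: "H m + k \<in> FF"
        using function_field_add h(1) k by simp
      have "vanishing (add_mset Q \<M>) m (H m + k)"
      proof (rule raise)
        have "ord_at f Infty (H m + k) = - int m"
          using ord_add_less[OF Infty_in_curve h(1) k] ordk[OF Infty_in_curve] h(3) h0(3) less by simp
        moreover have "ord_at f P (H m + k) \<ge> int (count \<M> P)" if "P \<in> curve f - {Infty}" for P
          using ord_add_ge[OF _ h(1) k hk, of P] ordk[of P] h(2)[OF that] h0(2)[OF that] that by auto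
        ultimately show "vanishing \<M> m (H m + k)"
          using hk by (simp add: vanishing_def)
        have "H m + k = H m - const_fn c * h0" by (simp add: k_def)
        then show "ord_at f Q (H m + k) > int (count \<M> Q)"
          using c hk h0(4) by metis
      qed
      then show ?thesis by blast
    next
      case False
      then show ?thesis using outside[of m] m by blast
    qed
    moreover have "card S \<le> Suc (card (S - {m0}))"
      using card_Suc_Diff1[OF S(1) m0S] by simp
    ultimately show ?thesis
      by (intro exI[of _ "S - {m0}"]) auto
  qed
qed

lemma vanishing_count:
  assumes "set_mset \<M> \<subseteq> curve f - {Infty}"
  shows "\<exists>S\<subseteq>{..n}. Suc n \<le> card S + g + size \<M> \<and> (\<forall>m\<in>S. \<exists>h. vanishing \<M> m h)"
  using assms
proof (induction \<M>)
  case empty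
  define S where "S = {m. m \<le> n \<and> \<not> (odd m \<and> m < 2 * g)}"
  have "{..n} \<subseteq> S \<union> (\<lambda>i. 2 * i + 1) ` {..<g}"
    by (auto simp: S_def elim!: oddE)
  then have "card {..n} \<le> card (S \<union> (\<lambda>i. 2 * i + 1) ` {..<g})"
    by (rule card_mono[rotated]) (simp add: S_def)
  also have "\<dots> \<le> card S + card ((\<lambda>i. 2 * i + 1) ` {..<g})"
    by (rule card_Un_le)
  also have "card ((\<lambda>i. 2 * i + 1) ` {..<g}) \<le> g"
    using card_image_le[of "{..<g}"] by simp
  finally have "Suc n \<le> card S + g" by simp
  then show ?case
    using vanishing_base by (intro exI[of _ S]) (auto simp: S_def)
next
  case (add Q \<M>)
  then obtain S where S: "S \<subseteq> {..n}" "Suc n \<le> card S + g + size \<M>" "\<forall>m\<in>S. \<exists>h. vanishing \<M> m h"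
    by auto
  moreover have "Q \<in> curve f - {Infty}" "finite S"
    using add.prems S(1) finite_subset by auto
  ultimately obtain S' where "S' \<subseteq> S" "card S \<le> Suc (card S')"
    "\<forall>m\<in>S'. \<exists>h. vanishing (add_mset Q \<M>) m h"
    using vanishing_step[of Q S \<M>] by blast
  then show ?case
    using S by (intro exI[of _ S']) auto
qed

lemma riemann_inequality:
  assumes "set_mset \<M> \<subseteq> curve f - {Infty}"
  obtains h where "h \<in> FF" "\<And>Q. Q \<in> curve f - {Infty} \<Longrightarrow> ord_at f Q h \<ge> int (count \<M> Q)"
    "ord_at f Infty h \<ge> - int (size \<M> + g)"
proof -
  obtain S where S: "S \<subseteq> {..size \<M> + g}" "Suc (size \<M> + g) \<le> card S + g + size \<M>"
    "\<forall>m\<in>S. \<exists>h. vanishing \<M> m h"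
    using vanishing_count[OF assms] by blast
  then have "S \<noteq> {}" by auto
  then obtain m h where "m \<le> size \<M> + g" "vanishing \<M> m h"
    using S(1,3) by blast
  then show thesis
    using that by (auto simp: vanishing_def)
qed

text \<open>
  Let \<open>C\<close> be a polynomial in \<open>x\<close> so divisible that \<open>F = div C - D\<close> is effective on the affine curve,
  of affine degree \<open>n\<close> say. A function \<open>h\<close> that vanishes along the affine part of \<open>F\<close> and has a pole
  of order at most \<open>n + g\<close> at infinity gives the representative \<open>D + div (h / C) = div h - F\<close>.
\<close>

lemma effective_representative:
  assumes D: "D \<in> carrier Div0"
  obtains E where "effective E" "div_degree E \<le> int g" "cl f D = cl f (minus_infty E)"
proof -
  let ?l = Poly_Mapping.lookup
  define K where "K = Poly_Mapping.keys D - {Infty}"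
  define C where "C = (\<Prod>Q\<in>K. [:- xcoord Q, 1:] ^ nat \<bar>?l D Q\<bar>)"
  have Kc: "K \<subseteq> curve f" "finite K" using D by (auto simp: K_def Div0_carrier)
  have C: "C \<noteq> 0" using Kc by (simp add: C_def prod_zero_iff)
  have C_FF: "fn_of_poly C \<in> FF" by (rule poly_FF[OF C])
  define F where "F = dvs (fn_of_poly C) - D"
  have F_Div0: "F \<in> carrier Div0"
    unfolding F_def using keys_dvs[OF C_FF] div_degree_dvs[OF C_FF] D by (intro Div0_diff) (simp_all only: Div0_carrier simp_thms)
  have F_nonneg: "?l F Q \<ge> 0" if "Q \<noteq> Infty" for Q
  proof (cases "Q \<in> K")
    case True
    then obtain c d where Q: "Q = Aff c d" "Aff c d \<in> curve f" using Kc by (cases Q) (auto simp: K_def)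
    have "nat \<bar>?l D Q\<bar> \<le> Polynomial.order c C"
      unfolding C_def order_prod_linear[OF Kc(2)]
      using member_le_sum[OF True, of "\<lambda>i. if xcoord i = c then nat \<bar>?l D i\<bar> else 0"] Kc(2) Q(1) by simp
    also have "\<dots> \<le> ram_index d * Polynomial.order c C"
      by (simp add: ram_index_def)
    finally have "ord_at f Q (fn_of_poly C) \<ge> \<bar>?l D Q\<bar>"
      using ord_Aff_poly[OF Q(2) C] Q(1) by (simp add: nat_le_iff)
    then show ?thesis
      using Q by (simp add: F_def lookup_minus lookup_dvs[OF C_FF])
  next
    case False
    then have "?l D Q = 0" using that by (simp add: K_def in_keys_iff)
    moreover have "ord_at f Q (fn_of_poly C) \<ge> 0" if "Q \<in> curve f"
      using that \<open>Q \<noteq> Infty\<close> ord_Aff_poly[OF _ C] by (cases Q) auto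
    ultimately show ?thesis
      by (simp add: F_def lookup_minus lookup_dvs[OF C_FF])
  qed
  define \<M> where "\<M> = (\<Sum>Q\<in>Poly_Mapping.keys F - {Infty}. replicate_mset (nat (?l F Q)) Q)"
  have countM: "int (count \<M> Q) = ?l F Q" if "Q \<noteq> Infty" for Q
    using that F_nonneg[OF that] by (auto simp: \<M>_def count_sum if_distrib sum.delta in_keys_iff)
  have setM: "set_mset \<M> \<subseteq> curve f - {Infty}"
    using F_Div0 by (auto simp: \<M>_def Div0_carrier set_mset_sum split: if_splits)
  have size_sum: "size (\<Sum>i\<in>J. replicate_mset (n i) i) = (\<Sum>i\<in>J. n i)" if "finite J"
    for J :: "'a point set" and n
    using that by (induction J rule: finite_induct) simp_all
  have "0 = ?l F Infty + (\<Sum>Q\<in>Poly_Mapping.keys F - {Infty}. ?l F Q)"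
    using F_Div0 sum.remove[of "insert Infty (Poly_Mapping.keys F)" Infty "?l F"]
      div_degree_superset[of "insert Infty (Poly_Mapping.keys F)" F] by (auto simp: Div0_carrier)
  also have "(\<Sum>Q\<in>Poly_Mapping.keys F - {Infty}. ?l F Q) = int (size \<M>)"
    using F_nonneg by (simp add: \<M>_def size_sum)
  finally have sizeM: "int (size \<M>) = - ?l F Infty" by simp
  obtain h where h: "h \<in> FF" "\<And>Q. Q \<in> curve f - {Infty} \<Longrightarrow> ord_at f Q h \<ge> int (count \<M> Q)"
    "ord_at f Infty h \<ge> - int (size \<M> + g)"
    using riemann_inequality[OF setM] by metis
  define G where "G = dvs h - F"
  have G_Div0: "G \<in> carrier Div0"
    unfolding G_def using keys_dvs[OF h(1)] div_degree_dvs[OF h(1)] F_Div0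
    by (intro Div0_diff) (simp_all only: Div0_carrier simp_thms)
  have "G - D = dvs (h / fn_of_poly C)"
    by (simp add: G_def F_def dvs_divide[OF h(1) C_FF])
  then have "G - D \<in> Prin"
    unfolding principal_divisors_eq using FF_divide[OF h(1) C_FF] by blast
  then have clG: "cl f D = cl f G" by (metis cl_eq_iff)
  define E where "E = G - frag_cmul (?l G Infty) (frag_of Infty)"
  have lE: "?l E Q = (if Q = Infty then 0 else ?l G Q)" for Q
    by (simp add: E_def lookup_minus)
  have "?l G Q \<ge> 0" if "Q \<noteq> Infty" for Q
  proof (cases "Q \<in> curve f")
    case True
    then show ?thesis
      using h(2)[of Q] countM[OF that] that by (simp add: G_def lookup_minus lookup_dvs[OF h(1)])
  next
    case False
    then have "?l G Q = 0" using G_Div0 by (auto simp: Div0_carrier in_keys_iff)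
    then show ?thesis by simp
  qed
  then have eff: "effective E"
    using G_Div0 by (auto simp: effective_def lE in_keys_iff Div0_carrier split: if_splits)
  have degE: "div_degree E = - ?l G Infty"
    using G_Div0 by (simp add: E_def div_degree_diff div_degree_cmul div_degree_frag_of Div0_carrier)
  have "?l G Infty \<ge> - int g"
    using h(3) sizeM Infty_in_curve by (simp add: G_def lookup_minus lookup_dvs[OF h(1)])
  then have "div_degree E \<le> int g" using degE by simp
  moreover have "minus_infty E = G"
    unfolding minus_infty_def degE by (simp add: E_def poly_mapping_eq_iff fun_eq_iff lookup_minus)
  ultimately show thesis
    using that eff clG by metis
qed

end

section \<open>The polynomial with roots \<open>- \<rr>\<^sub>i\<close>\<close>

lemma infinite_alg_closed: "infinite (UNIV :: 'a::alg_closed_field set)"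
proof
  assume fin: "finite (UNIV :: 'a set)"
  define p :: "'a poly" where "p = (\<Prod>c\<in>UNIV. [:- c, 1:])"
  have "Polynomial.degree p = card (UNIV :: 'a set)"
    unfolding p_def by (subst degree_prod_eq_sum_degree) auto
  then have "Polynomial.degree p > 0"
    using fin by (simp add: card_gt_0_iff)
  then have "Polynomial.degree (p + 1) > 0"
    by (subst degree_add_eq_left) simp_all
  then obtain x where "poly (p + 1) x = 0"
    using alg_closed_imp_poly_has_root by blast
  moreover have "poly p x = 0"
    unfolding p_def poly_prod using fin by (subst prod_zero_iff) auto
  ultimately show False by simp
qed

lemma poly_ext_alg_closed:
  fixes p q :: "'a::alg_closed_field poly"
  assumes "\<And>x. poly p x = poly q x"
  shows "p = q"
proof (rule ccontr)
  assume "p \<noteq> q"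
  then have "finite {x. poly (p - q) x = 0}"
    by (intro poly_roots_finite) simp
  then show False
    using assms infinite_alg_closed[where ?'a = 'a] by simp
qed

lemma sqrt_ex: "\<exists>t. t\<^sup>2 = (x :: 'a::alg_closed_field)"
  by (rule nth_root_exists) simp

text \<open>
  The even-indexed and the odd-indexed symmetric functions, as coefficients of two polynomials of
  degree at most \<open>g\<close>. They are the odd and the even part of \<open>\<Prod> (T + r\<^sub>i)\<close>, because \<open>2g + 1\<close> is odd.
\<close>

definition esym_even :: "nat \<Rightarrow> (nat \<Rightarrow> 'a::field) \<Rightarrow> 'a \<Rightarrow> 'a" where
  "esym_even g r x = (\<Sum>j\<le>g. esym g r (2 * j) * x ^ (g - j))"

definition esym_odd :: "nat \<Rightarrow> (nat \<Rightarrow> 'a::field) \<Rightarrow> 'a \<Rightarrow> 'a" where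
  "esym_odd g r x = (\<Sum>j\<le>g. esym g r (2 * j + 1) * x ^ (g - j))"

lemma sum_even_odd:
  fixes F :: "nat \<Rightarrow> 'a::comm_monoid_add"
  shows "(\<Sum>k\<le>2 * g + 1. F k) = (\<Sum>j\<le>g. F (2 * j)) + (\<Sum>j\<le>g. F (2 * j + 1))"
  by (induction g) (simp_all add: ac_simps)

lemma prod_shift_esym:
  fixes r :: "nat \<Rightarrow> 'a::field"
  shows "(\<Prod>i=1..2*g+1. r i + t) = (\<Sum>k\<le>2*g+1. esym g r k * t ^ (2*g+1 - k))"
proof -
  define I where "I = {1..2*g+1}"
  have I: "finite I" "card I = 2 * g + 1" by (simp_all add: I_def)
  have "(\<Prod>i\<in>I. r i + t) = (\<Sum>S\<in>Pow I. (\<Prod>i\<in>S. r i) * t ^ card (I - S))"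
    using I(1) by (simp add: prod_add)
  also have "\<dots> = (\<Sum>S\<in>Pow I. (\<Prod>i\<in>S. r i) * t ^ (2*g+1 - card S))"
    using I by (intro sum.cong) (auto simp: card_Diff_subset finite_subset)
  also have "\<dots> = (\<Sum>k\<in>{..2*g+1}. \<Sum>S\<in>{S \<in> Pow I. card S = k}. (\<Prod>i\<in>S. r i) * t ^ (2*g+1 - card S))"
    using I card_mono[OF I(1)] by (intro sum.group[symmetric]) auto
  also have "\<dots> = (\<Sum>k\<le>2*g+1. esym g r k * t ^ (2*g+1 - k))"
    by (intro sum.cong) (simp_all add: esym_def I_def sum_distrib_right)
  finally show ?thesis by (simp only: I_def)
qed

lemma prod_shift_even_odd:
  fixes r :: "nat \<Rightarrow> 'a::field"
  shows "(\<Prod>i=1..2*g+1. r i + t) = t * esym_even g r (t\<^sup>2) + esym_odd g r (t\<^sup>2)"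
proof -
  have e: "t ^ (2*g+1 - 2*j) = t * (t\<^sup>2) ^ (g - j)" "t ^ (2*g+1 - (2*j+1)) = (t\<^sup>2) ^ (g - j)"
    if "j \<le> g" for j
  proof -
    obtain i where "g = j + i" using \<open>j \<le> g\<close> le_Suc_ex by blast
    then show "t ^ (2*g+1 - 2*j) = t * (t\<^sup>2) ^ (g - j)" "t ^ (2*g+1 - (2*j+1)) = (t\<^sup>2) ^ (g - j)"
      by (simp_all add: power_mult)
  qed
  show ?thesis
    unfolding prod_shift_esym sum_even_odd esym_even_def esym_odd_def sum_distrib_left
    by (intro arg_cong2[of _ _ _ _ "(+)"] sum.cong refl) (simp_all only: atMost_iff e mult.left_commute)
qed

lemma esym_0: "esym g r 0 = 1"
proof -
  have "{S. S \<subseteq> {1..2*g+1} \<and> card S = 0} = {{}}"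
    using finite_subset by fastforce
  then show ?thesis by (simp add: esym_def)
qed

lemma esym_top: "esym g r (2*g+1) = (\<Prod>i=1..2*g+1. r i)"
proof -
  have "{S. S \<subseteq> {1..2*g+1} \<and> card S = 2*g+1} = {{1..2*g+1}}"
    using card_subset_eq[of "{1..2*g+1}"] by auto
  then show ?thesis by (simp add: esym_def)
qed

section \<open>The polynomials \<open>U\<close> and \<open>V\<close>\<close>

lemma sum_atMost_split_first:
  fixes F :: "nat \<Rightarrow> 'a::comm_monoid_add"
  shows "(\<Sum>j\<le>g. F j) = F 0 + (\<Sum>j=1..g. F j)"
  by (simp add: atMost_atLeast0 sum.atLeast_Suc_atMost)

lemma poly_half_U_aux:
  "poly ([:a, -1:] ^ g + (\<Sum>j=1..g. Polynomial.smult (esym g r (2*j)) ([:a, -1:] ^ (g - j)))) x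
    = esym_even g r (a - x)"
  by (simp add: esym_even_def sum_atMost_split_first esym_0 poly_sum)

lemma poly_half_U: "poly (half_U g a r) x = (- 1) ^ g * esym_even g r (a - x)"
  unfolding half_U_def poly_mult poly_half_U_aux by simp

lemma poly_half_V:
  assumes "(\<Prod>i=1..2*g+1. r i) = - b"
  shows "poly (half_V g a b r) x = esym_odd g r (a - x) - esym g r 1 * esym_even g r (a - x)"
proof -
  have "esym_odd g r (a - x) = (\<Sum>j<g. esym g r (2 * j + 1) * (a - x) ^ (g - j)) + esym g r (2 * g + 1)"
    by (simp add: esym_odd_def lessThan_Suc_atMost[symmetric])
  also have "(\<Sum>j<g. esym g r (2 * j + 1) * (a - x) ^ (g - j))
      = (\<Sum>j=1..g. esym g r (2 * j - 1) * (a - x) ^ (g - j + 1))"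
    by (rule sum.reindex_bij_witness[of _ "\<lambda>j. j - 1" Suc]) (auto simp: Suc_diff_Suc)
  finally have "esym_odd g r (a - x) = (\<Sum>j=1..g. esym g r (2 * j - 1) * (a - x) ^ (g - j + 1)) - b"
    using esym_top[of g r] assms by simp
  moreover have "poly [:a, -1:] x = a - x" "poly [:b:] x = b" by simp_all
  ultimately show ?thesis
    unfolding half_V_def poly_diff poly_smult poly_half_U_aux poly_sum poly_power by (simp only:)
qed

lemma degree_power_a_minus_x: "Polynomial.degree ([:a :: 'a::field, -1:] ^ k) = k"
  by (subst degree_power_eq) simp_all

lemma degree_sum_powers_less:
  fixes c :: "nat \<Rightarrow> 'a::field"
  assumes "\<And>j. j \<in> J \<Longrightarrow> e j < n" "n > 0"
  shows "Polynomial.degree (\<Sum>j\<in>J. Polynomial.smult (c j) ([:a, -1:] ^ e j)) < n"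
proof (intro degree_sum_less)
  fix j assume "j \<in> J"
  then show "Polynomial.degree (Polynomial.smult (c j) ([:a, -1:] ^ e j)) < n"
    using assms(1) degree_smult_le[of "c j" "[:a, -1:] ^ e j"]
    unfolding degree_power_a_minus_x by (meson le_less_trans)
qed (rule assms)

lemma half_U_monic:
  fixes r :: "nat \<Rightarrow> 'a::field"
  assumes "g \<ge> 1"
  shows "Polynomial.degree (half_U g a r) = g" and "lead_coeff (half_U g a r) = 1"
proof -
  define p where "p = [:a, -1:] ^ g"
  define q where "q = (\<Sum>j=1..g. Polynomial.smult (esym g r (2*j)) ([:a, -1:] ^ (g - j)))"
  have p: "Polynomial.degree p = g" "lead_coeff p = (- 1) ^ g"
    unfolding p_def degree_power_a_minus_x lead_coeff_power by simp_all
  have "Polynomial.degree q < g"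
    unfolding q_def using assms by (intro degree_sum_powers_less) auto
  then have pq: "Polynomial.degree (p + q) = g" "lead_coeff (p + q) = (- 1) ^ g"
    unfolding add.commute[of p q] using p degree_add_eq_right[of q p] lead_coeff_add_le[of q p]
    by (simp_all only:)
  have U: "half_U g a r = (- 1) ^ g * (p + q)"
    unfolding half_U_def p_def q_def ..
  have one: "(- 1 :: 'a poly) ^ g = [:(- 1) ^ g:]"
    by (induction g) (simp_all add: one_pCons)
  show "Polynomial.degree (half_U g a r) = g" "lead_coeff (half_U g a r) = 1"
    unfolding U one using pq by (simp_all flip: power_mult_distrib)
qed

text \<open>The two terms \<open>s\<^sub>1 (a - x)\<^sup>g\<close> of \<open>V\<close> cancel.\<close>

lemma degree_half_V:
  fixes r :: "nat \<Rightarrow> 'a::field"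
  assumes "g \<ge> 1"
  shows "Polynomial.degree (half_V g a b r) < g"
proof -
  define q where "q = (\<Sum>j=1..g. Polynomial.smult (esym g r (2*j)) ([:a, -1:] ^ (g - j)))"
  define p where "p = (\<Sum>j=Suc 1..g. Polynomial.smult (esym g r (2*j - 1)) ([:a, -1:] ^ (g - j + 1)))"
  have "(\<Sum>j=1..g. Polynomial.smult (esym g r (2*j - 1)) ([:a, -1:] ^ (g - j + 1)))
      = Polynomial.smult (esym g r 1) ([:a, -1:] ^ g) + p"
    unfolding sum.atLeast_Suc_atMost[OF assms] le_add_diff_inverse2[OF assms] p_def by simp
  then have "half_V g a b r = p - [:b:] - Polynomial.smult (esym g r 1) q"
    unfolding half_V_def q_def[symmetric] smult_add_right by simp
  moreover have "Polynomial.degree p < g"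
    unfolding p_def using assms by (intro degree_sum_powers_less) auto
  moreover have "Polynomial.degree q < g"
    unfolding q_def using assms by (intro degree_sum_powers_less) auto
  then have "Polynomial.degree (Polynomial.smult (esym g r 1) q) < g"
    using degree_smult_le le_less_trans by blast
  ultimately show ?thesis
    using assms by (simp add: degree_diff_less)
qed

text \<open>
  This is the polynomial \<open>A\<close> for which \<open>y - A\<close> has the zeros \<open>2D + \<iota>P\<close>; \<open>V\<close> is its remainder modulo
  \<open>U\<close>.
\<close>

definition half_A :: "nat \<Rightarrow> 'a::field \<Rightarrow> 'a \<Rightarrow> (nat \<Rightarrow> 'a) \<Rightarrow> 'a poly" where
  "half_A g a b r = half_V g a b r + Polynomial.smult (esym g r 1 * (- 1) ^ g) (half_U g a r)"

lemma poly_half_A: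
  assumes "(\<Prod>i=1..2*g+1. r i) = - b"
  shows "poly (half_A g a b r) x = esym_odd g r (a - x)"
proof -
  have "(- 1 :: 'a) ^ g * (- 1) ^ g = 1" by (simp flip: power_mult_distrib)
  then show ?thesis
    unfolding half_A_def poly_add poly_smult poly_half_U poly_half_V[OF assms] by (simp add: mult.assoc)
qed

lemma degree_half_A: "g \<ge> 1 \<Longrightarrow> Polynomial.degree (half_A g a b r) \<le> g"
  unfolding half_A_def using degree_half_V[of g a b r] half_U_monic(1)[of g a r]
    degree_smult_le[of "esym g r 1 * (- 1) ^ g" "half_U g a r"]
  by (intro degree_add_le) simp_all

context hyperelliptic
begin

text \<open>
  The identity says that the norm of \<open>y - A\<close> is, up to sign, \<open>x - a\<close> times the square of \<open>U\<close>. Such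
  pairs stand between the tuples of square roots and the halves of \<open>(a, b)\<close>.
\<close>

definition square_root_pair :: "'a \<Rightarrow> 'a \<Rightarrow> 'a poly \<Rightarrow> 'a poly \<Rightarrow> bool" where
  "square_root_pair a b U A \<longleftrightarrow> Polynomial.degree U = g \<and> lead_coeff U = 1 \<and>
     Polynomial.degree A \<le> g \<and> poly A a = - b \<and> f = A\<^sup>2 + [:- a, 1:] * U\<^sup>2"

text \<open>
  With \<open>t\<^sup>2 = a - x\<close>, the difference of squares \<open>A\<^sup>2 - (t U)\<^sup>2\<close> factors as
  \<open>\<Prod> (r\<^sub>i + t) \<Prod> (r\<^sub>i - t) = \<Prod> (r\<^sub>i\<^sup>2 - t\<^sup>2) = \<Prod> (x - \<alpha>\<^sub>i)\<close>.
\<close>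

lemma half_square_root_pair:
  assumes r: "r \<in> root_tuples g \<alpha> a b"
  shows "square_root_pair a b (half_U g a r) (half_A g a b r)"
proof -
  have sq: "(r i)\<^sup>2 = a - \<alpha> i" if "i \<in> {1..2*g+1}" for i
    using r that unfolding root_tuples_def by blast
  have pr: "(\<Prod>i=1..2*g+1. r i) = - b"
    using r unfolding root_tuples_def by blast
  have "poly f x = poly ((half_A g a b r)\<^sup>2 + [:- a, 1:] * (half_U g a r)\<^sup>2) x" for x
  proof -
    obtain t where t: "t\<^sup>2 = a - x" using sqrt_ex by blast
    let ?e = "esym_even g r (a - x)" and ?o = "esym_odd g r (a - x)"
    have "(t * ?e + ?o) * (- t * ?e + ?o) = (\<Prod>i=1..2*g+1. r i + t) * (\<Prod>i=1..2*g+1. r i + - t)"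
      using prod_shift_even_odd[where g = g and r = r and t = t]
        prod_shift_even_odd[where g = g and r = r and t = "- t"] by (simp only: t power2_minus)
    also have "\<dots> = (\<Prod>i=1..2*g+1. (r i + t) * (r i + - t))"
      by (rule prod.distrib[symmetric])
    also have "\<dots> = (\<Prod>i=1..2*g+1. x - \<alpha> i)"
    proof (rule prod.cong[OF refl])
      fix i assume "i \<in> {1..2*g+1}"
      then have "(r i + t) * (r i + - t) = (a - \<alpha> i) - (a - x)"
        using sq t by (simp add: power2_eq_square algebra_simps)
      then show "(r i + t) * (r i + - t) = x - \<alpha> i" by simp
    qed
    finally have "poly f x = ?o\<^sup>2 - t\<^sup>2 * ?e\<^sup>2"
      unfolding poly_f by (simp add: power2_eq_square algebra_simps)
    moreover have "((- 1) ^ g * ?e)\<^sup>2 = ?e\<^sup>2"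
      by (simp add: power_mult_distrib flip: power_mult)
    moreover have "poly [:- a, 1:] x = x - a" by simp
    ultimately show ?thesis
      unfolding poly_add poly_mult poly_power poly_half_A[OF pr] poly_half_U t
      by (simp only: minus_diff_eq[of a x, symmetric] mult_minus_left diff_conv_add_uminus[of "?o\<^sup>2"])
  qed
  then have "f = (half_A g a b r)\<^sup>2 + [:- a, 1:] * (half_U g a r)\<^sup>2"
    by (rule poly_ext_alg_closed)
  moreover have "poly (half_A g a b r) a = - b"
    using prod_shift_even_odd[where g = g and r = r and t = 0] pr unfolding poly_half_A[OF pr] by simp
  ultimately show ?thesis
    unfolding square_root_pair_def
    using half_U_monic[OF genus_pos] degree_half_A[OF genus_pos] by blast
qed

text \<open>A common root of \<open>U\<close> and \<open>f\<close> would be a root of \<open>A\<close> too, hence a double root of \<open>f\<close>.\<close>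

lemma square_root_pair_coprime:
  assumes p: "square_root_pair a b U A" and c: "poly f c = 0"
  shows "poly U c \<noteq> 0"
proof
  assume U: "poly U c = 0"
  have f: "f = A\<^sup>2 + [:- a, 1:] * U\<^sup>2" using p unfolding square_root_pair_def by blast
  have "poly f c = (poly A c)\<^sup>2 + poly [:- a, 1:] c * (poly U c)\<^sup>2"
    by (subst f) (simp only: poly_add poly_mult poly_power)
  then have "(poly A c)\<^sup>2 = 0" using c U by simp
  then have "[:- c, 1:] dvd A" "[:- c, 1:] dvd U"
    using U poly_eq_0_iff_dvd[of A c] poly_eq_0_iff_dvd[of U c] by simp_all
  then have "[:- c, 1:]\<^sup>2 dvd A\<^sup>2" "[:- c, 1:]\<^sup>2 dvd U\<^sup>2"
    by (simp_all only: dvd_power_same)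
  then have "[:- c, 1:]\<^sup>2 dvd f"
    unfolding f by (intro dvd_add dvd_mult)
  then show False using f_not_square_dvd by blast
qed

text \<open>Evaluate \<open>\<Prod> (r\<^sub>j + T)\<close> at its root \<open>T = - r\<^sub>i\<close>, where \<open>T\<^sup>2 = a - \<alpha>\<^sub>i\<close>.\<close>

lemma root_eq_half_quotient:
  assumes r: "r \<in> root_tuples g \<alpha> a b" and i: "i \<in> {1..2*g+1}"
  shows "r i = (- 1) ^ g * (poly (half_A g a b r) (\<alpha> i) / poly (half_U g a r) (\<alpha> i))"
proof -
  have sq: "(r i)\<^sup>2 = a - \<alpha> i" and pr: "(\<Prod>i=1..2*g+1. r i) = - b"
    using r i unfolding root_tuples_def by blast+
  have "(\<Prod>j=1..2*g+1. r j + - r i) = 0"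
    using i by (intro prod_zero) auto
  then have "esym_odd g r (a - \<alpha> i) = r i * esym_even g r (a - \<alpha> i)"
    unfolding prod_shift_even_odd by (simp add: sq)
  moreover have "poly f (\<alpha> i) = 0" using i poly_f_eq_0_iff by blast
  then have "poly (half_U g a r) (\<alpha> i) \<noteq> 0"
    by (rule square_root_pair_coprime[OF half_square_root_pair[OF r]])
  ultimately show ?thesis
    unfolding poly_half_A[OF pr] poly_half_U by simp
qed

text \<open>
  Conversely, \<open>T \<mapsto> (-1)\<^sup>g T U(a - T\<^sup>2) + A(a - T\<^sup>2)\<close> is a monic polynomial of degree \<open>2g + 1\<close> that
  vanishes at each \<open>- A(\<alpha>\<^sub>i) / ((-1)\<^sup>g U(\<alpha>\<^sub>i))\<close>. These are square roots of the distinct \<open>a - \<alpha>\<^sub>i\<close>, so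
  they are all the roots, and the even and odd parts of the product determine \<open>U\<close> and \<open>A\<close>.
\<close>

lemma square_root_pair_ex_tuple:
  assumes p: "square_root_pair a b U A"
  obtains r where "r \<in> root_tuples g \<alpha> a b" "U = half_U g a r" "A = half_A g a b r"
proof -
  have U: "Polynomial.degree U = g" "lead_coeff U = 1" and A: "Polynomial.degree A \<le> g" "poly A a = - b"
    and f: "f = A\<^sup>2 + [:- a, 1:] * U\<^sup>2"
    using p unfolding square_root_pair_def by blast+
  define I where "I = {1..2*g+1}"
  have I: "finite I" "card I = 2 * g + 1" by (simp_all add: I_def)
  define s :: 'a where "s = (- 1) ^ g"
  have s: "s * s = 1" "s \<noteq> 0" by (simp_all add: s_def flip: power_mult_distrib)
  have s2: "s * (s * z) = z" for z using s(1) by (metis mult.assoc mult_1)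
  define r where "r = restrict (\<lambda>i. s * (poly A (\<alpha> i) / poly U (\<alpha> i))) I"
  have Unz: "poly U (\<alpha> i) \<noteq> 0" if "i \<in> I" for i
    using that square_root_pair_coprime[OF p] poly_f_eq_0_iff unfolding I_def by blast
  have rU: "r i * (s * poly U (\<alpha> i)) = poly A (\<alpha> i)" if "i \<in> I" for i
    using that Unz[OF that] s by (simp add: r_def field_simps)
  have sq: "(r i)\<^sup>2 = a - \<alpha> i" if "i \<in> I" for i
  proof -
    have "poly f (\<alpha> i) = 0" using that poly_f_eq_0_iff unfolding I_def by blast
    then have "(poly A (\<alpha> i))\<^sup>2 = (a - \<alpha> i) * (poly U (\<alpha> i))\<^sup>2"
      using arg_cong[OF f, of "\<lambda>q. poly q (\<alpha> i)"] by (simp add: algebra_simps)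
    moreover have "(poly A (\<alpha> i))\<^sup>2 = (r i)\<^sup>2 * (poly U (\<alpha> i))\<^sup>2"
      unfolding rU[OF that, symmetric] using s(1) by (simp add: power_mult_distrib power2_eq_square)
    ultimately show ?thesis using Unz[OF that] by simp
  qed
  have "inj_on (\<lambda>i. - r i) I"
  proof (rule inj_onI)
    fix i j assume "i \<in> I" "j \<in> I" "- r i = - r j"
    then have "\<alpha> i = \<alpha> j" using sq[of i] sq[of j] by simp
    then show "i = j" using inj \<open>i \<in> I\<close> \<open>j \<in> I\<close> by (auto simp: I_def inj_on_def)
  qed
  \<comment> \<open>Substitute \<open>a - T\<^sup>2\<close> for \<open>x\<close>. The odd part \<open>W\<close> carries the leading term.\<close>
  define q where "q = [:a, 0, -1:]"
  have degq: "Polynomial.degree q = 2" "lead_coeff q = - 1" by (simp_all add: q_def)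
  define W where "W = [:0, 1:] * Polynomial.smult s (pcompose U q)"
  have "Polynomial.degree q > 0" by (simp add: degq)
  from lead_coeff_comp[OF this, of U] have UW2: "lead_coeff (pcompose U q) = s"
    unfolding U(2) degq(2) unfolding U(1) s_def mult_1 .
  have UW: "Polynomial.degree (pcompose U q) = 2 * g"
    by (simp add: degree_pcompose degq U)
  have U_nz: "pcompose U q \<noteq> 0"
    using UW2 s(2) by auto
  have Wdeg: "Polynomial.degree W = 2 * g + 1" "lead_coeff W = 1"
  proof -
    have "Polynomial.degree ([:0, 1:] :: 'a poly) = 1" by simp
    then show "Polynomial.degree W = 2 * g + 1"
      unfolding W_def using U_nz s(2) UW by (subst degree_mult_eq) auto
    show "lead_coeff W = 1"
      unfolding W_def lead_coeff_mult lead_coeff_smult UW2 s(1) by simp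
  qed
  have Adeg: "Polynomial.degree (pcompose A q) < 2 * g + 1"
    using A by (simp add: degree_pcompose degq)
  define Z where "Z = (\<Prod>i\<in>I. [:r i, 1:])"
  have Zdeg: "Polynomial.degree Z = 2 * g + 1" "lead_coeff Z = 1"
  proof -
    show "Polynomial.degree Z = 2 * g + 1"
      unfolding Z_def using I by (subst degree_prod_eq_sum_degree) auto
    show "lead_coeff Z = 1"
      unfolding Z_def lead_coeff_prod by (rule prod.neutral) simp
  qed
  have poly_q: "poly q T = a - T\<^sup>2" for T
    by (simp add: q_def power2_eq_square)
  have Weval: "poly (W + pcompose A q) T = T * (s * poly U (a - T\<^sup>2)) + poly A (a - T\<^sup>2)" for T
    by (simp add: W_def poly_pcompose poly_q)
  have Zeval: "poly Z T = (\<Prod>i=1..2*g+1. r i + T)" for T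
    unfolding Z_def poly_prod I_def by (rule prod.cong) simp_all
  have WA: "W + pcompose A q = Z"
  proof (rule poly_eqI_degree_lead_coeff[where A = "(\<lambda>i. - r i) ` I" and n = "2 * g + 1"])
    show "Polynomial.coeff (W + pcompose A q) (2 * g + 1) = Polynomial.coeff Z (2 * g + 1)"
      using Wdeg Zdeg coeff_eq_0[OF Adeg] by simp
    show "2 * g + 1 \<le> card ((\<lambda>i. - r i) ` I)"
      using card_image[OF \<open>inj_on (\<lambda>i. - r i) I\<close>] I by simp
    show "Polynomial.degree (W + pcompose A q) \<le> 2 * g + 1" "Polynomial.degree Z \<le> 2 * g + 1"
      using Wdeg Zdeg Adeg by (auto intro: degree_add_le)
    fix z assume "z \<in> (\<lambda>i. - r i) ` I"
    then obtain i where i: "i \<in> I" "z = - r i" by blast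
    have "poly (W + pcompose A q) z = 0"
      unfolding Weval i(2) using rU[OF i(1)] sq[OF i(1)] by simp
    moreover have "poly Z z = 0"
      unfolding Z_def poly_prod using I(1) i by (intro prod_zero) auto
    ultimately show "poly (W + pcompose A q) z = poly Z z" by simp
  qed
  have eval: "T * (s * poly U (a - T\<^sup>2)) + poly A (a - T\<^sup>2) = T * esym_even g r (T\<^sup>2) + esym_odd g r (T\<^sup>2)" for T
    using Weval[of T] Zeval[of T] unfolding WA prod_shift_even_odd by simp
  have pr: "(\<Prod>i=1..2*g+1. r i) = - b"
    using Weval[of 0] Zeval[of 0] A(2) unfolding WA by simp
  have rr: "r \<in> root_tuples g \<alpha> a b"
    unfolding root_tuples_def using sq pr by (auto simp: r_def I_def)
  have parts: "poly A (a - T\<^sup>2) = esym_odd g r (T\<^sup>2)" "T * (s * poly U (a - T\<^sup>2)) = T * esym_even g r (T\<^sup>2)" for T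
  proof -
    let ?x = "T * (s * poly U (a - T\<^sup>2)) - T * esym_even g r (T\<^sup>2)" and ?y = "poly A (a - T\<^sup>2) - esym_odd g r (T\<^sup>2)"
    have "?x + ?y = 0" "- ?x + ?y = 0"
      using eval[of T] eval[of "- T"] by (simp_all add: algebra_simps)
    moreover have "?y + ?y = (?x + ?y) + (- ?x + ?y)" "?x + ?x = (?x + ?y) - (- ?x + ?y)"
      by simp_all
    ultimately have "?y + ?y = 0" "?x + ?x = 0"
      by (simp_all only: add_0 diff_0_right)
    then show "poly A (a - T\<^sup>2) = esym_odd g r (T\<^sup>2)" "T * (s * poly U (a - T\<^sup>2)) = T * esym_even g r (T\<^sup>2)"
      unfolding double_eq_0_iff right_minus_eq by blast+
  qed
  have "poly A x = poly (half_A g a b r) x" for x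
  proof -
    obtain T where "T\<^sup>2 = a - x" using sqrt_ex by blast
    then show ?thesis using parts(1)[of T] by (simp add: poly_half_A[OF pr])
  qed
  then have A_eq: "A = half_A g a b r" by (rule poly_ext_alg_closed)
  have "poly ([:a, -1:] * U) x = poly ([:a, -1:] * half_U g a r) x" for x
  proof -
    obtain T where T: "T\<^sup>2 = a - x" using sqrt_ex by blast
    have "T * (s * poly U x) = T * esym_even g r (a - x)"
      using parts(2)[of T] T by simp
    then have "s * (T * (T * (s * poly U x))) = s * (T * (T * esym_even g r (a - x)))" by simp
    then have "T\<^sup>2 * (s * (s * poly U x)) = T\<^sup>2 * (s * esym_even g r (a - x))"
      by (simp add: power2_eq_square ac_simps)
    then have "(a - x) * poly U x = (a - x) * poly (half_U g a r) x"
      unfolding T s2 poly_half_U s_def[symmetric] .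
    moreover have "poly [:a, -1:] x = a - x" by simp
    ultimately show ?thesis
      unfolding poly_mult by (simp only:)
  qed
  then have "[:a, -1:] * U = [:a, -1:] * half_U g a r"
    by (rule poly_ext_alg_closed)
  then have "U = half_U g a r" by (simp del: mult_pCons_left)
  then show thesis
    using that rr A_eq by blast
qed

end

section \<open>Halves of a point\<close>

lemma lookup_sum_mset_graph:
  "Poly_Mapping.lookup (\<Sum>c\<in>#M. frag_of (Aff c (v c))) Q =
    (case Q of Aff c d \<Rightarrow> if d = v c then int (count M c) else 0 | Infty \<Rightarrow> 0)"
  by (induction M) (auto simp: lookup_add split: point.split)

lemma div_degree_sum_mset_graph: "div_degree (\<Sum>c\<in>#M. frag_of (Aff c (v c))) = int (size M)"
  by (induction M) (simp_all add: div_degree_add div_degree_zero div_degree_frag_of)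

context hyperelliptic
begin

lemma fn_y_minus_poly: "fn_y f - fn_of_poly A = curve_fn f (- A) 1"
  by (simp add: curve_fn_def fn.hom_uminus fn.hom_one)

text \<open>
  Where \<open>y - A\<close> vanishes and \<open>y\<close> does not, \<open>y + A\<close> is a unit, and the order is read off from the norm.
  If \<open>y\<close> vanishes as well, then \<open>U\<close> does not, so the norm forces the point to be \<open>(a, 0)\<close>, and the
  zero is simple.
\<close>

lemma ord_y_minus_square_root:
  assumes p: "square_root_pair a b U A" and Q: "Aff c d \<in> curve f"
  shows "ord_at f (Aff c d) (curve_fn f (- A) 1) =
    2 * (if d = poly A c then int (Polynomial.order c U) else 0) + (if c = a \<and> d = - b then 1 else 0)"
proof -
  have f: "f = A\<^sup>2 + [:- a, 1:] * U\<^sup>2" and Aa: "poly A a = - b" and U: "U \<noteq> 0"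
    using p unfolding square_root_pair_def by auto
  have nz: "- A \<noteq> 0 \<or> (1 :: 'a poly) \<noteq> 0" by simp
  show ?thesis
  proof (cases "d = poly A c")
    case False
    then have "ord_at f (Aff c d) (curve_fn f (- A) 1) = 0"
      using ord_Aff_curve_fn_pos_iff[OF Q nz] ord_Aff_curve_fn_nonneg[OF Q nz] by simp
    then show ?thesis using False Aa by auto
  next
    case d: True
    show ?thesis
    proof (cases "d = 0")
      case True
      then have fc: "poly f c = 0" and Ac: "poly (- A) c = 0"
        using Q d by (simp_all add: Aff_in_curve)
      have Uc: "poly U c \<noteq> 0" by (rule square_root_pair_coprime[OF p fc])
      have "poly f c = (poly A c)\<^sup>2 + (c - a) * (poly U c)\<^sup>2"
        by (subst f) (simp add: algebra_simps)
      then have "c = a" using fc Ac Uc by simp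
      moreover from this have "b = 0" using Aa Ac by simp
      moreover have "ord_at f (Aff c 0) (curve_fn f (- A) 1) = 1"
        by (rule ord_branch_simple_zero[OF fc Ac]) simp
      ultimately show ?thesis
        using True Uc order_0I[of U c] by simp
    next
      case False
      have "curve_norm f (- A) 1 = - ([:- a, 1:] * U\<^sup>2)"
        unfolding curve_norm_def by (subst f) simp
      then have "Polynomial.order c (curve_norm f (- A) 1) = Polynomial.order c [:- a, 1:] + 2 * Polynomial.order c U"
        using U by (simp add: order_mult power2_eq_square del: mult_pCons_left)
      then have "Polynomial.order c (curve_norm f (- A) 1) = (if c = a then 1 else 0) + 2 * Polynomial.order c U"
        unfolding order_linear .
      moreover have "poly (- A) c - poly 1 c * d \<noteq> 0"
        using d False double_eq_0_iff[of d] by (simp add: minus_equation_iff[of d])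
      ultimately show ?thesis
        using ord_Aff_curve_fn_norm[OF Q, of "- A" 1] d False Aa by (auto simp: ram_index_def)
    qed
  qed
qed

lemma degree_curve_norm_y_minus:
  "Polynomial.degree A \<le> g \<Longrightarrow> Polynomial.degree (curve_norm f (- A) 1) = 2 * g + 1"
  by (simp add: degree_curve_norm max_def)

lemma effective_frag_of: "Aff a b \<in> curve f \<Longrightarrow> effective (frag_of (Aff a b))"
  by (auto simp: effective_def)

text \<open>\<open>D\<close> halves the point \<open>(a, b)\<close> as soon as \<open>2D\<close> and the opposite point fill up the divisor of \<open>y - A\<close>.\<close>

lemma double_eq_point:
  assumes p: "square_root_pair a b U A" and P: "Aff a b \<in> curve f"
    and E: "effective E" "div_degree E = int g"
    and ord: "\<And>c d. Aff c d \<in> curve f \<Longrightarrow>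
      Poly_Mapping.lookup E (Aff c d) = (if d = poly A c then int (Polynomial.order c U) else 0)"
  shows "minus_infty E + minus_infty E - (frag_of (Aff a b) - frag_of Infty) \<in> Prin"
proof -
  let ?l = Poly_Mapping.lookup and ?P = "frag_of (Aff a b)"
  have FF: "curve_fn f (- A) 1 \<in> FF" "fn_of_poly (x_poly ?P) \<in> FF"
    by (intro curve_fn_FF poly_FF x_poly_nz, simp) (intro poly_FF x_poly_nz)
  define h where "h = curve_fn f (- A) 1 / fn_of_poly (x_poly ?P)"
  have h: "h \<in> FF" unfolding h_def by (rule FF_divide[OF FF])
  have ordh: "ord_at f Q h = ord_at f Q (curve_fn f (- A) 1) - ord_at f Q (fn_of_poly (x_poly ?P))"
    if "Q \<in> curve f" for Q
    unfolding h_def by (rule ord_divide[OF that FF])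
  have "minus_infty E + minus_infty E - (?P - frag_of Infty) = dvs h"
  proof (rule poly_mapping_eqI)
    fix Q
    show "?l (minus_infty E + minus_infty E - (?P - frag_of Infty)) Q = ?l (dvs h) Q"
    proof (cases Q)
      case Infty
      have "Polynomial.degree A \<le> g" using p by (simp add: square_root_pair_def)
      then show ?thesis
        using ordh[OF Infty_in_curve] ord_Infty_x_poly[OF effective_frag_of[OF P]] E
          ord_Infty_curve_fn[of "- A" 1] Infty_in_curve
        by (simp add: Infty lookup_dvs[OF h] lookup_add lookup_minus lookup_minus_infty
            div_degree_frag_of degree_curve_norm_y_minus)
    next
      case (Aff c d)
      show ?thesis
      proof (cases "Aff c d \<in> curve f")
        case True
        have eq: "(- d = b) = (d = - b)" by auto
        show ?thesis
          using ordh[OF True] ord_x_poly[OF effective_frag_of[OF P] True] ord[OF True] E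
            ord_y_minus_square_root[OF p True] True
          by (simp add: Aff lookup_dvs[OF h] lookup_add lookup_minus lookup_minus_infty eq)
      next
        case False
        then have "?l E (Aff c d) = 0" "\<not> (c = a \<and> d = b)"
          using E(1) P by (auto simp: effective_def in_keys_iff)
        then show ?thesis
          using False E by (auto simp: Aff lookup_dvs[OF h] lookup_add lookup_minus lookup_minus_infty)
      qed
    qed
  qed
  then show ?thesis
    unfolding principal_divisors_eq using h by blast
qed

context
  fixes a b :: 'a and r :: "nat \<Rightarrow> 'a"
  assumes r: "r \<in> root_tuples g \<alpha> a b"
begin

lemma half_V_eq_half_A: "poly (half_U g a r) c = 0 \<Longrightarrow> poly (half_V g a b r) c = poly (half_A g a b r) c"
  by (simp add: half_A_def)

lemma half_norm_eq: "f = (half_A g a b r)\<^sup>2 + [:- a, 1:] * (half_U g a r)\<^sup>2"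
  using half_square_root_pair[OF r] unfolding square_root_pair_def by blast

lemma half_U_nz: "half_U g a r \<noteq> 0"
  using half_U_monic(2)[OF genus_pos, of a r] by auto

lemma half_V_sq:
  assumes "poly (half_U g a r) c = 0"
  shows "(poly (half_V g a b r) c)\<^sup>2 = poly f c" and "poly (half_V g a b r) c \<noteq> 0"
proof -
  show "(poly (half_V g a b r) c)\<^sup>2 = poly f c"
    unfolding half_V_eq_half_A[OF assms] by (subst half_norm_eq) (simp add: assms)
  moreover have "poly f c \<noteq> 0"
    using square_root_pair_coprime[OF half_square_root_pair[OF r]] assms by blast
  ultimately show "poly (half_V g a b r) c \<noteq> 0" by auto
qed

lemma lookup_half_divisor:
  "Poly_Mapping.lookup (half_divisor g a b r) Q = (case Q of
     Aff c d \<Rightarrow> if d = poly (half_V g a b r) c then int (Polynomial.order c (half_U g a r)) else 0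
   | Infty \<Rightarrow> 0)"
  unfolding half_divisor_def lookup_sum_mset_graph using half_U_nz by (cases Q) simp_all

lemma lookup_half_divisor_Aff:
  "Poly_Mapping.lookup (half_divisor g a b r) (Aff c d) =
    (if d = poly (half_A g a b r) c then int (Polynomial.order c (half_U g a r)) else 0)"
  using half_V_eq_half_A[of c] order_0I[of "half_U g a r" c]
  by (cases "poly (half_U g a r) c = 0") (simp_all add: lookup_half_divisor)

lemma keys_half_divisor:
  "Q \<in> Poly_Mapping.keys (half_divisor g a b r) \<longleftrightarrow>
    (\<exists>c. poly (half_U g a r) c = 0 \<and> Q = Aff c (poly (half_V g a b r) c))"
  using half_U_nz by (auto simp: in_keys_iff lookup_half_divisor order_root split: point.splits)

lemma effective_half_divisor: "effective (half_divisor g a b r)"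
  unfolding effective_def
  by (auto simp: keys_half_divisor lookup_half_divisor Aff_in_curve half_V_sq(1) split: point.splits)

lemma degree_half_divisor: "div_degree (half_divisor g a b r) = int g"
  unfolding half_divisor_def div_degree_sum_mset_graph
  by (simp add: alg_closed_proots(1)[OF half_U_nz] half_U_monic(1)[OF genus_pos])

lemma reduced_half_divisor: "reduced f (half_divisor g a b r)"
  unfolding reduced_def semi_reduced_def
proof (intro conjI allI ballI impI)
  show "Poly_Mapping.keys (half_divisor g a b r) \<subseteq> curve f - {Infty}"
    "\<And>Q. Poly_Mapping.lookup (half_divisor g a b r) Q \<ge> 0"
    using effective_half_divisor by (simp_all add: effective_def)
  show "div_degree (half_divisor g a b r) \<le> int (genus f)"
    by (simp add: degree_half_divisor genus_f)
  fix Q assume "Q \<in> Poly_Mapping.keys (half_divisor g a b r)"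
  then obtain c where c: "poly (half_U g a r) c = 0" "Q = Aff c (poly (half_V g a b r) c)"
    unfolding keys_half_divisor by blast
  show "Poly_Mapping.lookup (half_divisor g a b r) Q = 1" if "Q \<in> weierstrass_points f"
    using that c half_V_sq(2)[OF c(1)] by (auto simp: weierstrass_points_def)
  show "hyp_inv Q \<notin> Poly_Mapping.keys (half_divisor g a b r)"
    using c neq_uminus[OF half_V_sq(2)[OF c(1)]] by (auto simp: keys_half_divisor)
qed

lemma half_class_eq: "half_class f g a b r = cl f (minus_infty (half_divisor g a b r))"
  by (simp add: half_class_def minus_infty_def degree_half_divisor)

lemma reduced_rep_half_class_iff:
  "reduced_rep f (half_class f g a b r) D \<longleftrightarrow> D = half_divisor g a b r"
  unfolding reduced_rep_def half_class_eq
  using reduced_unique[OF reduced_half_divisor] reduced_half_divisor by metis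

lemma x_poly_half_divisor: "x_poly (half_divisor g a b r) = half_U g a r"
proof (rule monic_poly_eqI_order[OF monic_x_poly half_U_monic(2)[OF genus_pos]])
  fix c
  obtain d where d: "d\<^sup>2 = poly f c" "poly (half_U g a r) c = 0 \<Longrightarrow> d = poly (half_V g a b r) c"
    using fiber_ex half_V_sq(1) by metis
  have "int (ram_index d * Polynomial.order c (x_poly (half_divisor g a b r))) =
      int (ram_index d * Polynomial.order c (half_U g a r))"
  proof (cases "poly (half_U g a r) c = 0")
    case True
    then show ?thesis
      using half_V_sq(2)[OF True] d(2)[OF True] neq_uminus
      unfolding order_x_poly[OF effective_half_divisor d(1)]
      by (simp add: lookup_half_divisor ram_index_def)
  next
    case False
    then show ?thesis
      unfolding order_x_poly[OF effective_half_divisor d(1)]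
      by (simp add: lookup_half_divisor order_0I)
  qed
  moreover have "ram_index d > 0" by (simp add: ram_index_def)
  ultimately show "Polynomial.order c (x_poly (half_divisor g a b r)) = Polynomial.order c (half_U g a r)"
    by simp
qed

text \<open>\<open>V\<close> and \<open>A\<close> agree modulo \<open>U\<close>, and \<open>A\<^sup>2 - f\<close> is a multiple of \<open>U\<^sup>2\<close>.\<close>

lemma half_U_dvd: "half_U g a r dvd (half_V g a b r)\<^sup>2 - f"
proof -
  define s where "s = Polynomial.smult (esym g r 1 * (- 1) ^ g) (half_U g a r)"
  have "half_U g a r dvd s" unfolding s_def by (rule dvd_smult) simp
  moreover have V: "half_V g a b r = half_A g a b r - s" by (simp add: half_A_def s_def)
  have "(half_V g a b r)\<^sup>2 - f = s * (s - 2 * half_A g a b r) - [:- a, 1:] * half_U g a r * half_U g a r"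
    by (subst half_norm_eq, subst V) (simp add: power2_eq_square algebra_simps)
  ultimately show ?thesis by (simp add: dvd_diff)
qed

text \<open>
  At a zero \<open>c\<close> of \<open>U\<close> the point is not a branch point, so \<open>U\<close> has the order of \<open>c\<close> as a root. If
  \<open>y - V\<close> vanishes too, it has the order of \<open>V\<^sup>2 - f\<close>, which \<open>U\<close> divides.
\<close>

lemma half_gcd:
  assumes Q: "Q \<in> curve f - {Infty}"
  shows "Poly_Mapping.lookup (half_divisor g a b r) Q =
    min (ord_at f Q (fn_of_poly (half_U g a r))) (ord_at f Q (fn_y f - fn_of_poly (half_V g a b r)))"
proof -
  let ?U = "half_U g a r" and ?V = "half_V g a b r"
  obtain c d where cd: "Q = Aff c d" "Aff c d \<in> curve f" using Q by (cases Q) auto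
  have nz: "- ?V \<noteq> 0 \<or> (1 :: 'a poly) \<noteq> 0" by simp
  have nonneg: "ord_at f (Aff c d) (curve_fn f (- ?V) 1) \<ge> 0"
    by (rule ord_Aff_curve_fn_nonneg[OF cd(2) nz])
  show ?thesis
  proof (cases "poly ?U c = 0")
    case False
    then show ?thesis
      using nonneg unfolding cd(1) fn_y_minus_poly ord_Aff_poly[OF cd(2) half_U_nz]
      by (simp add: lookup_half_divisor order_0I)
  next
    case True
    have "d \<noteq> 0"
      using cd(2) half_V_sq[OF True] by (auto simp: Aff_in_curve)
    then have ordU: "ord_at f (Aff c d) (fn_of_poly ?U) = int (Polynomial.order c ?U)"
      using ord_Aff_poly[OF cd(2) half_U_nz] by (simp add: ram_index_def)
    show ?thesis
    proof (cases "d = poly ?V c")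
      case False
      then have "ord_at f (Aff c d) (curve_fn f (- ?V) 1) = 0"
        using ord_Aff_curve_fn_pos_iff[OF cd(2) nz] nonneg by simp
      then show ?thesis
        using False unfolding cd(1) fn_y_minus_poly ordU by (simp add: lookup_half_divisor)
    next
      case d: True
      have N: "curve_norm f (- ?V) 1 = ?V\<^sup>2 - f" by (simp add: curve_norm_def)
      have "[:- c, 1:] ^ Polynomial.order c ?U dvd curve_norm f (- ?V) 1"
        unfolding N using order_1 half_U_dvd by (rule dvd_trans)
      then have le: "Polynomial.order c ?U \<le> Polynomial.order c (curve_norm f (- ?V) 1)"
        unfolding order_divides using nz curve_norm_zero_iff by blast
      have "poly (- ?V) c - poly 1 c * d = - (d + d)" using d by simp
      then have "poly (- ?V) c - poly 1 c * d \<noteq> 0"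
        using \<open>d \<noteq> 0\<close> double_eq_0_iff[of d] by simp
      then have "ord_at f (Aff c d) (curve_fn f (- ?V) 1) = int (Polynomial.order c (curve_norm f (- ?V) 1))"
        using ord_Aff_curve_fn_norm[OF cd(2)] \<open>d \<noteq> 0\<close> by (simp add: ram_index_def)
      then show ?thesis
        using le d unfolding cd(1) fn_y_minus_poly ordU by (simp add: lookup_half_divisor)
    qed
  qed
qed

text \<open>
  Along \<open>D\<close> both \<open>y - V\<close> and \<open>y - V'\<close> vanish, hence so does \<open>V - V'\<close>. As \<open>D\<close> contains no branch
  points, \<open>U\<close> divides \<open>V - V'\<close>.
\<close>

lemma mumford_V_unique:
  assumes V: "V = 0 \<or> Polynomial.degree V < Polynomial.degree (half_U g a r)"
    and ord: "\<And>Q. Q \<in> curve f - {Infty} \<Longrightarrow> Poly_Mapping.lookup (half_divisor g a b r) Q =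
      min (ord_at f Q (fn_of_poly (half_U g a r))) (ord_at f Q (fn_y f - fn_of_poly V))"
  shows "V = half_V g a b r"
proof (rule ccontr)
  let ?U = "half_U g a r" and ?V = "half_V g a b r"
  assume neq: "V \<noteq> ?V"
  define p where "p = ?V - V"
  have p: "p \<noteq> 0" using neq by (simp add: p_def)
  have le: "Polynomial.order c ?U \<le> Polynomial.order c p" for c
  proof (cases "poly ?U c = 0")
    case False
    then show ?thesis by (simp add: order_0I)
  next
    case True
    define d where "d = poly ?V c"
    have Q: "Aff c d \<in> curve f" and d: "d \<noteq> 0"
      using half_V_sq[OF True] by (simp_all add: d_def Aff_in_curve)
    have FF: "fn_y f - fn_of_poly V \<in> FF" "fn_y f - fn_of_poly ?V \<in> FF" "- (fn_y f - fn_of_poly ?V) \<in> FF"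
      unfolding fn_y_minus_poly by (intro FF_uminus curve_fn_FF, simp)+
    have eq: "(fn_y f - fn_of_poly V) + - (fn_y f - fn_of_poly ?V) = fn_of_poly p"
      by (simp add: p_def fn.hom_diff)
    have "int (Polynomial.order c ?U) \<le> ord_at f (Aff c d) (fn_y f - fn_of_poly V)"
      "int (Polynomial.order c ?U) \<le> ord_at f (Aff c d) (- (fn_y f - fn_of_poly ?V))"
      using ord[of "Aff c d"] half_gcd[of "Aff c d"] Q ord_uminus[OF Q FF(2)]
      by (simp_all add: lookup_half_divisor flip: d_def)
    then have "int (Polynomial.order c ?U) \<le> ord_at f (Aff c d) (fn_of_poly p)"
      using ord_add_ge[OF Q FF(1,3)] poly_FF[OF p] unfolding eq by simp
    then show ?thesis
      using ord_Aff_poly[OF Q p] d by (simp add: ram_index_def)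
  qed
  have "proots ?U \<subseteq># proots p"
    using le p half_U_nz by (intro mset_subset_eqI) simp
  then have "Polynomial.degree ?U \<le> Polynomial.degree p"
    using size_mset_mono alg_closed_proots(1)[OF p] alg_closed_proots(1)[OF half_U_nz] by metis
  moreover have "Polynomial.degree V < g"
    using V genus_pos half_U_monic(1)[OF genus_pos, of a r] by auto
  then have "Polynomial.degree p < g"
    unfolding p_def using degree_half_V[OF genus_pos] by (intro degree_diff_less)
  ultimately show False
    using half_U_monic(1)[OF genus_pos, of a r] by simp
qed

lemma mumford_rep_half_class_iff:
  "mumford_rep f (half_class f g a b r) U V \<longleftrightarrow> U = half_U g a r \<and> V = half_V g a b r"
proof
  assume "mumford_rep f (half_class f g a b r) U V"
  then have "U = x_poly (half_divisor g a b r)" "V = 0 \<or> Polynomial.degree V < Polynomial.degree U"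
    "\<forall>Q\<in>curve f - {Infty}. Poly_Mapping.lookup (half_divisor g a b r) Q =
        min (ord_at f Q (fn_of_poly U)) (ord_at f Q (fn_y f - fn_of_poly V))"
    unfolding mumford_rep_def reduced_rep_half_class_iff x_poly_def by blast+
  then show "U = half_U g a r \<and> V = half_V g a b r"
    using mumford_V_unique unfolding x_poly_half_divisor by blast
next
  assume "U = half_U g a r \<and> V = half_V g a b r"
  then show "mumford_rep f (half_class f g a b r) U V"
    unfolding mumford_rep_def reduced_rep_half_class_iff x_poly_def[symmetric]
    using x_poly_half_divisor half_U_dvd half_gcd degree_half_V[OF genus_pos, of a b r]
      half_U_monic(1)[OF genus_pos, of a r] by auto
qed

lemma half_double:
  assumes "Aff a b \<in> curve f"
  shows "minus_infty (half_divisor g a b r) + minus_infty (half_divisor g a b r)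
    - (frag_of (Aff a b) - frag_of Infty) \<in> Prin"
  using half_square_root_pair[OF r] assms effective_half_divisor degree_half_divisor lookup_half_divisor_Aff
  by (rule double_eq_point)

lemma half_class_halves: "Aff a b \<in> curve f \<Longrightarrow> half_class f g a b r \<in> halves f (Aff a b)"
  unfolding halves_iff half_class_eq using half_double minus_infty_Div0[OF effective_half_divisor] by blast

lemma root_eq_U_V:
  assumes "i \<in> {1..2*g+1}"
  shows "r i = esym g r 1 + (- 1) ^ g * (poly (half_V g a b r) (\<alpha> i) / poly (half_U g a r) (\<alpha> i))"
proof -
  have "poly f (\<alpha> i) = 0" using assms poly_f_eq_0_iff by blast
  then have U: "poly (half_U g a r) (\<alpha> i) \<noteq> 0"
    by (rule square_root_pair_coprime[OF half_square_root_pair[OF r]])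
  have s: "(- 1 :: 'a) ^ g * (- 1) ^ g = 1" by (simp flip: power_mult_distrib)
  have "r i = (- 1) ^ g * (poly (half_A g a b r) (\<alpha> i) / poly (half_U g a r) (\<alpha> i))"
    by (rule root_eq_half_quotient[OF r assms])
  also have "poly (half_A g a b r) (\<alpha> i) / poly (half_U g a r) (\<alpha> i) =
      poly (half_V g a b r) (\<alpha> i) / poly (half_U g a r) (\<alpha> i) + esym g r 1 * (- 1) ^ g"
    using U by (simp add: half_A_def add_divide_distrib)
  also have "(- 1) ^ g * (poly (half_V g a b r) (\<alpha> i) / poly (half_U g a r) (\<alpha> i) + esym g r 1 * (- 1) ^ g)
      = esym g r 1 * ((- 1) ^ g * (- 1) ^ g) + (- 1) ^ g * (poly (half_V g a b r) (\<alpha> i) / poly (half_U g a r) (\<alpha> i))"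
    by (simp only: distrib_left add.commute mult.left_commute)
  finally show ?thesis by (simp add: s)
qed

end

text \<open>
  Equal pairs \<open>(U, V)\<close> give tuples that differ by a constant \<open>\<delta>\<close>. If \<open>\<delta> \<noteq> 0\<close>, comparing squares
  yields \<open>r'\<^sub>i = - \<delta> / 2\<close> for all \<open>i\<close>, and all \<open>\<alpha>\<^sub>i\<close> would be equal.
\<close>

lemma half_class_inj: "inj_on (half_class f g a b) (root_tuples g \<alpha> a b)"
proof (rule inj_onI)
  fix r r' assume r: "r \<in> root_tuples g \<alpha> a b" and r': "r' \<in> root_tuples g \<alpha> a b"
    and eq: "half_class f g a b r = half_class f g a b r'"
  have "mumford_rep f (half_class f g a b r) (half_U g a r) (half_V g a b r)"
    using mumford_rep_half_class_iff[OF r] by simp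
  then have UV: "half_U g a r' = half_U g a r" "half_V g a b r' = half_V g a b r"
    unfolding eq mumford_rep_half_class_iff[OF r'] by simp_all
  define \<delta> where "\<delta> = esym g r 1 - esym g r' 1"
  have diff: "r i = r' i + \<delta>" if "i \<in> {1..2*g+1}" for i
    using root_eq_U_V[OF r that] root_eq_U_V[OF r' that] by (simp add: UV \<delta>_def)
  have sq: "(r i)\<^sup>2 = a - \<alpha> i" "(r' i)\<^sup>2 = a - \<alpha> i" if "i \<in> {1..2*g+1}" for i
    using r r' that unfolding root_tuples_def by blast+
  have "\<delta> = 0"
  proof (rule ccontr)
    assume \<delta>: "\<delta> \<noteq> 0"
    have val: "r' i + r' i = - \<delta>" if i: "i \<in> {1..2*g+1}" for i
    proof -
      have "\<delta> * (r' i + r' i + \<delta>) = (r' i + \<delta>)\<^sup>2 - (r' i)\<^sup>2"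
        by (simp add: power2_eq_square algebra_simps)
      also have "\<dots> = 0" using sq[OF i] diff[OF i] by simp
      finally show ?thesis using \<delta> by (simp add: eq_neg_iff_add_eq_0)
    qed
    have mem: "1 \<in> {1..2*g+1}" "2 \<in> {1..2*g+1}" using genus_pos by auto
    have "(r' 1 - r' 2) + (r' 1 - r' 2) = 0"
      using val[OF mem(1)] val[OF mem(2)] by (simp add: algebra_simps)
    then have "r' 1 = r' 2" unfolding double_eq_0_iff right_minus_eq .
    then have "\<alpha> 1 = \<alpha> 2" using sq(2)[OF mem(1)] sq(2)[OF mem(2)] by simp
    then show False using inj_onD[OF inj _ mem] by simp
  qed
  then have "r i = r' i" if "i \<in> {1..2*g+1}" for i using diff[OF that] by simp
  moreover have "r \<in> extensional {1..2*g+1}" "r' \<in> extensional {1..2*g+1}"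
    using r r' unfolding root_tuples_def PiE_def by blast+
  ultimately show "r = r'" by (intro extensionalityI)
qed

text \<open>
  A half \<open>D - m\<infinity>\<close> of \<open>P\<close> with \<open>m \<le> g\<close> makes \<open>2D + \<iota>P - (2m + 1)\<infinity>\<close> the divisor of a regular
  function \<open>A + B y\<close>. Its pole order is odd, so \<open>y\<close> occurs, which needs a pole of order at least
  \<open>2g + 1\<close>. Hence \<open>m = g\<close>, \<open>B\<close> is constant, and the norm of the function exhibits \<open>f - A\<^sup>2\<close>
  as \<open>x - a\<close> times a square.
\<close>

lemma halves_are_half_classes:
  assumes P: "Aff a b \<in> curve f" and H: "\<A> \<in> halves f (Aff a b)"
  shows "\<exists>r\<in>root_tuples g \<alpha> a b. \<A> = half_class f g a b r"
proof -
  let ?l = Poly_Mapping.lookup and ?P = "frag_of (Aff a b)"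
  obtain D where D: "D \<in> carrier Div0" "\<A> = cl f D" "D + D - (?P - frag_of Infty) \<in> Prin"
    using H unfolding halves_iff by blast
  obtain E where E: "effective E" "div_degree E \<le> int g" "cl f D = cl f (minus_infty E)"
    using effective_representative[OF D(1)] by blast
  have "minus_infty E - D \<in> Prin" using E(3) cl_eq_iff by metis
  then have "(minus_infty E - D) + (minus_infty E - D) + (D + D - (?P - frag_of Infty)) \<in> Prin"
    by (intro Prin_add D(3))
  then have "minus_infty E + minus_infty E - (?P - frag_of Infty) \<in> Prin"
    by (simp add: algebra_simps)
  then obtain h where h: "h \<in> FF" "minus_infty E + minus_infty E - (?P - frag_of Infty) = dvs h"
    unfolding principal_divisors_eq by blast
  have ordh: "ord_at f Q h = ?l (minus_infty E) Q + ?l (minus_infty E) Q - (?l ?P Q - ?l (frag_of Infty) Q)"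
    if "Q \<in> curve f" for Q
    using arg_cong[OF h(2), of "\<lambda>D. ?l D Q"] that by (simp add: lookup_dvs[OF h(1)] lookup_add lookup_minus)
  define k where "k = h * fn_of_poly (x_poly ?P)"
  have k: "k \<in> FF" unfolding k_def by (intro FF_mult h poly_FF x_poly_nz)
  have ordk: "ord_at f Q k = ord_at f Q h + ord_at f Q (fn_of_poly (x_poly ?P))" if "Q \<in> curve f" for Q
    unfolding k_def by (intro ord_mult that h poly_FF x_poly_nz)
  have aff: "ord_at f (Aff c d) k = 2 * ?l E (Aff c d) + (if c = a \<and> d = - b then 1 else 0)"
    if "Aff c d \<in> curve f" for c d
  proof -
    have eq: "(- d = b) = (d = - b)" by auto
    show ?thesis
      using ordk[OF that] ordh[OF that] ord_x_poly[OF effective_frag_of[OF P] that] E(1)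
      by (simp add: lookup_minus_infty eq)
  qed
  have inf: "ord_at f Infty k = - (2 * div_degree E + 1)"
    using ordk[OF Infty_in_curve] ordh[OF Infty_in_curve] ord_Infty_x_poly[OF effective_frag_of[OF P]] E(1)
    by (simp add: lookup_minus_infty div_degree_frag_of)
  have nonneg: "ord_at f Q k \<ge> 0" if "Q \<in> curve f - {Infty}" for Q
    using that aff E(1) by (cases Q) (auto simp: effective_def)
  obtain A0 B where AB: "A0 \<noteq> 0 \<or> B \<noteq> 0" "k = curve_fn f A0 B"
    using regular_function[OF k nonneg] by metis
  have degN: "int (Polynomial.degree (curve_norm f A0 B)) = 2 * div_degree E + 1"
    using inf ord_Infty_curve_fn[OF AB(1)] AB(2) by simp
  have "B \<noteq> 0"
  proof
    assume "B = 0"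
    then have "2 * int (Polynomial.degree A0) = 2 * div_degree E + 1"
      using degN by (simp add: degree_curve_norm)
    then show False by presburger
  qed
  then have max: "max (2 * int (Polynomial.degree A0)) (2 * int (Polynomial.degree B) + 2 * int g + 1) = 2 * div_degree E + 1"
    using degN by (simp add: degree_curve_norm of_nat_max)
  then have "div_degree E = int g" "Polynomial.degree B = 0" "Polynomial.degree A0 \<le> g"
    using E(2) by linarith+
  note degs = this
  obtain \<beta> where \<beta>: "B = [:\<beta>:]" "\<beta> \<noteq> 0"
    using degs(2) \<open>B \<noteq> 0\<close> by (metis degree_eq_zeroE pCons_eq_0_iff)
  define A where "A = - Polynomial.smult (inverse \<beta>) A0"
  have degA: "Polynomial.degree A \<le> g"
    using degs(3) degree_smult_le[of "inverse \<beta>" A0] by (simp add: A_def)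
  have "k = const_fn \<beta> * curve_fn f (- A) 1"
    using curve_fn_smult[of \<beta> "- A" 1] \<beta> AB(2) by (simp add: A_def one_pCons)
  then have ordA: "ord_at f Q (curve_fn f (- A) 1) = ord_at f Q k" if "Q \<in> curve f" for Q
    using ord_mult[OF that poly_FF[of "[:\<beta>:]"] curve_fn_FF[of "- A" 1]] ord_const[OF that \<beta>(2)] \<beta>(2) by simp
  note affA = ordA[unfolded aff]
  define U where "U = x_poly E"
  have U: "Polynomial.degree U = g" "lead_coeff U = 1" "U \<noteq> 0"
    using degree_x_poly[of E] E(1) degs(1) monic_x_poly[of E] x_poly_nz[of E]
    by (auto simp: U_def effective_def)
  have ordN: "Polynomial.order c (f - A\<^sup>2) = (if c = a then 1 else 0) + 2 * Polynomial.order c U" for c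
  proof -
    obtain d where d: "d\<^sup>2 = poly f c" using fiber_ex by blast
    have Q: "Aff c d \<in> curve f" "Aff c (- d) \<in> curve f" using d by (simp_all add: Aff_in_curve)
    have da: "d = b \<or> d = - b" if "c = a"
      using d P that by (simp add: Aff_in_curve power2_eq_iff[symmetric])
    have "f - A\<^sup>2 = - curve_norm f (- A) 1" by (simp add: curve_norm_def)
    then have "int (Polynomial.order c (f - A\<^sup>2)) = (\<Sum>Q\<in>fiber c. ord_at f Q (curve_fn f (- A) 1))"
      using sum_fiber_ord[of "- A" 1 c] by simp
    also have "\<dots> = (if c = a then 1 else 0) + 2 * int (Polynomial.order c U)"
    proof (cases "d = 0")
      case True
      then have "int (ram_index 0 * Polynomial.order c U) = 2 * ?l E (Aff c 0)"
        using order_x_poly[OF E(1) d] by (simp add: U_def)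
      then show ?thesis
        unfolding sum_fiber[OF d] using True Q ordA[OF Q(1)] aff[OF Q(1)] da by (auto simp: ram_index_def)
    next
      case False
      then have "int (Polynomial.order c U) = ?l E (Aff c d) + ?l E (Aff c (- d))"
        using order_x_poly[OF E(1) d] by (simp add: U_def ram_index_def)
      moreover have "(if c = a \<and> d = - b then 1 else 0) + (if c = a \<and> - d = - b then 1 else (0 :: int)) = (if c = a then 1 else 0)"
        using da False neq_uminus[of d] by auto
      ultimately show ?thesis
        unfolding sum_fiber[OF d] using False ordA[OF Q(1)] ordA[OF Q(2)] aff[OF Q(1)] aff[OF Q(2)] by simp
    qed
    finally show ?thesis by (simp add: of_nat_eq_iff[symmetric, where ?'a = int] del: of_nat_eq_iff)
  qed
  have degA2: "Polynomial.degree (- (A\<^sup>2)) < Polynomial.degree f"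
    using degA degree_power_le[of A 2] by (simp add: degree_f)
  have "f - A\<^sup>2 = [:- a, 1:] * U\<^sup>2"
  proof (rule monic_poly_eqI_order)
    have "lead_coeff (- (A\<^sup>2) + f) = 1"
      by (subst lead_coeff_add_le[OF degA2]) (rule monic_f)
    then show "lead_coeff (f - A\<^sup>2) = 1" by simp
    show "lead_coeff ([:- a, 1:] * U\<^sup>2) = 1"
      unfolding lead_coeff_mult lead_coeff_power U(2) by simp
    show "Polynomial.order c (f - A\<^sup>2) = Polynomial.order c ([:- a, 1:] * U\<^sup>2)" for c
      using U(3) unfolding ordN by (simp add: order_linear order_mult power2_eq_square del: mult_pCons_left)
  qed
  then have f: "f = A\<^sup>2 + [:- a, 1:] * U\<^sup>2" by (simp add: algebra_simps)
  have Q: "Aff a (- b) \<in> curve f" using P by (simp add: Aff_in_curve)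
  have "ord_at f (Aff a (- b)) (curve_fn f (- A) 1) \<ge> 1"
    using ordA[OF Q] aff[OF Q] E(1) by (simp add: effective_def)
  then have "- poly A a = b"
    using ord_Aff_curve_fn_pos_iff[OF Q, of "- A" 1] by (simp add: add_eq_0_iff)
  then have "poly A a = - b" by (metis minus_minus)
  with f U degA have p: "square_root_pair a b U A" unfolding square_root_pair_def by blast
  obtain r where r: "r \<in> root_tuples g \<alpha> a b" "U = half_U g a r" "A = half_A g a b r"
    using square_root_pair_ex_tuple[OF p] by blast
  have "E = half_divisor g a b r"
  proof (rule poly_mapping_eqI)
    fix Q
    show "?l E Q = ?l (half_divisor g a b r) Q"
    proof (cases "Q \<in> curve f - {Infty}")
      case True
      then obtain c d where cd: "Q = Aff c d" "Aff c d \<in> curve f" by (cases Q) auto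
      then show ?thesis
        using ordA[OF cd(2)] aff[OF cd(2)] ord_y_minus_square_root[OF p cd(2)]
          lookup_half_divisor_Aff[OF r(1), of c d] r by simp
    next
      case False
      then have "Q \<notin> Poly_Mapping.keys E" "Q \<notin> Poly_Mapping.keys (half_divisor g a b r)"
        using E(1) effective_half_divisor[OF r(1)] unfolding effective_def by blast+
      then show ?thesis by (simp add: in_keys_iff)
    qed
  qed
  then show ?thesis
    using r(1) half_class_eq[OF r(1)] D(2) E(3) by metis
qed

lemma half_class_bij:
  assumes "Aff a b \<in> curve f"
  shows "bij_betw (half_class f g a b) (root_tuples g \<alpha> a b) (halves f (Aff a b))"
  unfolding bij_betw_def
  using half_class_inj half_class_halves[OF _ assms] halves_are_half_classes[OF assms] by blast

text \<open>
  At most one of the \<open>a - \<alpha>\<^sub>i\<close> vanishes, say for \<open>i = k\<close> if any does. The other \<open>2g\<close> square roots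
  can be chosen freely, and the condition on the product determines \<open>r\<^sub>k\<close>.
\<close>

lemma card_root_tuples:
  assumes P: "Aff a b \<in> curve f"
  shows "card (root_tuples g \<alpha> a b) = 2 ^ (2 * g)"
proof -
  define I where "I = {1..2*g+1}"
  have I: "finite I" "card I = 2 * g + 1" by (simp_all add: I_def)
  obtain k where k: "k \<in> I" "\<And>i. i \<in> I - {k} \<Longrightarrow> a - \<alpha> i \<noteq> 0"
  proof (cases "\<exists>k\<in>I. a = \<alpha> k")
    case True
    then obtain k where "k \<in> I" "a = \<alpha> k" by blast
    then show thesis
      using inj by (intro that[of k]) (auto simp: I_def inj_on_def)
  next
    case False
    moreover have "1 \<in> I" by (simp add: I_def)
    ultimately show thesis
      by (intro that[of 1]) auto
  qed
  define J where "J = I - {k}"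
  have J: "finite J" "card J = 2 * g" "insert k J = I" "k \<notin> J" using I k(1) by (auto simp: J_def)
  have prod_I: "(\<Prod>i\<in>I. F i) = F k * (\<Prod>i\<in>J. F i)" for F :: "nat \<Rightarrow> 'a"
    using J by (metis prod.insert)
  define S where "S = (\<lambda>i. {z. z\<^sup>2 = a - \<alpha> i})"
  have tuples: "r \<in> root_tuples g \<alpha> a b \<longleftrightarrow>
      r \<in> extensional I \<and> (\<forall>i\<in>I. (r i)\<^sup>2 = a - \<alpha> i) \<and> (\<Prod>i\<in>I. r i) = - b" for r
    unfolding root_tuples_def I_def[symmetric] by (auto simp: PiE_def)
  have nz: "(\<Prod>i\<in>J. s i) \<noteq> 0" if "\<And>i. i \<in> J \<Longrightarrow> (s i)\<^sup>2 = a - \<alpha> i" for s :: "nat \<Rightarrow> 'a"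
    using that k(2) J(1) by (subst prod_zero_iff) (force simp: J_def)+
  define \<phi> where "\<phi> = (\<lambda>r :: nat \<Rightarrow> 'a. restrict r J)"
  define \<psi> where "\<psi> = (\<lambda>s :: nat \<Rightarrow> 'a. s(k := - b / (\<Prod>i\<in>J. s i)))"
  have \<psi>_prod: "(\<Prod>i\<in>J. \<psi> s i) = (\<Prod>i\<in>J. s i)" for s
    using J(4) by (intro prod.cong) (auto simp: \<psi>_def)
  have "bij_betw \<phi> (root_tuples g \<alpha> a b) (PiE J S)"
  proof (rule bij_betw_byWitness[where f' = \<psi>])
    show "\<forall>r\<in>root_tuples g \<alpha> a b. \<psi> (\<phi> r) = r"
    proof
      fix r assume "r \<in> root_tuples g \<alpha> a b"
      then have r: "r \<in> extensional I" "\<And>i. i \<in> I \<Longrightarrow> (r i)\<^sup>2 = a - \<alpha> i" "r k * (\<Prod>i\<in>J. r i) = - b"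
        unfolding tuples prod_I by blast+
      have "(\<Prod>i\<in>J. r i) \<noteq> 0" using r(2) J(3) by (intro nz) auto
      then have "r k = - b / (\<Prod>i\<in>J. r i)" using r(3) by (simp add: field_simps)
      moreover have "r i = undefined" if "i \<notin> I" for i using r(1) that by (simp add: extensional_def)
      ultimately show "\<psi> (\<phi> r) = r"
        using J(3) by (auto simp: \<psi>_def \<phi>_def fun_eq_iff)
    qed
    show "\<forall>s\<in>PiE J S. \<phi> (\<psi> s) = s"
      using J(4) by (auto simp: \<psi>_def \<phi>_def fun_eq_iff PiE_def extensional_def)
    show "\<phi> ` root_tuples g \<alpha> a b \<subseteq> PiE J S"
      using J(3) by (auto simp: \<phi>_def S_def tuples)
    show "\<psi> ` PiE J S \<subseteq> root_tuples g \<alpha> a b"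
    proof (rule image_subsetI)
      fix s assume s: "s \<in> PiE J S"
      then have sq: "\<And>i. i \<in> J \<Longrightarrow> (s i)\<^sup>2 = a - \<alpha> i" by (auto simp: S_def)
      have "b\<^sup>2 = (\<Prod>i\<in>I. a - \<alpha> i)"
        using P unfolding Aff_in_curve poly_f I_def .
      also have "\<dots> = (a - \<alpha> k) * (\<Prod>i\<in>J. s i)\<^sup>2"
        unfolding prod_I prod_power_distrib
        using sq by (intro arg_cong2[of _ _ _ _ "(*)"] prod.cong) simp_all
      finally have b: "b\<^sup>2 = (a - \<alpha> k) * (\<Prod>i\<in>J. s i)\<^sup>2" .
      have nz': "(\<Prod>i\<in>J. s i) \<noteq> 0" using sq by (rule nz)
      have "(\<psi> s i)\<^sup>2 = a - \<alpha> i" if "i \<in> I" for i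
        using that sq J(3) b nz' by (auto simp: \<psi>_def power_divide)
      moreover have "(\<Prod>i\<in>I. \<psi> s i) = - b"
        unfolding prod_I \<psi>_prod using nz' by (simp add: \<psi>_def)
      moreover have "\<psi> s \<in> extensional I"
        using s J(3) by (auto simp: \<psi>_def PiE_def extensional_def)
      ultimately show "\<psi> s \<in> root_tuples g \<alpha> a b"
        unfolding tuples by blast
    qed
  qed
  then have "card (root_tuples g \<alpha> a b) = card (PiE J S)" by (rule bij_betw_same_card)
  also have "\<dots> = (\<Prod>i\<in>J. card (S i))" by (rule card_PiE[OF J(1)])
  also have "\<dots> = (\<Prod>i\<in>J. 2)"
  proof (rule prod.cong[OF refl])
    fix i assume "i \<in> J"
    then have "a - \<alpha> i \<noteq> 0" using k(2) by (simp add: J_def)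
    obtain t where t: "t\<^sup>2 = a - \<alpha> i" using sqrt_ex by blast
    then have "S i = {t, - t}" by (auto simp: S_def power2_eq_iff t[symmetric])
    moreover have "- t \<noteq> t" using t \<open>a - \<alpha> i \<noteq> 0\<close> by (intro neq_uminus) auto
    ultimately show "card (S i) = 2" by auto
  qed
  finally show ?thesis using J(2) by simp
qed

end

theorem theorem3p2:
  fixes g :: nat and \<alpha> :: "nat \<Rightarrow> 'a::alg_closed_field" and a b :: 'a and f :: "'a poly"
  assumes "CHAR('a) \<noteq> 2"
    and "g \<ge> 1"
    and "inj_on \<alpha> {1..2*g+1}"
    and "f = (\<Prod>i=1..2*g+1. [:- \<alpha> i, 1:])"
    and "Aff a b \<in> curve f"
  shows "card (halves f (Aff a b)) = 2 ^ (2*g)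
    \<and> bij_betw (half_class f g a b) (root_tuples g \<alpha> a b) (halves f (Aff a b))
    \<and> (\<forall>r\<in>root_tuples g \<alpha> a b.
         (\<forall>U V. mumford_rep f (half_class f g a b r) U V \<longleftrightarrow>
                U = half_U g a r \<and> V = half_V g a b r)
       \<and> size (proots (half_U g a r)) = g
       \<and> (\<forall>c\<in>#proots (half_U g a r). Aff c (poly (half_V g a b r) c) \<in> curve f)
       \<and> (\<forall>D. reduced_rep f (half_class f g a b r) D \<longleftrightarrow> D = half_divisor g a b r)
       \<and> half_class f g a b r [^]\<^bsub>jacobian f\<^esub> (2::nat) = point_class f (Aff a b)
       \<and> (\<forall>i\<in>{1..2*g+1}. poly (half_U g a r) (\<alpha> i) \<noteq> 0)
       \<and> coprime (half_U g a r) f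
       \<and> (\<forall>i\<in>{1..2*g+1}. r i = esym g r 1
            + (-1) ^ g * (poly (half_V g a b r) (\<alpha> i) / poly (half_U g a r) (\<alpha> i))))"
proof -
  interpret hyperelliptic g \<alpha> f
    using assms(1-4) by unfold_locales
  note P = assms(5)
  show ?thesis
  proof (intro conjI ballI allI)
    show bij: "bij_betw (half_class f g a b) (root_tuples g \<alpha> a b) (halves f (Aff a b))"
      by (rule half_class_bij[OF P])
    show "card (halves f (Aff a b)) = 2 ^ (2*g)"
      using bij_betw_same_card[OF bij] card_root_tuples[OF P] by simp
  next
    fix r assume r: "r \<in> root_tuples g \<alpha> a b"
    show "mumford_rep f (half_class f g a b r) U V \<longleftrightarrow> U = half_U g a r \<and> V = half_V g a b r" for U V
      by (rule mumford_rep_half_class_iff[OF r])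
    show "size (proots (half_U g a r)) = g"
      using alg_closed_proots(1)[OF half_U_nz[OF r]] half_U_monic(1)[OF genus_pos] by simp
    show "Aff c (poly (half_V g a b r) c) \<in> curve f" if "c \<in># proots (half_U g a r)" for c
      using that half_V_sq(1)[OF r] half_U_nz[OF r] by (simp add: Aff_in_curve)
    show "reduced_rep f (half_class f g a b r) D \<longleftrightarrow> D = half_divisor g a b r" for D
      by (rule reduced_rep_half_class_iff[OF r])
    show "half_class f g a b r [^]\<^bsub>jacobian f\<^esub> (2::nat) = point_class f (Aff a b)"
      using half_class_halves[OF r P] by (simp add: halves_def)
    have common: "poly (half_U g a r) c \<noteq> 0" if "poly f c = 0" for c
      using square_root_pair_coprime[OF half_square_root_pair[OF r] that] .
    show "poly (half_U g a r) (\<alpha> i) \<noteq> 0" if "i \<in> {1..2*g+1}" for i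
      using that by (intro common) (metis imageI poly_f_eq_0_iff)
    show "coprime (half_U g a r) f"
    proof (rule coprimeI)
      fix p assume p: "p dvd half_U g a r" "p dvd f"
      have "Polynomial.degree p = 0"
      proof (rule ccontr)
        assume "Polynomial.degree p \<noteq> 0"
        then obtain c where "poly p c = 0" using alg_closed_imp_poly_has_root by blast
        then have "poly (half_U g a r) c = 0" "poly f c = 0"
          using p by (auto elim!: dvdE)
        then show False using common by blast
      qed
      moreover have "p \<noteq> 0" using p(2) f_nz by auto
      ultimately show "is_unit p" by (simp add: is_unit_iff_degree)
    qed
    show "r i = esym g r 1 + (-1) ^ g * (poly (half_V g a b r) (\<alpha> i) / poly (half_U g a r) (\<alpha> i))"
      if "i \<in> {1..2*g+1}" for i
      by (rule root_eq_U_V[OF r that])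
  qed
qed

end
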